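(* Let $G$ be a countable ICC group and let $\pi:G\to\mathcal U(\mathcal H)$ be a unitary representation of $G$ on the Hilbert space $\mathcal H$. Suppose there exists a Parseval frame vector $\xi\in\mathcal H$ for $\mathcal H$ with $\|\xi\|^2=\frac1N$, $N\in\mathbb Z$. Assume in addition that $H$ is a normal ICC subgroup of $G$ with index $[G:H]=N$, and that $H$ contains elements of infinite order. Then there exists a strongly disjoint $N$-tuple $\eta_1,\dots,\eta_N$ of Parseval frame vectors for $\mathcal H$ such that for all $i=1,\dots,N$, the family $\{\sqrt N\,\pi(h)\eta_i\,|\,h\in H\}$ is an orthonormal basis for $\mathcal H$.
   Context: A group $G$ is ICC if for every $g\ne e$ in $G$ the conjugacy class of $g$ is infinite. A family $\{e_i\,|\,i\in I\}$ in a Hilbert space $\mathcal K$ is a Parseval frame for $\mathcal K$ if $\|f\|^2=\sum_{i\in I}|\langle f,e_i\rangle|^2$ for all $f\in\mathcal K$. A vector $\xi\in\mathcal H$ is a Parseval frame vector for $\mathcal H$ (with the representation $\pi$ of $G$) if $\{\pi(g)\xi\,|\,g\in G\}$ (indexed by $G$) is a Parseval frame for $\mathcal H$. Parseval frame vectors $\eta_1,\dots,\eta_N$ for $\mathcal H$ form a strongly disjoint $N$-tuple if $\{\pi(g)\eta_1\oplus\dots\oplus\pi(g)\eta_N\,|\,g\in G\}$ is a Parseval frame for $\mathcal H^N=\mathcal H\oplus\dots\oplus\mathcal H$. *)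

theory Defs
  imports "HOL-Analysis.Analysis" "HOL-Algebra.Coset" "HOL-Algebra.Multiplicative_Group"
begin

text \<open>
  Complex inner product spaces. The inner product is linear in the first and conjugate-linear
  in the second argument. Positive definiteness is part of \<open>cinner_self\<close>, since the norm is the
  one of a normed space. The real scalar multiplication of \<open>real_normed_vector\<close> is the
  restriction of the complex one.
\<close>

class complex_inner = real_normed_vector +
  fixes scaleC :: "complex \<Rightarrow> 'a \<Rightarrow> 'a"  (infixr "*\<^sub>C" 75)
    and cinner :: "'a \<Rightarrow> 'a \<Rightarrow> complex"
  assumes scaleC_add_right: "a *\<^sub>C (x + y) = a *\<^sub>C x + a *\<^sub>C y"
    and scaleC_add_left: "(a + b) *\<^sub>C x = a *\<^sub>C x + b *\<^sub>C x"
    and scaleC_scaleC: "a *\<^sub>C b *\<^sub>C x = (a * b) *\<^sub>C x"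
    and scaleC_of_real: "complex_of_real r *\<^sub>C x = r *\<^sub>R x"
    and cinner_commute: "cinner x y = cnj (cinner y x)"
    and cinner_add_left: "cinner (x + y) z = cinner x z + cinner y z"
    and cinner_scaleC_left: "cinner (a *\<^sub>C x) y = a * cinner x y"
    and cinner_self: "cinner x x = complex_of_real ((norm x)\<^sup>2)"

class chilbert_space = complex_inner + complete_space

lemma vector_space_scaleC:
  "vector_space (scaleC :: complex \<Rightarrow> 'a::complex_inner \<Rightarrow> 'a)"
proof
  fix x :: 'a
  show "1 *\<^sub>C x = x"
    using scaleC_of_real [of 1 x] by simp
qed (simp_all add: scaleC_add_right scaleC_add_left scaleC_scaleC)

global_interpretation complex_vector: vector_space "scaleC :: complex \<Rightarrow> 'a::complex_inner \<Rightarrow> 'a"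
  defines cspan = complex_vector.span
  by (rule vector_space_scaleC)

text \<open>
  The Hilbert space direct sum of finitely many copies of a Hilbert space; the norm is the
  \<open>\<ell>\<^sup>2\<close>-norm already provided for \<open>vec\<close> by the library.
\<close>

instantiation vec :: (complex_inner, finite) complex_inner
begin

definition scaleC_vec_def: "a *\<^sub>C x = (\<chi> i. a *\<^sub>C (x $ i))"

definition cinner_vec_def: "cinner x y = (\<Sum>i\<in>UNIV. cinner (x $ i) (y $ i))"

instance
proof
  fix a b :: complex and r :: real and x y z :: "'a ^ 'b"
  show "a *\<^sub>C (x + y) = a *\<^sub>C x + a *\<^sub>C y"
    by (simp add: scaleC_vec_def vec_eq_iff scaleC_add_right)
  show "(a + b) *\<^sub>C x = a *\<^sub>C x + b *\<^sub>C x"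
    by (simp add: scaleC_vec_def vec_eq_iff scaleC_add_left)
  show "a *\<^sub>C b *\<^sub>C x = (a * b) *\<^sub>C x"
    by (simp add: scaleC_vec_def vec_eq_iff scaleC_scaleC)
  show "complex_of_real r *\<^sub>C x = r *\<^sub>R x"
    by (simp add: scaleC_vec_def vec_eq_iff scaleC_of_real)
  show "cinner x y = cnj (cinner y x)"
    by (simp add: cinner_vec_def cinner_commute [symmetric])
  show "cinner (x + y) z = cinner x z + cinner y z"
    by (simp add: cinner_vec_def cinner_add_left sum.distrib)
  show "cinner (a *\<^sub>C x) y = a * cinner x y"
    by (simp add: cinner_vec_def scaleC_vec_def cinner_scaleC_left sum_distrib_left)
  show "cinner x x = complex_of_real ((norm x)\<^sup>2)"
    by (simp add: cinner_vec_def cinner_self norm_vec_def L2_set_def sum_nonneg)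
qed

end

instance vec :: (chilbert_space, finite) chilbert_space ..


definition unitary_op :: "('h::chilbert_space \<Rightarrow> 'h) \<Rightarrow> bool" where
  "unitary_op U \<longleftrightarrow>
     Vector_Spaces.linear scaleC scaleC U \<and> surj U \<and> (\<forall>x y. cinner (U x) (U y) = cinner x y)"

definition unitary_group :: "('h::chilbert_space \<Rightarrow> 'h) monoid" where
  "unitary_group = \<lparr>carrier = {U. unitary_op U}, monoid.mult = (\<circ>), one = id\<rparr>"

definition unitary_representation ::
    "('g, 'm) monoid_scheme \<Rightarrow> ('g \<Rightarrow> 'h::chilbert_space \<Rightarrow> 'h) \<Rightarrow> bool" where
  "unitary_representation G \<pi> \<longleftrightarrow> \<pi> \<in> hom G unitary_group"

definition icc_group :: "('g, 'm) monoid_scheme \<Rightarrow> bool" where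
  "icc_group G \<longleftrightarrow> group G \<and>
     (\<forall>g \<in> carrier G. g \<noteq> \<one>\<^bsub>G\<^esub> \<longrightarrow>
        infinite {k \<otimes>\<^bsub>G\<^esub> g \<otimes>\<^bsub>G\<^esub> inv\<^bsub>G\<^esub> k | k. k \<in> carrier G})"

text \<open>Frames and bases are indexed families, so repeated vectors count with multiplicity.\<close>

definition parseval_frame :: "'i set \<Rightarrow> ('i \<Rightarrow> 'h::chilbert_space) \<Rightarrow> bool" where
  "parseval_frame I e \<longleftrightarrow> (\<forall>f. ((\<lambda>i. (cmod (cinner f (e i)))\<^sup>2) has_sum (norm f)\<^sup>2) I)"

definition orthonormal_basis :: "'i set \<Rightarrow> ('i \<Rightarrow> 'h::chilbert_space) \<Rightarrow> bool" where
  "orthonormal_basis I e \<longleftrightarrow>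
     (\<forall>i\<in>I. \<forall>j\<in>I. cinner (e i) (e j) = (if i = j then 1 else 0)) \<and>
     closure (cspan (e ` I)) = UNIV"

definition parseval_frame_vector ::
    "('g, 'm) monoid_scheme \<Rightarrow> ('g \<Rightarrow> 'h::chilbert_space \<Rightarrow> 'h) \<Rightarrow> 'h \<Rightarrow> bool" where
  "parseval_frame_vector G \<pi> \<xi> \<longleftrightarrow> parseval_frame (carrier G) (\<lambda>g. \<pi> g \<xi>)"

text \<open>An \<open>N\<close>-tuple is a family indexed by a finite type \<open>'n\<close> with \<open>N\<close> elements.\<close>

definition strongly_disjoint ::
    "('g, 'm) monoid_scheme \<Rightarrow> ('g \<Rightarrow> 'h::chilbert_space \<Rightarrow> 'h) \<Rightarrow> ('n::finite \<Rightarrow> 'h) \<Rightarrow> bool" where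
  "strongly_disjoint G \<pi> \<eta> \<longleftrightarrow>
     (\<forall>i. parseval_frame_vector G \<pi> (\<eta> i)) \<and>
     parseval_frame (carrier G) (\<lambda>g. (\<chi> i. \<pi> g (\<eta> i)) :: 'h ^ 'n)"

end

theory Submission
  imports Defs
begin

text \<open>
  The frame coefficients \<open>f \<mapsto> (\<langle>f, \<pi> g \<xi>\<rangle>)\<^sub>g\<close> embed \<open>\<H>\<close> as an invariant subspace into the regular
  representation \<open>\<ell>\<^sup>2(G)\<close>, and the trace of the projection onto the image is \<open>\<parallel>\<xi>\<parallel>\<^sup>2 = 1/N\<close>. This trace
  is a dimension. For an ICC group it determines the representation up to isomorphism
  (\<open>icc_comparison\<close>, \<open>icc_parseval_comparison\<close>): the commutant of \<open>\<ell>\<^sup>2(G)\<close> is a factor, so two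
  nonzero invariant subspaces always have isomorphic nonzero parts, and a maximal partial isomorphism
  between subspaces of equal trace is total.

  Dimensions also decide completeness: if a representation has dimension one, then every orthonormal
  orbit in it is an orthonormal basis (\<open>orthonormal_orbit_basis\<close>). Over \<open>G\<close> the space \<open>\<H>\<^sup>N\<close> has dimension
  \<open>N \<cdot> 1/N = 1\<close>, and over \<open>H\<close> the space \<open>\<H>\<close> has dimension \<open>[G : H] \<cdot> 1/N = 1\<close>. It is therefore enough
  to find vectors \<open>\<eta>\<^sub>i\<close> with two properties of their matrix coefficients: \<open>\<langle>\<pi> h \<eta>\<^sub>i, \<eta>\<^sub>i\<rangle>\<close> is \<open>1/N\<close> at
  \<open>h = 1\<close> and \<open>0\<close> elsewhere on \<open>H\<close>, and \<open>\<Sum>\<^sub>i \<langle>\<pi> g \<eta>\<^sub>i, \<eta>\<^sub>i\<rangle> = 0\<close> for \<open>g \<notin> H\<close>. Each \<open>\<eta>\<^sub>i\<close> is then a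
  Parseval frame vector for \<open>\<H>\<close>, as a coordinate of one for \<open>\<H>\<^sup>N\<close>.

  To construct them, take \<open>u \<in> H\<close> of infinite order. The Fourier coefficients of an arc covering \<open>1/N\<close>
  of the unit circle, placed on the powers of \<open>u\<close>, define a projection of trace \<open>1/N\<close> in the algebra of
  right translations by elements of \<open>H\<close>. By comparison \<open>\<H>\<close> is isomorphic to its range, which is the
  orthogonal sum of the subspaces \<open>X\<^sub>k\<close> of functions supported on the \<open>N\<close> cosets \<open>H r\<^sub>k\<close>. An element
  outside \<open>H\<close> moves every \<open>X\<^sub>k\<close> to an orthogonal one. Over \<open>H\<close> each \<open>X\<^sub>k\<close> has dimension \<open>1/N\<close>, and so has
  the range in \<open>\<ell>\<^sup>2(H)\<close> of the projection \<open>q\<^sub>k\<close> given by the arc rotated by \<open>k/N\<close> of a full turn.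
  Comparison over \<open>H\<close> yields \<open>\<zeta>\<^sub>k \<in> X\<^sub>k\<close> with the matrix coefficient of \<open>q\<^sub>k \<delta>\<^sub>1\<close> on \<open>H\<close> (\<open>coset_vector_exists\<close>). Since
  \<open>\<Sum>\<^sub>k q\<^sub>k = 1\<close>, the vectors \<open>\<eta>\<^sub>i = N\<^sup>-\<^sup>1\<^sup>/\<^sup>2 \<Sum>\<^sub>k exp (2 \<pi> \<i> i k / N) \<zeta>\<^sub>k\<close> have both properties.
\<close>

section \<open>Complex Hilbert spaces\<close>

lemma cinner_add_right: "cinner x (y + z) = cinner x y + cinner x z"
  by (metis cinner_add_left cinner_commute complex_cnj_add)

lemma cinner_scaleC_right: "cinner x (a *\<^sub>C y) = cnj a * cinner x y"
  by (metis cinner_commute cinner_scaleC_left complex_cnj_mult)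

lemma cinner_scaleR_left: "cinner (r *\<^sub>R x) y = of_real r * cinner x y"
  by (metis cinner_scaleC_left scaleC_of_real)

lemma cinner_scaleR_right: "cinner x (r *\<^sub>R y) = of_real r * cinner x y"
  by (metis cinner_scaleC_right scaleC_of_real complex_cnj_complex_of_real)

lemma cinner_uminus_left: "cinner (- x) y = - cinner x y"
  using cinner_scaleR_left[of "-1" x y] by simp

lemma cinner_diff_left: "cinner (x - y) z = cinner x z - cinner y z"
  by (metis cinner_add_left cinner_uminus_left uminus_add_conv_diff add.commute)

lemma cinner_diff_right: "cinner x (y - z) = cinner x y - cinner x z"
  by (metis cinner_diff_left cinner_commute complex_cnj_diff)

lemma cinner_zero_left [simp]: "cinner 0 x = 0"
  using cinner_scaleR_left[of 0 x x] by simp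

lemma cinner_zero_right [simp]: "cinner x 0 = 0"
  using cinner_scaleR_right[of x 0 x] by simp

lemma cinner_eq_zero_iff [simp]: "cinner x x = 0 \<longleftrightarrow> x = 0"
  by (simp add: cinner_self)

lemma cmod_cinner_commute: "cmod (cinner x y) = cmod (cinner y x)"
  by (metis cinner_commute complex_mod_cnj)

lemma norm_diff_sq:
  "(norm (x - y))\<^sup>2 = (norm x)\<^sup>2 - 2 * Re (cinner x y) + (norm y)\<^sup>2"
proof -
  have "complex_of_real ((norm (x - y))\<^sup>2) = cinner x x - cinner x y - cinner y x + cinner y y"
    by (simp add: cinner_self[symmetric] cinner_diff_left cinner_diff_right del: of_real_power)
  then have "Re (complex_of_real ((norm (x - y))\<^sup>2)) = Re (cinner x x - cinner x y - cinner y x + cinner y y)"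
    by simp
  moreover have "Re (cinner y x) = Re (cinner x y)"
    by (subst cinner_commute) simp
  ultimately show ?thesis
    by (simp add: cinner_self)
qed

lemma norm_add_sq:
  "(norm (x + y))\<^sup>2 = (norm x)\<^sup>2 + 2 * Re (cinner x y) + (norm y)\<^sup>2"
  using norm_diff_sq[of x "- y"]
  by (simp add: cinner_uminus_left cinner_commute[of x "-y"] cinner_commute[of x y])

lemma parallelogram_law:
  "(norm (x + y))\<^sup>2 + (norm (x - y))\<^sup>2 = 2 * (norm x)\<^sup>2 + 2 * (norm (y::'a::complex_inner))\<^sup>2"
  by (simp add: norm_diff_sq norm_add_sq)

lemma norm_scaleC: "norm (a *\<^sub>C (x::'a::complex_inner)) = cmod a * norm x"
proof -
  have "complex_of_real ((norm (a *\<^sub>C x))\<^sup>2) = complex_of_real ((cmod a * norm x)\<^sup>2)"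
    unfolding power_mult_distrib of_real_mult
    by (simp add: cinner_self[symmetric] cinner_scaleC_left cinner_scaleC_right complex_norm_square
        mult_ac del: of_real_power)
  then have "(norm (a *\<^sub>C x))\<^sup>2 = (cmod a * norm x)\<^sup>2"
    using of_real_eq_iff by blast
  then show ?thesis
    by (simp add: power2_eq_iff_nonneg)
qed

text \<open>Subtracting from \<open>x\<close> its component along \<open>y\<close> shortens it by exactly
  \<open>\<bar>\<langle>x, y\<rangle>\<bar>\<^sup>2 / \<parallel>y\<parallel>\<^sup>2\<close>. Both the Cauchy-Schwarz inequality and the orthogonality of a closest
  point come from this.\<close>
lemma norm_diff_component_sq:
  assumes "y \<noteq> 0"
  shows "(norm (x - (cinner x y / of_real ((norm y)\<^sup>2)) *\<^sub>C y))\<^sup>2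
    = (norm x)\<^sup>2 - (cmod (cinner x y))\<^sup>2 / (norm y)\<^sup>2"
proof -
  have n: "(norm y)\<^sup>2 \<noteq> 0" using assms by simp
  define a where "a = cinner x y / of_real ((norm y)\<^sup>2)"
  have c: "cmod a = cmod (cinner x y) / (norm y)\<^sup>2"
    by (simp add: a_def norm_divide norm_power)
  have "cinner x (a *\<^sub>C y) = of_real ((cmod (cinner x y))\<^sup>2 / (norm y)\<^sup>2)"
    by (simp add: cinner_scaleC_right a_def complex_norm_square[symmetric] mult.commute[of "cnj _"])
  then have r: "Re (cinner x (a *\<^sub>C y)) = (cmod (cinner x y))\<^sup>2 / (norm y)\<^sup>2"
    by simp
  have "(norm (a *\<^sub>C y))\<^sup>2 = (cmod (cinner x y))\<^sup>2 / (norm y)\<^sup>2"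
    using n by (simp add: norm_scaleC c power_mult_distrib power_divide field_simps power2_eq_square)
  then show ?thesis
    unfolding norm_diff_sq a_def[symmetric] r by simp
qed

lemma cinner_Cauchy_Schwarz: "cmod (cinner x y) \<le> norm x * norm y"
proof (cases "y = 0")
  case False
  have "0 \<le> (norm x)\<^sup>2 - (cmod (cinner x y))\<^sup>2 / (norm y)\<^sup>2"
    by (metis norm_diff_component_sq[OF False] zero_le_power2)
  then have "(cmod (cinner x y))\<^sup>2 \<le> (norm x * norm y)\<^sup>2"
    using False by (simp add: field_simps)
  then show ?thesis
    by (simp add: power2_le_iff_abs_le)
qed simp

global_interpretation cinner: bounded_bilinear "cinner :: 'a::complex_inner \<Rightarrow> 'a \<Rightarrow> complex"
proof
  show "\<exists>K. \<forall>a b. cmod (cinner (a::'a) b) \<le> norm a * norm b * K"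
    by (rule exI[of _ 1]) (simp add: cinner_Cauchy_Schwarz)
qed (simp_all add: cinner_add_left cinner_add_right cinner_scaleR_left cinner_scaleR_right scaleR_conv_of_real)

lemma bounded_linear_scaleC: "bounded_linear (\<lambda>x::'a::complex_inner. a *\<^sub>C x)"
proof
  fix x y :: 'a and r :: real
  show "a *\<^sub>C (x + y) = a *\<^sub>C x + a *\<^sub>C y" by (rule scaleC_add_right)
  show "a *\<^sub>C (r *\<^sub>R x) = r *\<^sub>R (a *\<^sub>C x)"
    by (simp add: scaleC_of_real[symmetric] scaleC_scaleC mult.commute)
  show "\<exists>K. \<forall>x::'a. norm (a *\<^sub>C x) \<le> norm x * K"
    by (rule exI[of _ "cmod a"]) (simp add: norm_scaleC mult.commute)
qed

lemma eq_by_cinner: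
  assumes "\<And>z. cinner x z = cinner y z"
  shows "x = y"
  using assms[of "x - y"] cinner_eq_zero_iff[of "x - y"] by (simp add: cinner_diff_left)

abbreviation clinear :: "('a::complex_inner \<Rightarrow> 'b::complex_inner) \<Rightarrow> bool" where
  "clinear \<equiv> Vector_Spaces.linear scaleC scaleC"

lemma clinearI:
  assumes "\<And>x y. T (x + y) = T x + T y" "\<And>a x. T (a *\<^sub>C x) = a *\<^sub>C T x"
  shows "clinear T"
  by (intro Vector_Spaces.linear.intro module_hom.intro module_hom_axioms.intro
      vector_space_scaleC complex_vector.module_axioms assms)

lemma clinear_add: "clinear T \<Longrightarrow> T (x + y) = T x + T y"
  unfolding Vector_Spaces.linear_def by (blast intro: module_hom.add)

lemma clinear_scaleC: "clinear T \<Longrightarrow> T (a *\<^sub>C x) = a *\<^sub>C T x"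
  unfolding Vector_Spaces.linear_def by (blast intro: module_hom.scale)

lemma clinear_scaleR: "clinear T \<Longrightarrow> T (r *\<^sub>R x) = r *\<^sub>R T x"
  by (metis clinear_scaleC scaleC_of_real)

lemma clinear_diff: "clinear T \<Longrightarrow> T (x - y) = T x - T y"
  unfolding Vector_Spaces.linear_def by (blast intro: module_hom.diff)

lemma clinear_zero: "clinear T \<Longrightarrow> T 0 = 0"
  unfolding Vector_Spaces.linear_def by (blast intro: module_hom.zero)

lemma clinear_sum: "clinear T \<Longrightarrow> T (sum f A) = (\<Sum>x\<in>A. T (f x))"
  unfolding Vector_Spaces.linear_def by (blast intro: module_hom.sum)

lemma clinear_compose: "clinear S \<Longrightarrow> clinear T \<Longrightarrow> clinear (\<lambda>x. S (T x))"
  by (intro clinearI) (simp_all add: clinear_add clinear_scaleC)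

lemma Re_cinner_polarization: "Re (cinner x y) = ((norm (x + y))\<^sup>2 - (norm (x - y))\<^sup>2) / 4"
  by (simp add: norm_diff_sq norm_add_sq)

lemma Im_cinner_eq_Re: "Im (cinner x y) = Re (cinner x (\<i> *\<^sub>C y))"
  by (simp add: cinner_scaleC_right)

section \<open>Orthogonal projections\<close>

definition closed_csubspace :: "'a::complex_inner set \<Rightarrow> bool" where
  "closed_csubspace M \<longleftrightarrow> complex_vector.subspace M \<and> closed M"

lemma closed_csubspaceI:
  assumes "0 \<in> M" "\<And>x y. x \<in> M \<Longrightarrow> y \<in> M \<Longrightarrow> x + y \<in> M"
    "\<And>a x. x \<in> M \<Longrightarrow> a *\<^sub>C x \<in> M" "closed M"
  shows "closed_csubspace M"
  unfolding closed_csubspace_def using assms by (auto intro: complex_vector.subspaceI)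

lemma closed_csubspaceD:
  assumes "closed_csubspace M"
  shows "0 \<in> M" "x \<in> M \<Longrightarrow> y \<in> M \<Longrightarrow> x + y \<in> M" "x \<in> M \<Longrightarrow> a *\<^sub>C x \<in> M"
    "x \<in> M \<Longrightarrow> y \<in> M \<Longrightarrow> x - y \<in> M" "x \<in> M \<Longrightarrow> r *\<^sub>R x \<in> M" "closed M"
  using assms unfolding closed_csubspace_def
  by (auto intro: complex_vector.subspace_0 complex_vector.subspace_add complex_vector.subspace_scale
      complex_vector.subspace_diff simp flip: scaleC_of_real)

lemma closed_csubspace_Int:
  "closed_csubspace M \<Longrightarrow> closed_csubspace N \<Longrightarrow> closed_csubspace (M \<inter> N)"
  unfolding closed_csubspace_def by (simp add: complex_vector.subspace_inter closed_Int)

lemma closed_csubspace_UNIV: "closed_csubspace UNIV"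
  unfolding closed_csubspace_def by simp

lemma closed_csubspace_orthogonal: "closed_csubspace {x. \<forall>s\<in>S. cinner x (s::'a::complex_inner) = 0}"
proof (rule closed_csubspaceI)
  show "closed {x. \<forall>s\<in>S. cinner x s = 0}"
    unfolding Ball_def by (intro closed_Collect_all closed_Collect_imp open_Collect_const closed_Collect_eq
       continuous_intros cinner.continuous_on)
qed (auto simp: cinner_add_left cinner_scaleC_left)

lemma closed_csubspace_closure_cspan: "closed_csubspace (closure (cspan S))"
proof (rule closed_csubspaceI)
  show "0 \<in> closure (cspan S)"
    using complex_vector.span_zero closure_subset by blast
next
  fix x y assume "x \<in> closure (cspan S)" "y \<in> closure (cspan S)"
  then obtain f g where "\<And>n. f n \<in> cspan S" "f \<longlonglongrightarrow> x" "\<And>n. g n \<in> cspan S" "g \<longlonglongrightarrow> y"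
    by (meson closure_sequential)
  then have "\<And>n. f n + g n \<in> cspan S" "(\<lambda>n. f n + g n) \<longlonglongrightarrow> x + y"
    by (auto intro: tendsto_add complex_vector.span_add)
  then show "x + y \<in> closure (cspan S)"
    unfolding closure_sequential by (intro exI[of _ "\<lambda>n. f n + g n"]) auto
next
  fix a x assume "x \<in> closure (cspan S)"
  then obtain f where "\<And>n. f n \<in> cspan S" "f \<longlonglongrightarrow> x"
    by (meson closure_sequential)
  then have "\<And>n. a *\<^sub>C f n \<in> cspan S" "(\<lambda>n. a *\<^sub>C f n) \<longlonglongrightarrow> a *\<^sub>C x"
    by (auto intro: bounded_linear.tendsto[OF bounded_linear_scaleC] complex_vector.span_scale)
  then show "a *\<^sub>C x \<in> closure (cspan S)"
    unfolding closure_sequential by (intro exI[of _ "\<lambda>n. a *\<^sub>C f n"]) auto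
qed simp

text \<open>A sequence in \<open>M\<close> whose distances to \<open>x\<close> approach the infimum is a Cauchy sequence by the
  parallelogram law, because the midpoint of two of its members also lies in \<open>M\<close>.\<close>
lemma closest_point_exists:
  fixes M :: "'a::chilbert_space set"
  assumes M: "closed_csubspace M"
  shows "\<exists>p\<in>M. \<forall>y\<in>M. norm (x - p) \<le> norm (x - y)"
proof -
  note Mc = closed_csubspaceD[OF M]
  define d where "d = (INF y\<in>M. norm (x - y))"
  have bdd: "bdd_below ((\<lambda>y. norm (x - y)) ` M)" by (rule bdd_belowI[of _ 0]) auto
  have ne: "M \<noteq> {}" using Mc(1) by auto
  have d_le: "d \<le> norm (x - y)" if "y \<in> M" for y
    unfolding d_def using bdd that by (rule cINF_lower)
  have d0: "d \<ge> 0" unfolding d_def using ne by (intro cINF_greatest) auto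
  have "\<exists>y\<in>M. norm (x - y) < d + 1 / real (Suc n)" for n
    using cINF_less_iff[OF ne bdd, of "d + 1 / real (Suc n)"] by (simp add: d_def)
  then obtain y where y: "\<And>n. y n \<in> M" "\<And>n. norm (x - y n) < d + 1 / real (Suc n)"
    by metis
  have lim: "(\<lambda>n. norm (x - y n)) \<longlonglongrightarrow> d"
  proof (rule tendsto_sandwich[of "\<lambda>_. d" _ _ "\<lambda>n. d + 1 / real (Suc n)"])
    show "(\<lambda>n. d + 1 / real (Suc n)) \<longlonglongrightarrow> d"
      using tendsto_add[OF tendsto_const LIMSEQ_inverse_real_of_nat, of d]
      by (simp add: inverse_eq_divide)
  qed (use y d_le in \<open>auto intro!: eventuallyI less_imp_le simp del: of_nat_Suc\<close>)
  have key: "(norm (y m - y n))\<^sup>2 \<le> 2 * ((norm (x - y m))\<^sup>2 - d\<^sup>2) + 2 * ((norm (x - y n))\<^sup>2 - d\<^sup>2)" for m n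
  proof -
    have "d \<le> norm (x - (1/2) *\<^sub>R (y m + y n))"
      using y Mc by (intro d_le) auto
    then have "d\<^sup>2 \<le> (norm (x - (1/2) *\<^sub>R (y m + y n)))\<^sup>2"
      using d0 by (simp add: power_mono)
    moreover have "(x - y m) + (x - y n) = 2 *\<^sub>R (x - (1/2) *\<^sub>R (y m + y n))"
      by (simp add: scaleR_diff_right scaleR_2)
    then have "(norm ((x - y m) + (x - y n)))\<^sup>2 = 4 * (norm (x - (1/2) *\<^sub>R (y m + y n)))\<^sup>2"
      by (simp add: power_mult_distrib)
    moreover have "norm (y m - y n) = norm ((x - y m) - (x - y n))"
      by (simp add: norm_minus_commute)
    ultimately show ?thesis
      using parallelogram_law[of "x - y m" "x - y n"] by simp
  qed
  have "Cauchy y"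
  proof (rule CauchyI)
    fix e :: real assume e: "e > 0"
    have "(\<lambda>n. (norm (x - y n))\<^sup>2 - d\<^sup>2) \<longlonglongrightarrow> d\<^sup>2 - d\<^sup>2"
      by (intro tendsto_intros lim)
    then have "\<forall>\<^sub>F n in sequentially. (norm (x - y n))\<^sup>2 - d\<^sup>2 < e\<^sup>2 / 4"
      using e by (intro order_tendstoD) auto
    then obtain K where K: "\<And>n. n \<ge> K \<Longrightarrow> (norm (x - y n))\<^sup>2 - d\<^sup>2 < e\<^sup>2 / 4"
      by (auto simp: eventually_sequentially)
    have "norm (y m - y n) < e" if "m \<ge> K" "n \<ge> K" for m n
    proof -
      have "(norm (y m - y n))\<^sup>2 < e\<^sup>2"
        using key[of m n] K[OF that(1)] K[OF that(2)] by argo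
      then show ?thesis
        using e by (simp add: power2_less_imp_less)
    qed
    then show "\<exists>K. \<forall>m\<ge>K. \<forall>n\<ge>K. norm (y m - y n) < e" by blast
  qed
  then obtain p where p: "y \<longlonglongrightarrow> p"
    using Cauchy_convergent_iff convergent_def by blast
  have "p \<in> M"
    using Mc(6) y(1) p by (meson closed_sequentially)
  moreover have "norm (x - p) = d"
    by (rule LIMSEQ_unique[OF _ lim]) (intro tendsto_intros p)
  ultimately show ?thesis using d_le by metis
qed

lemma orthogonal_decomposition_exists:
  fixes M :: "'a::chilbert_space set"
  assumes M: "closed_csubspace M"
  shows "\<exists>p\<in>M. \<forall>y\<in>M. cinner (x - p) y = 0"
proof -
  obtain p where p: "p \<in> M" "\<And>y. y \<in> M \<Longrightarrow> norm (x - p) \<le> norm (x - y)"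
    using closest_point_exists[OF M] by blast
  have "cinner (x - p) y = 0" if y: "y \<in> M" for y
  proof (rule ccontr)
    assume n: "cinner (x - p) y \<noteq> 0"
    then have y0: "y \<noteq> 0" by auto
    define a where "a = cinner (x - p) y / of_real ((norm y)\<^sup>2)"
    have "norm (x - p) \<le> norm (x - (p + a *\<^sub>C y))"
      using p y closed_csubspaceD[OF M] by blast
    then have "(norm (x - p))\<^sup>2 \<le> (norm ((x - p) - a *\<^sub>C y))\<^sup>2"
      by (simp add: power_mono diff_diff_eq)
    then show False
      using norm_diff_component_sq[OF y0, of "x - p", folded a_def] n y0 by (simp add: divide_le_0_iff)
  qed
  then show ?thesis using p(1) by blast
qed

definition proj :: "'a::chilbert_space set \<Rightarrow> 'a \<Rightarrow> 'a" where
  "proj M x = (SOME p. p \<in> M \<and> (\<forall>y\<in>M. cinner (x - p) y = 0))"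

context
  fixes M :: "'a::chilbert_space set"
  assumes M: "closed_csubspace M"
begin

lemma proj_in: "proj M x \<in> M"
  and proj_orthogonal: "y \<in> M \<Longrightarrow> cinner (x - proj M x) y = 0"
  using someI_ex[of "\<lambda>p. p \<in> M \<and> (\<forall>y\<in>M. cinner (x - p) y = 0)"]
    orthogonal_decomposition_exists[OF M, of x]
  unfolding proj_def by blast+

lemma proj_eqI:
  assumes "p \<in> M" "\<And>y. y \<in> M \<Longrightarrow> cinner (x - p) y = 0"
  shows "proj M x = p"
proof -
  have m: "p - proj M x \<in> M"
    using assms proj_in closed_csubspaceD[OF M] by blast
  have "p - proj M x = (x - proj M x) - (x - p)" by simp
  then have "cinner (p - proj M x) (p - proj M x) = 0"
    using assms(2)[OF m] proj_orthogonal[OF m, of x] by (metis cinner_diff_left diff_zero)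
  then show ?thesis by simp
qed

lemma proj_same: "x \<in> M \<Longrightarrow> proj M x = x"
  by (rule proj_eqI) auto

lemma cinner_proj: "y \<in> M \<Longrightarrow> cinner (proj M x) y = cinner x y"
  using proj_orthogonal[of y x] by (simp add: cinner_diff_left)

lemma cinner_proj': "y \<in> M \<Longrightarrow> cinner y (proj M x) = cinner y x"
  by (metis cinner_commute cinner_proj)

lemma proj_selfadjoint: "cinner (proj M x) y = cinner x (proj M y)"
  by (metis cinner_proj cinner_proj' proj_in)

lemma clinear_proj: "clinear (proj M)"
  using proj_in closed_csubspaceD[OF M]
  by (intro clinearI proj_eqI)
     (auto simp: cinner_diff_left cinner_add_left cinner_scaleC_left cinner_proj)

lemma norm_proj_pythagoras: "(norm x)\<^sup>2 = (norm (proj M x))\<^sup>2 + (norm (x - proj M x))\<^sup>2"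
proof -
  have "cinner (x - proj M x) (proj M x) = 0"
    using proj_orthogonal proj_in by blast
  then show ?thesis
    using norm_add_sq[of "x - proj M x" "proj M x"] by simp
qed

lemma norm_proj_le: "norm (proj M x) \<le> norm x"
proof (rule power2_le_imp_le)
  show "(norm (proj M x))\<^sup>2 \<le> (norm x)\<^sup>2"
    using norm_proj_pythagoras[of x] zero_le_power2[of "norm (x - proj M x)"] by linarith
qed simp

text \<open>Here \<open>V\<close> is the adjoint of \<open>U\<close>; invariance of \<open>M\<close> under it says that \<open>U\<close> preserves the
  orthogonal complement of \<open>M\<close> as well.\<close>
lemma proj_intertwines:
  assumes "clinear U" "\<And>x. x \<in> M \<Longrightarrow> U x \<in> M"
    and "\<And>x y. cinner (U x) y = cinner x (V y)" "\<And>x. x \<in> M \<Longrightarrow> V x \<in> M"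
  shows "proj M (U x) = U (proj M x)"
proof (rule proj_eqI)
  fix y assume "y \<in> M"
  then show "cinner (U x - U (proj M x)) y = 0"
    using assms proj_orthogonal by (simp flip: clinear_diff[OF assms(1)])
qed (use assms proj_in in auto)

end

lemma closed_csubspace_eq_UNIV:
  fixes M :: "'a::chilbert_space set"
  assumes "closed_csubspace M" "\<And>x. (\<And>y. y \<in> M \<Longrightarrow> cinner x y = 0) \<Longrightarrow> x = 0"
  shows "M = UNIV"
proof -
  have "x \<in> M" for x
    using assms(2)[of "x - proj M x"] proj_orthogonal[OF assms(1)] proj_in[OF assms(1), of x]
    by simp
  then show ?thesis by blast
qed

section \<open>Square roots of positive operators\<close>

instance chilbert_space \<subseteq> banach ..

text \<open>The iteration \<open>Y \<mapsto> (B + Y\<^sup>2) / 2\<close> started at \<open>0\<close> converges to the solution of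
  \<open>Y = (B + Y\<^sup>2) / 2\<close>, that is \<open>(1 - Y)\<^sup>2 = 1 - B\<close>. Its members are polynomials in \<open>B\<close>, so they
  commute with each other and with whatever commutes with \<open>B\<close>.\<close>
primrec sqrt_iter :: "('a::complex_inner \<Rightarrow> 'a) \<Rightarrow> nat \<Rightarrow> 'a \<Rightarrow> 'a" where
  "sqrt_iter B 0 x = 0"
| "sqrt_iter B (Suc n) x = (1/2) *\<^sub>R (B x + sqrt_iter B n (sqrt_iter B n x))"

text \<open>The scalar iteration with \<open>B = 1\<close> majorizes the iteration for every contraction.\<close>
primrec sqrt_majorant :: "nat \<Rightarrow> real" where
  "sqrt_majorant 0 = 0"
| "sqrt_majorant (Suc n) = (1 + (sqrt_majorant n)\<^sup>2) / 2"

lemma sqrt_majorant_bounds: "0 \<le> sqrt_majorant n \<and> sqrt_majorant n \<le> 1"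
  by (induction n) (auto simp: power_le_one)

lemma sqrt_majorant_mono: "sqrt_majorant n \<le> sqrt_majorant (Suc n)"
proof -
  have "0 \<le> (1 - sqrt_majorant n)\<^sup>2" by simp
  then show ?thesis by (simp add: power2_eq_square algebra_simps)
qed

lemma summable_sqrt_majorant_diff: "summable (\<lambda>n. sqrt_majorant (Suc n) - sqrt_majorant n)"
proof -
  have "convergent sqrt_majorant"
    by (rule Bseq_monoseq_convergent)
       (use sqrt_majorant_bounds sqrt_majorant_mono in
         \<open>auto intro!: BseqI'[of _ 1] simp: monoseq_Suc simp del: sqrt_majorant.simps\<close>)
  then show ?thesis
    by (auto simp: convergent_def simp del: sqrt_majorant.simps intro: telescope_summable)
qed

context
  fixes B :: "'a::chilbert_space \<Rightarrow> 'a"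
  assumes B_lin: "clinear B" and B_contr: "\<And>x. norm (B x) \<le> norm x"
begin

lemma clinear_sqrt_iter: "clinear (sqrt_iter B n)"
proof (induction n)
  case 0
  show ?case by (rule clinearI) (simp_all add: complex_vector.scale_zero_right)
next
  case (Suc n)
  show ?case
  proof (rule clinearI)
    fix a x
    have "(1/2) *\<^sub>R (a *\<^sub>C z) = a *\<^sub>C ((1/2) *\<^sub>R z)" for z :: 'a
      by (simp flip: scaleC_of_real add: scaleC_scaleC mult.commute)
    then show "sqrt_iter B (Suc n) (a *\<^sub>C x) = a *\<^sub>C sqrt_iter B (Suc n) x"
      by (simp add: clinear_scaleC[OF Suc] clinear_scaleC[OF B_lin] scaleC_add_right[symmetric])
  qed (simp add: clinear_add[OF Suc] clinear_add[OF B_lin] scaleR_add_right)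
qed

lemma sqrt_iter_commutes:
  assumes C: "clinear C" "\<And>x. C (B x) = B (C x)"
  shows "C (sqrt_iter B n x) = sqrt_iter B n (C x)"
  by (induction n arbitrary: x) (simp_all add: clinear_zero C clinear_add clinear_scaleR)

lemma norm_sqrt_iter_le: "norm (sqrt_iter B n x) \<le> sqrt_majorant n * norm x"
proof (induction n arbitrary: x)
  case (Suc n)
  have "norm (sqrt_iter B n (sqrt_iter B n x)) \<le> sqrt_majorant n * (sqrt_majorant n * norm x)"
    using Suc[of "sqrt_iter B n x"] mult_left_mono[OF Suc[of x], of "sqrt_majorant n"]
      sqrt_majorant_bounds[of n] by linarith
  then have "norm (B x + sqrt_iter B n (sqrt_iter B n x)) \<le> norm x + sqrt_majorant n * (sqrt_majorant n * norm x)"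
    by (intro norm_triangle_le add_mono B_contr)
  then have "norm ((1/2) *\<^sub>R (B x + sqrt_iter B n (sqrt_iter B n x)))
      \<le> (1/2) * (norm x + sqrt_majorant n * (sqrt_majorant n * norm x))"
    unfolding norm_scaleR by simp
  then show ?case by (simp add: power2_eq_square field_simps del: scaleR_add_right)
qed simp

lemma norm_sqrt_iter_le_norm: "norm (sqrt_iter B n x) \<le> norm x"
  using norm_sqrt_iter_le[of n x] sqrt_majorant_bounds[of n] mult_left_le_one_le[of "norm x" "sqrt_majorant n"]
  by simp

text \<open>Factoring \<open>Y\<^sub>n\<^sub>+\<^sub>1\<^sup>2 - Y\<^sub>n\<^sup>2 = (Y\<^sub>n\<^sub>+\<^sub>1 + Y\<^sub>n) (Y\<^sub>n\<^sub>+\<^sub>1 - Y\<^sub>n)\<close>, which holds because the iterates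
  commute, turns the bounds on the iterates into bounds on their increments.\<close>
lemma norm_sqrt_iter_diff_le:
  "norm (sqrt_iter B (Suc n) x - sqrt_iter B n x)
    \<le> (sqrt_majorant (Suc n) - sqrt_majorant n) * norm x"
proof (induction n arbitrary: x)
  case 0
  show ?case using B_contr[of x] by simp
next
  case (Suc n)
  define Y where "Y = sqrt_iter B n"
  define Z where "Z = sqrt_iter B (Suc n)"
  define y where "y = sqrt_majorant n"
  define z where "z = sqrt_majorant (Suc n)"
  have lin: "clinear Y" "clinear Z" unfolding Y_def Z_def by (rule clinear_sqrt_iter)+
  have "Y (B u) = B (Y u)" for u
    unfolding Y_def by (rule sqrt_iter_commutes[symmetric, OF B_lin refl])
  then have com: "Y (Z u) = Z (Y u)" for u
    unfolding Z_def by (rule sqrt_iter_commutes[OF lin(1)])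
  have d: "norm (Z x - Y x) \<le> (z - y) * norm x"
    using Suc unfolding Y_def Z_def y_def z_def .
  have zy: "0 \<le> y" "0 \<le> z"
    using sqrt_majorant_bounds unfolding y_def z_def by blast+
  have "norm (Z (Z x - Y x)) \<le> z * ((z - y) * norm x)"
    using norm_sqrt_iter_le[of "Suc n" "Z x - Y x"] mult_left_mono[OF d zy(2)]
    unfolding Z_def[symmetric] z_def[symmetric] by linarith
  moreover have "norm (Y (Z x - Y x)) \<le> y * ((z - y) * norm x)"
    using norm_sqrt_iter_le[of n "Z x - Y x"] mult_left_mono[OF d zy(1)]
    unfolding Y_def[symmetric] y_def[symmetric] by linarith
  ultimately have *: "norm (Z (Z x - Y x) + Y (Z x - Y x)) \<le> (z\<^sup>2 - y\<^sup>2) * norm x"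
    by (intro norm_triangle_le) (simp add: power2_eq_square algebra_simps)
  have "Z (Z x - Y x) + Y (Z x - Y x) = Z (Z x) - Y (Y x)"
    by (simp add: clinear_diff lin com)
  moreover have "sqrt_iter B (Suc (Suc n)) x - sqrt_iter B (Suc n) x = (1/2) *\<^sub>R (Z (Z x) - Y (Y x))"
    by (simp add: Z_def Y_def scaleR_diff_right[symmetric] del: sqrt_iter.simps)
       (simp add: sqrt_iter.simps(2)[of B "Suc n"] sqrt_iter.simps(2)[of B n x] scaleR_diff_right[symmetric]
          del: sqrt_iter.simps)
  moreover have "sqrt_majorant (Suc (Suc n)) - sqrt_majorant (Suc n) = (z\<^sup>2 - y\<^sup>2) / 2"
    by (simp add: z_def y_def sqrt_majorant.simps(2)[of "Suc n"] sqrt_majorant.simps(2)[of n]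
        diff_divide_distrib del: sqrt_majorant.simps)
       (simp add: field_simps)
  moreover have "norm ((1/2) *\<^sub>R (Z (Z x) - Y (Y x))) \<le> (z\<^sup>2 - y\<^sup>2) / 2 * norm x"
    using * calculation(1) unfolding norm_scaleR by simp
  ultimately show ?case by metis
qed

text \<open>The increments are dominated by those of the bounded monotone scalar iteration, so their sum
  converges absolutely.\<close>
lemma sqrt_iter_convergent: "convergent (\<lambda>n. sqrt_iter B n x)"
proof -
  have "summable (\<lambda>n. sqrt_iter B (Suc n) x - sqrt_iter B n x)"
    by (rule summable_comparison_test'[OF summable_mult2[OF summable_sqrt_majorant_diff]])
       (rule norm_sqrt_iter_diff_le)
  then obtain l where "(\<lambda>n. \<Sum>i<n. sqrt_iter B (Suc i) x - sqrt_iter B i x) \<longlonglongrightarrow> l"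
    by (auto simp: summable_def sums_def)
  then show ?thesis
    using sum_lessThan_telescope[of "\<lambda>n. sqrt_iter B n x"]
    by (auto simp: convergent_def simp del: sqrt_iter.simps(2))
qed

definition sqrt_lim :: "'a \<Rightarrow> 'a" where
  "sqrt_lim x = lim (\<lambda>n. sqrt_iter B n x)"

lemma tendsto_sqrt_lim: "(\<lambda>n. sqrt_iter B n x) \<longlonglongrightarrow> sqrt_lim x"
  using sqrt_iter_convergent unfolding sqrt_lim_def by (simp add: convergent_LIMSEQ_iff)

lemma clinear_sqrt_lim: "clinear sqrt_lim"
proof (rule clinearI)
  fix x y :: 'a and a
  show "sqrt_lim (x + y) = sqrt_lim x + sqrt_lim y"
    using tendsto_add[OF tendsto_sqrt_lim tendsto_sqrt_lim, of x y] tendsto_sqrt_lim[of "x + y"]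
    by (simp add: clinear_add[OF clinear_sqrt_iter] LIMSEQ_unique)
  show "sqrt_lim (a *\<^sub>C x) = a *\<^sub>C sqrt_lim x"
    using bounded_linear.tendsto[OF bounded_linear_scaleC tendsto_sqrt_lim, of a x] tendsto_sqrt_lim[of "a *\<^sub>C x"]
    by (simp add: clinear_scaleC[OF clinear_sqrt_iter] LIMSEQ_unique)
qed

lemma sqrt_lim_fixpoint: "sqrt_lim x = (1/2) *\<^sub>R (B x + sqrt_lim (sqrt_lim x))"
proof -
  let ?Y = "\<lambda>n. sqrt_iter B n"
  have "(\<lambda>n. ?Y n (?Y n x - sqrt_lim x)) \<longlonglongrightarrow> 0"
  proof (rule tendsto_norm_zero_cancel, rule tendsto_sandwich[OF _ _ tendsto_const])
    show "(\<lambda>n. norm (?Y n x - sqrt_lim x)) \<longlonglongrightarrow> 0"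
      using tendsto_sqrt_lim[of x] by (simp add: LIM_zero_iff tendsto_norm_zero_iff)
  qed (auto intro!: always_eventually norm_sqrt_iter_le_norm)
  then have "(\<lambda>n. ?Y n (?Y n x - sqrt_lim x) + ?Y n (sqrt_lim x)) \<longlonglongrightarrow> 0 + sqrt_lim (sqrt_lim x)"
    by (intro tendsto_add tendsto_sqrt_lim)
  then have "(\<lambda>n. ?Y n (?Y n x)) \<longlonglongrightarrow> sqrt_lim (sqrt_lim x)"
    by (simp add: clinear_diff[OF clinear_sqrt_iter])
  then have "(\<lambda>n. ?Y (Suc n) x) \<longlonglongrightarrow> (1/2) *\<^sub>R (B x + sqrt_lim (sqrt_lim x))"
    by (auto intro!: tendsto_intros)
  then show ?thesis
    using LIMSEQ_unique LIMSEQ_Suc[OF tendsto_sqrt_lim] by blast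
qed

end

lemma adjoint_clinear:
  assumes "\<And>x y. cinner (T x) y = cinner x (T' y)"
  shows "clinear T'"
proof (rule clinearI)
  have T': "cinner (T' y) x = cinner y (T x)" for x y
    using assms by (metis cinner_commute)
  show "T' (x + y) = T' x + T' y" "T' (a *\<^sub>C x) = a *\<^sub>C T' x" for a x y
    by (rule eq_by_cinner; simp add: T' cinner_add_left cinner_scaleC_left)+
qed

text \<open>For a contraction \<open>T\<close> the operator \<open>1 - T\<^sup>*T\<close> is again a contraction, because
  \<open>\<parallel>x - T\<^sup>*T x\<parallel>\<^sup>2 = \<parallel>x\<parallel>\<^sup>2 - 2 \<parallel>T x\<parallel>\<^sup>2 + \<parallel>T\<^sup>*T x\<parallel>\<^sup>2\<close>; hence the iteration applies to it.\<close>
lemma positive_sqrt_exists: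
  fixes T T' :: "'a::chilbert_space \<Rightarrow> 'a"
  assumes T: "clinear T" "\<And>x. norm (T x) \<le> norm x"
    and adj: "\<And>x y. cinner (T x) y = cinner x (T' y)" and T': "\<And>x. norm (T' x) \<le> norm x"
  obtains R where "clinear R" "\<And>x y. cinner (R x) y = cinner x (R y)" "\<And>x. R (R x) = T' (T x)"
    "\<forall>C. clinear C \<longrightarrow> (\<forall>x. norm (C x) \<le> norm x) \<longrightarrow> (\<forall>x. C (T' (T x)) = T' (T (C x))) \<longrightarrow>
       (\<forall>x. C (R x) = R (C x))"
proof -
  have T'_lin: "clinear T'" using adj by (rule adjoint_clinear)
  define B where "B x = x - T' (T x)" for x
  have B_lin: "clinear B"
    using T(1) T'_lin
    by (intro clinearI) (simp_all add: B_def clinear_add clinear_scaleC complex_vector.scale_right_diff_distrib)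
  have B_contr: "norm (B x) \<le> norm x" for x
  proof (rule power2_le_imp_le)
    have "(norm (B x))\<^sup>2 = (norm x)\<^sup>2 - 2 * (norm (T x))\<^sup>2 + (norm (T' (T x)))\<^sup>2"
      by (simp add: B_def norm_diff_sq adj[symmetric] cinner_self)
    moreover have "(norm (T' (T x)))\<^sup>2 \<le> (norm (T x))\<^sup>2"
      using T' by (simp add: power_mono)
    ultimately show "(norm (B x))\<^sup>2 \<le> (norm x)\<^sup>2"
      using zero_le_power2[of "norm (T x)"] by linarith
  qed simp
  note B = B_lin B_contr
  have T2: "cinner (T' (T x)) y = cinner x (T' (T y))" for x y
    using adj by (metis cinner_commute)
  have B_sa: "cinner (B x) y = cinner x (B y)" for x y
    by (simp add: B_def cinner_diff_left cinner_diff_right T2)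
  have sa: "cinner (sqrt_iter B n x) y = cinner x (sqrt_iter B n y)" for n x y
    by (induction n arbitrary: x y)
       (simp_all add: cinner_scaleR_left cinner_scaleR_right cinner_add_left cinner_add_right B_sa)
  have Y_sa: "cinner (sqrt_lim B x) y = cinner x (sqrt_lim B y)" for x y
  proof -
    have "(\<lambda>n. cinner (sqrt_iter B n x) y) \<longlonglongrightarrow> cinner (sqrt_lim B x) y"
      "(\<lambda>n. cinner x (sqrt_iter B n y)) \<longlonglongrightarrow> cinner x (sqrt_lim B y)"
      by (intro cinner.tendsto tendsto_const tendsto_sqrt_lim B)+
    then show ?thesis unfolding sa by (rule LIMSEQ_unique)
  qed
  define R where "R x = x - sqrt_lim B x" for x
  note Y_lin = clinear_sqrt_lim[OF B]
  show ?thesis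
  proof (rule that[of R])
    show "clinear R"
      using Y_lin by (intro clinearI)
        (simp_all add: R_def clinear_add clinear_scaleC complex_vector.scale_right_diff_distrib)
    show "cinner (R x) y = cinner x (R y)" for x y
      by (simp add: R_def cinner_diff_left cinner_diff_right Y_sa)
    show "R (R x) = T' (T x)" for x
    proof -
      have "2 *\<^sub>R sqrt_lim B x = B x + sqrt_lim B (sqrt_lim B x)"
        by (subst sqrt_lim_fixpoint[OF B]) simp
      moreover have "R (R x) = x - 2 *\<^sub>R sqrt_lim B x + sqrt_lim B (sqrt_lim B x)"
        by (simp add: R_def clinear_diff[OF Y_lin] scaleR_2)
      ultimately show ?thesis
        by (simp add: B_def[of x])
    qed
    show "\<forall>C. clinear C \<longrightarrow> (\<forall>x. norm (C x) \<le> norm x) \<longrightarrow> (\<forall>x. C (T' (T x)) = T' (T (C x))) \<longrightarrow>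
       (\<forall>x. C (R x) = R (C x))"
    proof (intro allI impI)
      fix C x
      assume "clinear C" "\<forall>x. norm (C x) \<le> norm x" "\<forall>x. C (T' (T x)) = T' (T (C x))"
      then have C: "clinear C" "\<And>x. norm (C x) \<le> norm x" "\<And>x. C (T' (T x)) = T' (T (C x))"
        by blast+
      have CB: "C (B u) = B (C u)" for u by (simp add: B_def clinear_diff[OF C(1)] C(3))
      have "bounded_linear C"
        by (rule bounded_linear_intro[of _ 1]) (simp_all add: C clinear_add clinear_scaleR)
      then have "(\<lambda>n. C (sqrt_iter B n x)) \<longlonglongrightarrow> C (sqrt_lim B x)"
        by (rule bounded_linear.tendsto) (rule tendsto_sqrt_lim[OF B])
      then have "C (sqrt_lim B x) = sqrt_lim B (C x)"
        using tendsto_sqrt_lim[OF B, of "C x"] LIMSEQ_unique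
        by (simp add: sqrt_iter_commutes[OF B C(1) CB]) blast
      then show "C (R x) = R (C x)" by (simp add: R_def clinear_diff[OF C(1)])
    qed
  qed
qed

section \<open>Square-summable functions\<close>

typedef 'a ell2 = "{f :: 'a \<Rightarrow> complex. (\<lambda>x. (cmod (f x))\<^sup>2) summable_on UNIV}"
  morphisms coord Abs_ell2
  by (rule exI[of _ "\<lambda>_. 0"]) simp

setup_lifting type_definition_ell2

lemma summable_coord: "(\<lambda>x. (cmod (coord f x))\<^sup>2) summable_on A"
  using coord[of f] summable_on_subset_banach by blast

lemma ell2_eqI: "(\<And>x. coord f x = coord g x) \<Longrightarrow> f = g"
  by (simp add: coord_inject[symmetric] fun_eq_iff)

lemma square_summable_add:
  assumes "(\<lambda>x. (cmod (f x))\<^sup>2) summable_on A" "(\<lambda>x. (cmod (g x))\<^sup>2) summable_on A"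
  shows "(\<lambda>x. (cmod (f x + g x))\<^sup>2) summable_on A"
proof (rule summable_on_comparison_test)
  show "(\<lambda>x. 2 * (cmod (f x))\<^sup>2 + 2 * (cmod (g x))\<^sup>2) summable_on A"
    by (intro summable_on_add summable_on_cmult_right assms)
  show "(cmod (f x + g x))\<^sup>2 \<le> 2 * (cmod (f x))\<^sup>2 + 2 * (cmod (g x))\<^sup>2" for x
  proof -
    have "(cmod (f x + g x))\<^sup>2 \<le> (cmod (f x) + cmod (g x))\<^sup>2"
      by (intro power_mono norm_triangle_ineq) auto
    also have "\<dots> \<le> 2 * (cmod (f x))\<^sup>2 + 2 * (cmod (g x))\<^sup>2"
      using zero_le_power2[of "cmod (f x) - cmod (g x)"] by (simp add: power2_eq_square algebra_simps)
    finally show ?thesis .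
  qed
qed simp

lemma square_summable_mult:
  fixes f g :: "'a \<Rightarrow> complex"
  assumes "(\<lambda>x. (cmod (f x))\<^sup>2) summable_on A" "(\<lambda>x. (cmod (g x))\<^sup>2) summable_on A"
  shows "(\<lambda>x. norm (f x * cnj (g x))) summable_on A"
proof (rule summable_on_comparison_test)
  show "(\<lambda>x. (cmod (f x))\<^sup>2 + (cmod (g x))\<^sup>2) summable_on A"
    by (intro summable_on_add assms)
  show "cmod (f x * cnj (g x)) \<le> (cmod (f x))\<^sup>2 + (cmod (g x))\<^sup>2" for x
  proof -
    have "2 * (cmod (f x) * cmod (g x)) \<le> (cmod (f x))\<^sup>2 + (cmod (g x))\<^sup>2"
      using zero_le_power2[of "cmod (f x) - cmod (g x)"] by (simp add: power2_eq_square algebra_simps)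
    moreover have "0 \<le> cmod (f x) * cmod (g x)" by simp
    ultimately show ?thesis unfolding norm_mult complex_mod_cnj by linarith
  qed
qed simp

lemma summable_coord_mult: "(\<lambda>x. coord f x * cnj (coord g x)) summable_on A"
  by (rule abs_summable_summable, rule square_summable_mult) (rule summable_coord)+

instantiation ell2 :: (type) complex_inner
begin

lift_definition zero_ell2 :: "'a ell2" is "\<lambda>_. 0" by simp
lift_definition plus_ell2 :: "'a ell2 \<Rightarrow> 'a ell2 \<Rightarrow> 'a ell2" is "\<lambda>f g x. f x + g x"
  by (rule square_summable_add)
lift_definition scaleC_ell2 :: "complex \<Rightarrow> 'a ell2 \<Rightarrow> 'a ell2" is "\<lambda>a f x. a * f x"
  by (simp add: norm_mult power_mult_distrib summable_on_cmult_right)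
definition uminus_ell2 :: "'a ell2 \<Rightarrow> 'a ell2" where "uminus_ell2 f = scaleC (- 1) f"
definition minus_ell2 :: "'a ell2 \<Rightarrow> 'a ell2 \<Rightarrow> 'a ell2" where "minus_ell2 f g = f + (- g)"
definition scaleR_ell2 :: "real \<Rightarrow> 'a ell2 \<Rightarrow> 'a ell2" where "scaleR_ell2 r f = scaleC (of_real r) f"
definition norm_ell2 :: "'a ell2 \<Rightarrow> real" where
  "norm_ell2 f = sqrt (\<Sum>\<^sub>\<infinity>x. (cmod (coord f x))\<^sup>2)"
definition dist_ell2 :: "'a ell2 \<Rightarrow> 'a ell2 \<Rightarrow> real" where "dist_ell2 f g = norm (f - g)"
definition sgn_ell2 :: "'a ell2 \<Rightarrow> 'a ell2" where "sgn_ell2 f = inverse (norm f) *\<^sub>R f"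
definition uniformity_ell2 :: "('a ell2 \<times> 'a ell2) filter" where
  "uniformity_ell2 = (INF e\<in>{0 <..}. principal {(x, y). dist x (y :: 'a ell2) < e})"
definition open_ell2 :: "'a ell2 set \<Rightarrow> bool" where
  "open_ell2 U = (\<forall>x\<in>U. \<forall>\<^sub>F (x', y) in uniformity. x' = x \<longrightarrow> y \<in> U)"
definition cinner_ell2 :: "'a ell2 \<Rightarrow> 'a ell2 \<Rightarrow> complex" where
  "cinner_ell2 f g = (\<Sum>\<^sub>\<infinity>x. coord f x * cnj (coord g x))"

lemma coord_simps [simp]:
  "coord 0 x = 0"
  "coord (f + g) x = coord f x + coord g x"
  "coord (a *\<^sub>C f) x = a * coord f x"
  "coord (- f) x = - coord f x"
  "coord (f - g) x = coord f x - coord g x"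
  "coord (r *\<^sub>R f) x = of_real r * coord f x"
  by (simp_all add: zero_ell2.rep_eq plus_ell2.rep_eq scaleC_ell2.rep_eq uminus_ell2_def
      minus_ell2_def scaleR_ell2_def)

lemma norm_ell2_sq: "(norm f)\<^sup>2 = (\<Sum>\<^sub>\<infinity>x. (cmod (coord f x))\<^sup>2)"
  unfolding norm_ell2_def by (simp add: infsum_nonneg)

lemma norm_ell2_nonneg: "norm (f::'a ell2) \<ge> 0"
  unfolding norm_ell2_def by (simp add: infsum_nonneg)

lemma L2_set_coord_le_norm:
  assumes "finite F" shows "L2_set (\<lambda>x. cmod (coord f x)) F \<le> norm f"
  unfolding L2_set_def norm_ell2_def
  by (intro real_sqrt_le_mono finite_sum_le_infsum summable_coord assms) auto

lemma norm_ell2_leI: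
  assumes "b \<ge> 0" "\<And>F. finite F \<Longrightarrow> L2_set (\<lambda>x. cmod (coord f x)) F \<le> b"
  shows "norm f \<le> b"
proof (rule power2_le_imp_le[OF _ assms(1)])
  show "(norm f)\<^sup>2 \<le> b\<^sup>2"
    unfolding norm_ell2_sq
  proof (rule infsum_le_finite_sums[OF summable_coord])
    fix F :: "'a set" assume "finite F"
    then have "(L2_set (\<lambda>x. cmod (coord f x)) F)\<^sup>2 \<le> b\<^sup>2"
      using assms by (intro power_mono) auto
    then show "(\<Sum>x\<in>F. (cmod (coord f x))\<^sup>2) \<le> b\<^sup>2"
      by (simp add: L2_set_def sum_nonneg)
  qed
qed

lemma norm_ell2_triangle: "norm (f + g) \<le> norm f + norm (g::'a ell2)"
proof (rule norm_ell2_leI)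
  fix F :: "'a set" assume F: "finite F"
  have "L2_set (\<lambda>x. cmod (coord (f + g) x)) F \<le> L2_set (\<lambda>x. cmod (coord f x) + cmod (coord g x)) F"
    by (intro L2_set_mono) (auto simp: norm_triangle_ineq)
  also have "\<dots> \<le> L2_set (\<lambda>x. cmod (coord f x)) F + L2_set (\<lambda>x. cmod (coord g x)) F"
    by (rule L2_set_triangle_ineq)
  also have "\<dots> \<le> norm f + norm g"
    by (intro add_mono L2_set_coord_le_norm F)
  finally show "L2_set (\<lambda>x. cmod (coord (f + g) x)) F \<le> norm f + norm g" .
qed (simp add: norm_ell2_nonneg)

instance
proof
  fix a b :: complex and r s :: real and x y z :: "'a ell2"
  show "x + y + z = x + (y + z)" "x + y = y + x" "0 + x = x" "- x + x = 0" "x - y = x + - y"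
    "r *\<^sub>R (x + y) = r *\<^sub>R x + r *\<^sub>R y" "(r + s) *\<^sub>R x = r *\<^sub>R x + s *\<^sub>R x"
    "r *\<^sub>R s *\<^sub>R x = (r * s) *\<^sub>R x" "1 *\<^sub>R x = x"
    "a *\<^sub>C (x + y) = a *\<^sub>C x + a *\<^sub>C y" "(a + b) *\<^sub>C x = a *\<^sub>C x + b *\<^sub>C x"
    "a *\<^sub>C b *\<^sub>C x = (a * b) *\<^sub>C x" "complex_of_real r *\<^sub>C x = r *\<^sub>R x"
    by (rule ell2_eqI; simp add: algebra_simps)+
  show "dist x y = norm (x - y)" "sgn x = inverse (norm x) *\<^sub>R x"
    by (simp_all add: dist_ell2_def sgn_ell2_def)
  show "uniformity = (INF e\<in>{0<..}. principal {(x::'a ell2, y). dist x y < e})"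
    by (rule uniformity_ell2_def)
  show "open U = (\<forall>x\<in>U. \<forall>\<^sub>F (x', y) in uniformity. x' = x \<longrightarrow> y \<in> U)" for U :: "'a ell2 set"
    by (rule open_ell2_def)
  show "(norm x = 0) = (x = 0)"
  proof
    assume "norm x = 0"
    then have "(norm x)\<^sup>2 = 0" by simp
    then have "(cmod (coord x u))\<^sup>2 = 0" for u
      unfolding norm_ell2_sq
      by (intro nonneg_infsum_le_0D[of "\<lambda>u. (cmod (coord x u))\<^sup>2" UNIV u])
         (auto intro: summable_coord)
    then show "x = 0" by (intro ell2_eqI) simp
  qed (simp add: norm_ell2_def)
  show "norm (x + y) \<le> norm x + norm y" by (rule norm_ell2_triangle)
  show "norm (r *\<^sub>R x) = \<bar>r\<bar> * norm x"
    by (simp add: norm_ell2_def norm_mult power_mult_distrib infsum_cmult_right' real_sqrt_mult)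
  show "cinner x y = cnj (cinner y x)"
    unfolding cinner_ell2_def infsum_cnj[symmetric] by (simp add: mult.commute)
  show "cinner (x + y) z = cinner x z + cinner y z"
    by (simp add: cinner_ell2_def distrib_right infsum_add summable_coord_mult)
  show "cinner (a *\<^sub>C x) y = a * cinner x y"
    by (simp add: cinner_ell2_def mult.assoc infsum_cmult_right')
  show "cinner x x = complex_of_real ((norm x)\<^sup>2)"
  proof -
    have "((\<lambda>u. (cmod (coord x u))\<^sup>2) has_sum (norm x)\<^sup>2) UNIV"
      unfolding norm_ell2_sq by (rule has_sum_infsum[OF summable_coord])
    then have "((\<lambda>u. complex_of_real ((cmod (coord x u))\<^sup>2)) has_sum complex_of_real ((norm x)\<^sup>2)) UNIV"
      by (rule has_sum_of_real)
    then have "((\<lambda>u. coord x u * cnj (coord x u)) has_sum complex_of_real ((norm x)\<^sup>2)) UNIV"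
      by (simp only: complex_norm_square)
    then show ?thesis
      unfolding cinner_ell2_def by (rule infsumI)
  qed
qed

end

lemma has_sum_norm_ell2: "((\<lambda>x. (cmod (coord f x))\<^sup>2) has_sum (norm f)\<^sup>2) UNIV"
  unfolding norm_ell2_sq using summable_coord by (rule has_sum_infsum)

lemma has_sum_cinner_ell2:
  "((\<lambda>x. coord f x * cnj (coord g x)) has_sum cinner f g) UNIV"
  unfolding cinner_ell2_def using summable_coord_mult by (rule has_sum_infsum)

lemma cmod_coord_le_norm: "cmod (coord f x) \<le> norm f"
  using L2_set_coord_le_norm[of "{x}" f] by (simp add: L2_set_def)

text \<open>A Cauchy sequence converges coordinatewise; the estimates on finite sets of coordinates,
  uniform in the set, carry membership and convergence over to the limit.\<close>
instance ell2 :: (type) chilbert_space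
proof
  fix X :: "nat \<Rightarrow> 'a ell2" assume C: "Cauchy X"
  have "Cauchy (\<lambda>n. coord (X n) x)" for x
  proof (rule CauchyI)
    fix e :: real assume "e > 0"
    then obtain M where M: "\<And>m n. m \<ge> M \<Longrightarrow> n \<ge> M \<Longrightarrow> norm (X m - X n) < e"
      using CauchyD[OF C] by metis
    have "norm (coord (X m) x - coord (X n) x) < e" if "m \<ge> M" "n \<ge> M" for m n
      using cmod_coord_le_norm[of "X m - X n" x] M[OF that] by simp
    then show "\<exists>M. \<forall>m\<ge>M. \<forall>n\<ge>M. norm (coord (X m) x - coord (X n) x) < e" by blast
  qed
  then have "\<exists>l. (\<lambda>n. coord (X n) x) \<longlonglongrightarrow> l" for x
    using Cauchy_convergent_iff convergent_def by blast
  then obtain g where g: "\<And>x. (\<lambda>n. coord (X n) x) \<longlonglongrightarrow> g x" by metis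
  obtain K where K: "\<And>n. norm (X n) \<le> K"
    using Cauchy_Bseq[OF C] by (auto simp: Bseq_def)
  have "(\<lambda>x. (cmod (g x))\<^sup>2) summable_on UNIV"
  proof (rule nonneg_bdd_above_summable_on)
    show "bdd_above (sum (\<lambda>x. (cmod (g x))\<^sup>2) ` {F. F \<subseteq> UNIV \<and> finite F})"
    proof (rule bdd_aboveI2[of _ _ "K\<^sup>2"])
      fix F :: "'a set" assume F: "F \<in> {F. F \<subseteq> UNIV \<and> finite F}"
      have "(\<Sum>x\<in>F. (cmod (coord (X n) x))\<^sup>2) \<le> K\<^sup>2" for n
      proof -
        have "(L2_set (\<lambda>x. cmod (coord (X n) x)) F)\<^sup>2 \<le> K\<^sup>2"
          using L2_set_coord_le_norm[of F "X n"] K[of n] F by (intro power_mono) auto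
        then show ?thesis by (simp add: L2_set_def sum_nonneg)
      qed
      moreover have "(\<lambda>n. \<Sum>x\<in>F. (cmod (coord (X n) x))\<^sup>2) \<longlonglongrightarrow> (\<Sum>x\<in>F. (cmod (g x))\<^sup>2)"
        by (intro tendsto_intros g)
      ultimately show "(\<Sum>x\<in>F. (cmod (g x))\<^sup>2) \<le> K\<^sup>2"
        by (meson LIMSEQ_le_const2)
    qed
  qed simp
  then have co: "coord (Abs_ell2 g) = g"
    by (simp add: Abs_ell2_inverse)
  have "X \<longlonglongrightarrow> Abs_ell2 g"
  proof (rule LIMSEQ_I)
    fix e :: real assume e: "e > 0"
    then obtain M where M: "\<And>m n. m \<ge> M \<Longrightarrow> n \<ge> M \<Longrightarrow> norm (X m - X n) < e / 2"
      using CauchyD[OF C, of "e/2"] by (metis half_gt_zero)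
    have "norm (X n - Abs_ell2 g) < e" if n: "n \<ge> M" for n
    proof -
      have "norm (X n - Abs_ell2 g) \<le> e / 2"
      proof (rule norm_ell2_leI)
        fix F :: "'a set" assume F: "finite F"
        have "L2_set (\<lambda>x. cmod (coord (X n - X m) x)) F \<le> e / 2" if "m \<ge> M" for m
          using L2_set_coord_le_norm[OF F, of "X n - X m"] M[OF n that] by linarith
        moreover have "(\<lambda>m. L2_set (\<lambda>x. cmod (coord (X n - X m) x)) F)
            \<longlonglongrightarrow> L2_set (\<lambda>x. cmod (coord (X n - Abs_ell2 g) x)) F"
          unfolding L2_set_def by (simp add: co) (intro tendsto_intros g)
        ultimately show "L2_set (\<lambda>x. cmod (coord (X n - Abs_ell2 g) x)) F \<le> e / 2"
          by (meson LIMSEQ_le_const2)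
      qed (use e in simp)
      then show ?thesis using e by simp
    qed
    then show "\<exists>M. \<forall>n\<ge>M. norm (X n - Abs_ell2 g) < e" by blast
  qed
  then show "convergent X" by (auto simp: convergent_def)
qed

definition supported :: "'a set \<Rightarrow> 'a ell2 set" where
  "supported S = {f. \<forall>x. x \<notin> S \<longrightarrow> coord f x = 0}"

definition delta :: "'a \<Rightarrow> 'a ell2" where
  "delta a = Abs_ell2 (\<lambda>x. if x = a then 1 else 0)"

lemma coord_delta [simp]: "coord (delta a) x = (if x = a then 1 else 0)"
proof -
  have "(\<lambda>x. (cmod (if x = a then 1 else 0))\<^sup>2) summable_on UNIV"
    by (rule finite_nonzero_values_imp_summable_on) auto
  then show ?thesis
    unfolding delta_def by (subst Abs_ell2_inverse) auto
qed

lemma cinner_delta [simp]: "cinner f (delta a) = coord f a"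
proof (rule has_sum_unique[OF has_sum_cinner_ell2])
  have "((\<lambda>x. coord f x * cnj (coord (delta a) x)) has_sum (\<Sum>x\<in>{a}. coord f x * cnj (coord (delta a) x))) UNIV"
    by (rule has_sum_finite_neutralI[of "{a}"]) auto
  then show "((\<lambda>x. coord f x * cnj (coord (delta a) x)) has_sum coord f a) UNIV"
    by simp
qed

lemma closed_csubspace_supported: "closed_csubspace (supported S)"
proof -
  have *: "supported S = {f. \<forall>s\<in>delta ` (- S). cinner f s = 0}"
    by (auto simp: supported_def)
  show ?thesis
    unfolding * by (rule closed_csubspace_orthogonal)
qed

lemma cinner_disjoint_supported:
  assumes "f \<in> supported S" "g \<in> supported T" "S \<inter> T = {}"
  shows "cinner f g = 0"
proof -
  have *: "(\<lambda>x. coord f x * cnj (coord g x)) = (\<lambda>_. 0)"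
    using assms unfolding supported_def fun_eq_iff by fastforce
  show ?thesis unfolding cinner_ell2_def * by simp
qed

lemma has_sum_norm_supported:
  assumes "f \<in> supported S"
  shows "((\<lambda>x. (cmod (coord f x))\<^sup>2) has_sum (norm f)\<^sup>2) S"
proof -
  have "((\<lambda>x. (cmod (coord f x))\<^sup>2) has_sum (norm f)\<^sup>2) UNIV \<longleftrightarrow>
      ((\<lambda>x. (cmod (coord f x))\<^sup>2) has_sum (norm f)\<^sup>2) S"
    by (rule has_sum_cong_neutral) (use assms in \<open>auto simp: supported_def\<close>)
  then show ?thesis using has_sum_norm_ell2 by blast
qed

text \<open>Composition with a map that is not injective need not preserve square-summability; the value
  \<open>0\<close> in that case makes the operation total.\<close>
lift_definition reindex :: "('a \<Rightarrow> 'a) \<Rightarrow> 'a ell2 \<Rightarrow> 'a ell2" is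
  "\<lambda>p f x. if bij p then f (p x) else 0"
proof -
  fix p :: "'a \<Rightarrow> 'a" and f :: "'a \<Rightarrow> complex"
  assume "(\<lambda>x. (cmod (f x))\<^sup>2) summable_on UNIV"
  then show "(\<lambda>x. (cmod (if bij p then f (p x) else 0))\<^sup>2) summable_on UNIV"
    using summable_on_reindex_bij_betw[of p UNIV UNIV "\<lambda>x. (cmod (f x))\<^sup>2"]
    by (cases "bij p") simp_all
qed

lemma coord_reindex: "bij p \<Longrightarrow> coord (reindex p f) x = coord f (p x)"
  by (simp add: reindex.rep_eq)

lemma clinear_reindex: "clinear (reindex p)"
  by (intro clinearI ell2_eqI) (simp_all add: reindex.rep_eq)

lemma cinner_reindex: "bij p \<Longrightarrow> cinner (reindex p f) (reindex p g) = cinner f g"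
  using infsum_reindex_bij_betw[of p UNIV UNIV "\<lambda>x. coord f x * cnj (coord g x)"]
  by (simp add: cinner_ell2_def coord_reindex)

section \<open>Unitary actions and invariant subspaces\<close>

definition invariant ::
    "('g, 'm) monoid_scheme \<Rightarrow> ('g \<Rightarrow> 'a \<Rightarrow> 'a) \<Rightarrow> 'a::complex_inner set \<Rightarrow> bool" where
  "invariant G \<sigma> A \<longleftrightarrow> closed_csubspace A \<and> (\<forall>g\<in>carrier G. \<forall>x\<in>A. \<sigma> g x \<in> A)"

locale unitary_action = group G for G :: "('g, 'm) monoid_scheme" (structure) +
  fixes \<sigma> :: "'g \<Rightarrow> 'a::chilbert_space \<Rightarrow> 'a"
  assumes clinear_action: "g \<in> carrier G \<Longrightarrow> clinear (\<sigma> g)"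
    and cinner_action: "g \<in> carrier G \<Longrightarrow> cinner (\<sigma> g x) (\<sigma> g y) = cinner x y"
    and action_mult: "g \<in> carrier G \<Longrightarrow> h \<in> carrier G \<Longrightarrow> \<sigma> (g \<otimes> h) x = \<sigma> g (\<sigma> h x)"
    and action_one: "\<sigma> \<one> x = x"
begin

lemma action_inv [simp]:
  assumes "g \<in> carrier G"
  shows "\<sigma> g (\<sigma> (inv g) x) = x" "\<sigma> (inv g) (\<sigma> g x) = x"
  using assms action_mult[of g "inv g" x] action_mult[of "inv g" g x] by (simp_all add: action_one)

lemma cinner_action_left: "g \<in> carrier G \<Longrightarrow> cinner (\<sigma> g x) y = cinner x (\<sigma> (inv g) y)"
  using cinner_action[of "inv g" "\<sigma> g x" y] by simp

lemma cinner_action_right: "g \<in> carrier G \<Longrightarrow> cinner x (\<sigma> g y) = cinner (\<sigma> (inv g) x) y"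
  using cinner_action_left[of "inv g" x y] by simp

lemma norm_action: "g \<in> carrier G \<Longrightarrow> norm (\<sigma> g x) = norm x"
proof -
  assume "g \<in> carrier G"
  then have "complex_of_real ((norm (\<sigma> g x))\<^sup>2) = complex_of_real ((norm x)\<^sup>2)"
    by (metis cinner_self cinner_action)
  then show ?thesis
    by (metis of_real_eq_iff norm_ge_zero power2_eq_iff_nonneg)
qed

lemma invariantD:
  assumes "invariant G \<sigma> A" shows "closed_csubspace A" "g \<in> carrier G \<Longrightarrow> x \<in> A \<Longrightarrow> \<sigma> g x \<in> A"
  using assms unfolding invariant_def by auto

lemma invariant_Int: "invariant G \<sigma> A \<Longrightarrow> invariant G \<sigma> B \<Longrightarrow> invariant G \<sigma> (A \<inter> B)"
  unfolding invariant_def using closed_csubspace_Int by blast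

lemma invariant_orthogonal:
  assumes "\<And>g s. g \<in> carrier G \<Longrightarrow> s \<in> S \<Longrightarrow> \<sigma> g s \<in> S"
  shows "invariant G \<sigma> {x. \<forall>s\<in>S. cinner x s = 0}"
  unfolding invariant_def using closed_csubspace_orthogonal assms
  by (auto simp: cinner_action_left)

lemma proj_action:
  assumes "invariant G \<sigma> A" "g \<in> carrier G"
  shows "proj A (\<sigma> g x) = \<sigma> g (proj A x)"
  using assms by (intro proj_intertwines[where V = "\<sigma> (inv g)"])
    (auto simp: invariantD clinear_action cinner_action_left)

end

section \<open>The regular representations\<close>

text \<open>Elements outside the carrier are fixed, so that the translations are unitary on all of
  \<open>'g ell2\<close> and not only on the functions supported in the carrier.\<close>
definition lam :: "('g, 'm) monoid_scheme \<Rightarrow> 'g \<Rightarrow> 'g ell2 \<Rightarrow> 'g ell2" where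
  "lam G g = reindex (\<lambda>x. if x \<in> carrier G then inv\<^bsub>G\<^esub> g \<otimes>\<^bsub>G\<^esub> x else x)"

definition rho :: "('g, 'm) monoid_scheme \<Rightarrow> 'g \<Rightarrow> 'g ell2 \<Rightarrow> 'g ell2" where
  "rho G g = reindex (\<lambda>x. if x \<in> carrier G then x \<otimes>\<^bsub>G\<^esub> g else x)"

lemma bij_extend_id:
  assumes "bij_betw f S S"
  shows "bij (\<lambda>x. if x \<in> S then f x else x)"
proof -
  have "bij_betw (\<lambda>x. if x \<in> S then f x else x) (S \<union> - S) (S \<union> - S)"
    using assms by (intro bij_betw_disjoint_Un) (auto simp: bij_betw_def inj_on_def)
  then show ?thesis by simp
qed

context group
begin

lemma bij_lam: "g \<in> carrier G \<Longrightarrow> bij (\<lambda>x. if x \<in> carrier G then inv g \<otimes> x else x)"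
  by (intro bij_extend_id bij_betw_byWitness[where f' = "\<lambda>x. g \<otimes> x"]) (auto simp flip: m_assoc)

lemma bij_rho: "g \<in> carrier G \<Longrightarrow> bij (\<lambda>x. if x \<in> carrier G then x \<otimes> g else x)"
  by (intro bij_extend_id bij_betw_byWitness[where f' = "\<lambda>x. x \<otimes> inv g"]) (auto simp: m_assoc)

lemma coord_lam:
  "g \<in> carrier G \<Longrightarrow> coord (lam G g f) x = coord f (if x \<in> carrier G then inv g \<otimes> x else x)"
  unfolding lam_def by (rule coord_reindex[OF bij_lam])

lemma coord_rho:
  "g \<in> carrier G \<Longrightarrow> coord (rho G g f) x = coord f (if x \<in> carrier G then x \<otimes> g else x)"
  unfolding rho_def by (rule coord_reindex[OF bij_rho])

lemma unitary_action_lam: "unitary_action G (lam G)"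
proof (intro unitary_action.intro unitary_action_axioms.intro group_axioms)
  show "cinner (lam G g x) (lam G g y) = cinner x y" if "g \<in> carrier G" for g x y
    unfolding lam_def by (rule cinner_reindex[OF bij_lam[OF that]])
  show "lam G (g \<otimes> h) x = lam G g (lam G h x)" if "g \<in> carrier G" "h \<in> carrier G" for g h x
    using that by (intro ell2_eqI) (simp add: coord_lam inv_mult_group m_assoc)
  show "lam G \<one> x = x" for x
    by (intro ell2_eqI) (simp add: coord_lam)
qed (simp add: lam_def clinear_reindex)

lemma unitary_action_rho: "unitary_action G (rho G)"
proof (intro unitary_action.intro unitary_action_axioms.intro group_axioms)
  show "cinner (rho G g x) (rho G g y) = cinner x y" if "g \<in> carrier G" for g x y
    unfolding rho_def by (rule cinner_reindex[OF bij_rho[OF that]])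
  show "rho G (g \<otimes> h) x = rho G g (rho G h x)" if "g \<in> carrier G" "h \<in> carrier G" for g h x
    using that by (intro ell2_eqI) (simp add: coord_rho m_assoc)
  show "rho G \<one> x = x" for x
    by (intro ell2_eqI) (simp add: coord_rho)
qed (simp add: rho_def clinear_reindex)

lemma lam_rho_commute:
  "g \<in> carrier G \<Longrightarrow> h \<in> carrier G \<Longrightarrow> lam G g (rho G h f) = rho G h (lam G g f)"
  by (intro ell2_eqI) (simp add: coord_lam coord_rho m_assoc)

lemma lam_delta: "g \<in> carrier G \<Longrightarrow> x \<in> carrier G \<Longrightarrow> lam G g (delta x) = delta (g \<otimes> x)"
  by (intro ell2_eqI) (auto simp: coord_lam inv_solve_left')

lemma rho_delta: "g \<in> carrier G \<Longrightarrow> x \<in> carrier G \<Longrightarrow> rho G g (delta x) = delta (x \<otimes> inv g)"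
  by (intro ell2_eqI) (auto simp: coord_rho inv_solve_right m_assoc)

lemma lam_supported: "g \<in> carrier G \<Longrightarrow> f \<in> supported (carrier G) \<Longrightarrow> lam G g f \<in> supported (carrier G)"
  by (simp add: supported_def coord_lam)

lemma rho_supported: "g \<in> carrier G \<Longrightarrow> f \<in> supported (carrier G) \<Longrightarrow> rho G g f \<in> supported (carrier G)"
  by (simp add: supported_def coord_rho)

end

sublocale group \<subseteq> lam: unitary_action G "lam G" by (rule unitary_action_lam)
sublocale group \<subseteq> rho: unitary_action G "rho G" by (rule unitary_action_rho)

lemma ell2_constant_on_infinite:
  assumes "infinite S" "\<And>x. x \<in> S \<Longrightarrow> coord f x = c"
  shows "c = 0"
proof (rule ccontr)
  assume c: "c \<noteq> 0"
  obtain n :: nat where n: "(norm f)\<^sup>2 < of_nat n * (cmod c)\<^sup>2"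
    using reals_Archimedean3[of "(cmod c)\<^sup>2"] c by auto
  obtain F where F: "finite F" "card F = n" "F \<subseteq> S"
    using infinite_arbitrarily_large[OF assms(1)] by blast
  have "(L2_set (\<lambda>x. cmod (coord f x)) F)\<^sup>2 \<le> (norm f)\<^sup>2"
    by (intro power_mono L2_set_coord_le_norm F) simp
  moreover have "(L2_set (\<lambda>x. cmod (coord f x)) F)\<^sup>2 = (\<Sum>x\<in>F. (cmod (coord f x))\<^sup>2)"
    by (simp add: L2_set_def sum_nonneg)
  moreover have "(\<Sum>x\<in>F. (cmod (coord f x))\<^sup>2) = of_nat n * (cmod c)\<^sup>2"
    using F assms(2) by (subst sum.cong[OF refl, of _ _ "\<lambda>_. (cmod c)\<^sup>2"]) auto
  ultimately show False using n by simp
qed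

section \<open>Comparison of invariant subspaces of the regular representation\<close>

text \<open>The functions orthogonal to all right translates of \<open>A\<close> form a closed subspace \<open>M\<close> invariant
  under left and right translations. The projection \<open>z\<close> of \<open>\<delta>\<^sub>1\<close> to \<open>M\<close> is therefore constant on
  conjugacy classes, and all of these but one are infinite, so that \<open>z\<close> is a multiple of \<open>\<delta>\<^sub>1\<close>.
  Suppose that \<open>B \<subseteq> M\<close>. If \<open>z = 0\<close> then \<open>M = {0}\<close>, so \<open>B = {0}\<close>; otherwise \<open>\<delta>\<^sub>1 \<in> M\<close> and
  \<open>A = {0}\<close>.\<close>
lemma icc_invariant_subspaces_not_disjoint:
  fixes G :: "('g, 'm) monoid_scheme" (structure)
  assumes icc: "icc_group G"
    and A: "invariant G (lam G) A" "A \<subseteq> supported (carrier G)" "x\<^sub>0 \<in> A" "x\<^sub>0 \<noteq> 0"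
    and B: "invariant G (lam G) B" "B \<subseteq> supported (carrier G)" "y\<^sub>0 \<in> B" "y\<^sub>0 \<noteq> 0"
  shows "\<exists>g\<in>carrier G. \<exists>x\<in>A. \<exists>y\<in>B. cinner (rho G g x) y \<noteq> 0"
proof (rule ccontr)
  interpret group G using icc by (simp add: icc_group_def)
  assume "\<not> (\<exists>g\<in>carrier G. \<exists>x\<in>A. \<exists>y\<in>B. cinner (rho G g x) y \<noteq> 0)"
  then have zero: "cinner (rho G g x) y = 0" if "g \<in> carrier G" "x \<in> A" "y \<in> B" for g x y
    using that by blast
  define S where "S = {rho G g x |g x. g \<in> carrier G \<and> x \<in> A}"
  define M where "M = {f. \<forall>s\<in>S. cinner f s = 0} \<inter> supported (carrier G)"
  have "lam G g s \<in> S" if "g \<in> carrier G" "s \<in> S" for g s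
  proof -
    from that obtain h x where "s = rho G h x" "h \<in> carrier G" "x \<in> A"
      by (auto simp: S_def)
    then show ?thesis
      using that(1) lam.invariantD(2)[OF A(1)] by (auto simp: S_def lam_rho_commute)
  qed
  then have lam_M: "invariant G (lam G) M"
    unfolding M_def by (intro lam.invariant_Int lam.invariant_orthogonal)
      (auto simp: invariant_def closed_csubspace_supported lam_supported)
  have "rho G g s \<in> S" if "g \<in> carrier G" "s \<in> S" for g s
  proof -
    from that obtain h x where *: "s = rho G h x" "h \<in> carrier G" "x \<in> A"
      by (auto simp: S_def)
    then have "rho G g s = rho G (g \<otimes> h) x"
      using that(1) by (simp add: rho.action_mult)
    then show ?thesis
      using that(1) * unfolding S_def by blast
  qed
  then have rho_M: "invariant G (rho G) M"
    unfolding M_def by (intro rho.invariant_Int rho.invariant_orthogonal)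
      (auto simp: invariant_def closed_csubspace_supported rho_supported)
  have cM: "closed_csubspace M" using lam_M by (rule lam.invariantD)
  define z where "z = proj M (delta \<one>)"
  have z_conj: "coord z (inv g \<otimes> x \<otimes> g) = coord z x" if "g \<in> carrier G" "x \<in> carrier G" for g x
  proof -
    have "lam G g (rho G g z) = proj M (lam G g (rho G g (delta \<one>)))"
      unfolding z_def using that by (simp add: lam.proj_action[OF lam_M] rho.proj_action[OF rho_M])
    also have "lam G g (rho G g (delta \<one>)) = delta \<one>"
      using that by (simp add: rho_delta lam_delta)
    finally have "coord (lam G g (rho G g z)) x = coord z x"
      by (simp add: z_def)
    then show ?thesis
      using that by (simp add: coord_lam coord_rho)
  qed
  have "coord z x = 0" if "x \<noteq> \<one>" for x
  proof (cases "x \<in> carrier G")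
    case True
    then have "infinite {k \<otimes> x \<otimes> inv k |k. k \<in> carrier G}"
      using icc that by (auto simp: icc_group_def)
    moreover have "coord z y = coord z x" if "y \<in> {k \<otimes> x \<otimes> inv k |k. k \<in> carrier G}" for y
    proof -
      obtain k where "y = k \<otimes> x \<otimes> inv k" "k \<in> carrier G"
        using \<open>y \<in> _\<close> by blast
      then show ?thesis
        using z_conj[of "inv k" x] True by simp
    qed
    ultimately show ?thesis by (rule ell2_constant_on_infinite)
  next
    case False
    then show ?thesis
      using proj_in[OF cM] unfolding z_def by (auto simp: M_def supported_def)
  qed
  then have z: "z = coord z \<one> *\<^sub>C delta \<one>"
    by (intro ell2_eqI) simp
  have "coord z \<one> \<noteq> 0"
  proof
    assume "coord z \<one> = 0"
    then have z0: "z = 0" using z ell2_eqI[of "coord z \<one> *\<^sub>C delta \<one>" 0] by simp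
    have yM: "y \<in> M" if "y \<in> B" for y
      using that zero B(2) cinner_commute[of y] by (auto simp: M_def S_def)
    have "coord y\<^sub>0 g = 0" if g: "g \<in> carrier G" for g
    proof -
      have "lam G (inv g) y\<^sub>0 \<in> M"
        using yM lam.invariantD(2)[OF B(1)] B(3) g by simp
      then have "coord (lam G (inv g) y\<^sub>0) \<one> = cinner (lam G (inv g) y\<^sub>0) z"
        using cinner_proj'[OF cM, of _ "delta \<one>"] by (simp add: z_def)
      then show ?thesis using g z0 by (simp add: coord_lam)
    qed
    then have "y\<^sub>0 = 0"
      using B(2,3) by (intro ell2_eqI) (auto simp: supported_def)
    then show False using B(4) by simp
  qed
  then have "delta \<one> = (1 / coord z \<one>) *\<^sub>C z"
    by (subst z) (simp add: scaleC_scaleC)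
  moreover have "z \<in> M" unfolding z_def by (rule proj_in[OF cM])
  ultimately have dM: "delta \<one> \<in> M"
    using closed_csubspaceD(3)[OF cM] by metis
  have "coord x\<^sub>0 g = 0" if g: "g \<in> carrier G" for g
  proof -
    have "cinner (delta \<one>) (rho G g x\<^sub>0) = 0"
      using dM A(3) g by (auto simp: M_def S_def)
    then have "cinner (rho G g x\<^sub>0) (delta \<one>) = 0"
      by (subst cinner_commute) simp
    then show ?thesis using g by (simp add: coord_rho)
  qed
  then have "x\<^sub>0 = 0"
    using A(2,3) by (intro ell2_eqI) (auto simp: supported_def)
  then show False using A(4) by simp
qed

text \<open>Compatible pairs are the pairs in the graph of a partial isometric intertwiner, described by
  inner products alone. No linearity or closure has to be maintained, and unions of chains of
  compatible relations are compatible.\<close>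
definition compatible ::
    "('g, 'm) monoid_scheme \<Rightarrow> ('g \<Rightarrow> 'a \<Rightarrow> 'a) \<Rightarrow> ('a::complex_inner \<times> 'a) set \<Rightarrow> bool" where
  "compatible G \<sigma> F \<longleftrightarrow> (\<forall>a b a' b' g. (a, b) \<in> F \<longrightarrow> (a', b') \<in> F \<longrightarrow> g \<in> carrier G \<longrightarrow>
     cinner (\<sigma> g a) a' = cinner (\<sigma> g b) b')"

definition maximal_compatible ::
    "('g, 'm) monoid_scheme \<Rightarrow> ('g \<Rightarrow> 'a \<Rightarrow> 'a) \<Rightarrow> 'a::complex_inner set \<Rightarrow> 'a set \<Rightarrow> ('a \<times> 'a) set \<Rightarrow> bool" where
  "maximal_compatible G \<sigma> A B F \<longleftrightarrow> F \<subseteq> A \<times> B \<and> compatible G \<sigma> F \<and>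
     (\<forall>F'. F \<subseteq> F' \<longrightarrow> F' \<subseteq> A \<times> B \<longrightarrow> compatible G \<sigma> F' \<longrightarrow> F' = F)"

lemma compatibleD:
  "compatible G \<sigma> F \<Longrightarrow> (a, b) \<in> F \<Longrightarrow> (a', b') \<in> F \<Longrightarrow> g \<in> carrier G \<Longrightarrow>
    cinner (\<sigma> g a) a' = cinner (\<sigma> g b) b'"
  unfolding compatible_def by blast

lemma compatible_converse: "compatible G \<sigma> F \<Longrightarrow> compatible G \<sigma> (F\<inverse>)"
  by (auto simp: compatible_def)

lemma maximal_compatible_converse:
  assumes "maximal_compatible G \<sigma> A B F"
  shows "maximal_compatible G \<sigma> B A (F\<inverse>)"
  unfolding maximal_compatible_def
proof (intro conjI allI impI)
  show "F\<inverse> \<subseteq> B \<times> A" using assms unfolding maximal_compatible_def by auto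
  show "compatible G \<sigma> (F\<inverse>)"
    using assms unfolding maximal_compatible_def by (intro compatible_converse) simp
  fix F' assume F': "F\<inverse> \<subseteq> F'" "F' \<subseteq> B \<times> A" "compatible G \<sigma> F'"
  have "F \<subseteq> F'\<inverse>" "F'\<inverse> \<subseteq> A \<times> B" using F'(1,2) by auto
  moreover have "compatible G \<sigma> (F'\<inverse>)" using F'(3) by (rule compatible_converse)
  ultimately have "F'\<inverse> = F"
    using assms unfolding maximal_compatible_def by metis
  then show "F' = F\<inverse>" by auto
qed

lemma maximal_compatible_exists: "\<exists>F. maximal_compatible G \<sigma> A B F"
proof -
  let ?Z = "{F. F \<subseteq> A \<times> B \<and> compatible G \<sigma> F}"
  have "\<exists>M\<in>?Z. \<forall>X\<in>?Z. M \<subseteq> X \<longrightarrow> X = M"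
  proof (rule subset_Zorn')
    fix C assume C: "subset.chain ?Z C"
    have "compatible G \<sigma> (\<Union>C)"
      unfolding compatible_def
    proof (clarify)
      fix a b a' b' g X Y
      assume *: "(a, b) \<in> X" "X \<in> C" "(a', b') \<in> Y" "Y \<in> C" "g \<in> carrier G"
      have "X \<subseteq> Y \<or> Y \<subseteq> X"
        using C *(2,4) unfolding subset_chain_def by blast
      then obtain W where W: "W \<in> C" "(a, b) \<in> W" "(a', b') \<in> W"
        using *(1-4) by blast
      then have "compatible G \<sigma> W"
        using C unfolding subset_chain_def by blast
      then show "cinner (\<sigma> g a) a' = cinner (\<sigma> g b) b'"
        using W(2,3) *(5) by (rule compatibleD)
    qed
    moreover have "C \<subseteq> ?Z"
      using C by (simp add: subset_chain_def)
    then have "X \<subseteq> A \<times> B" if "X \<in> C" for X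
      using that by blast
    ultimately show "\<Union>C \<in> ?Z" by (simp add: Union_least)
  qed
  then obtain M where M: "M \<in> ?Z" and max: "\<forall>X\<in>?Z. M \<subseteq> X \<longrightarrow> X = M" by (rule bexE)
  have "F' = M" if "M \<subseteq> F'" "F' \<subseteq> A \<times> B" "compatible G \<sigma> F'" for F'
    using bspec[OF max, of F'] that by simp
  then have "maximal_compatible G \<sigma> A B M"
    using M unfolding maximal_compatible_def by simp
  then show ?thesis by (rule exI)
qed

context unitary_action
begin

lemma maximal_compatible_memI:
  assumes F: "maximal_compatible G \<sigma> A B F" and ab: "a \<in> A" "b \<in> B"
    and cross: "\<And>a' b' g. (a', b') \<in> F \<Longrightarrow> g \<in> carrier G \<Longrightarrow> cinner (\<sigma> g a) a' = cinner (\<sigma> g b) b'"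
    and self: "\<And>g. g \<in> carrier G \<Longrightarrow> cinner (\<sigma> g a) a = cinner (\<sigma> g b) b"
  shows "(a, b) \<in> F"
proof -
  have comp: "compatible G \<sigma> F" using F unfolding maximal_compatible_def by blast
  have cross': "cinner (\<sigma> g a') a = cinner (\<sigma> g b') b" if "(a', b') \<in> F" "g \<in> carrier G" for a' b' g
    using cross[OF that(1), of "inv g"] that(2) cinner_action_left[OF that(2)]
    by (metis cinner_commute inv_closed)
  have "compatible G \<sigma> (insert (a, b) F)"
    unfolding compatible_def
  proof (intro allI impI)
    fix u v u' v' g
    assume "(u, v) \<in> insert (a, b) F" "(u', v') \<in> insert (a, b) F" "g \<in> carrier G"
    then show "cinner (\<sigma> g u) u' = cinner (\<sigma> g v) v'"
      using cross[of u' v' g] cross'[of u v g] self[of g] compatibleD[OF comp, of u v u' v' g]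
      by auto
  qed
  moreover have "insert (a, b) F \<subseteq> A \<times> B"
    using F ab unfolding maximal_compatible_def by blast
  ultimately have "insert (a, b) F = F"
    using F unfolding maximal_compatible_def by (metis subset_insertI)
  then show ?thesis by blast
qed

text \<open>In particular a compatible relation is single-valued in both directions.\<close>
lemma compatible_diff_norm:
  assumes "compatible G \<sigma> F" "(a, b) \<in> F" "(a', b') \<in> F"
  shows "norm (a - a') = norm (b - b')"
proof -
  have c: "cinner u u' = cinner v v'" if "(u, v) \<in> F" "(u', v') \<in> F" for u v u' v'
    using compatibleD[OF assms(1) that one_closed] by (simp add: action_one)
  have "cinner (a - a') (a - a') = cinner (b - b') (b - b')"
    using assms(2,3) by (simp add: cinner_diff_left cinner_diff_right c[of a b a b] c[of a b a' b']
        c[of a' b' a b] c[of a' b' a' b'])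
  then have "(norm (a - a'))\<^sup>2 = (norm (b - b'))\<^sup>2"
    unfolding cinner_self using of_real_eq_iff by blast
  then show ?thesis by (simp add: power2_eq_iff_nonneg)
qed

text \<open>Maximality makes the relation the graph of an isometry between closed invariant subspaces:
  linear combinations, translates and limits of pairs in the relation stay compatible with it.\<close>
lemma maximal_compatible_invariant_Domain:
  assumes A: "invariant G \<sigma> A" and B: "invariant G \<sigma> B" and F: "maximal_compatible G \<sigma> A B F"
  shows "invariant G \<sigma> (Domain F)"
    and "\<And>g a b. g \<in> carrier G \<Longrightarrow> (a, b) \<in> F \<Longrightarrow> (\<sigma> g a, \<sigma> g b) \<in> F"
proof -
  note Ac = closed_csubspaceD[OF invariantD(1)[OF A]] and Bc = closed_csubspaceD[OF invariantD(1)[OF B]]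
  have sub: "a \<in> A" "b \<in> B" if "(a, b) \<in> F" for a b
    using F that unfolding maximal_compatible_def by auto
  have comp: "compatible G \<sigma> F" using F unfolding maximal_compatible_def by blast
  note c = compatibleD[OF comp]
  note memI = maximal_compatible_memI[OF F]
  have act: "(\<sigma> h a, \<sigma> h b) \<in> F" if "h \<in> carrier G" "(a, b) \<in> F" for h a b
  proof (rule memI)
    fix g assume g: "g \<in> carrier G"
    show "cinner (\<sigma> g (\<sigma> h a)) a' = cinner (\<sigma> g (\<sigma> h b)) b'" if "(a', b') \<in> F" for a' b'
      using c[OF \<open>(a, b) \<in> F\<close> that, of "g \<otimes> h"] g \<open>h \<in> carrier G\<close> by (simp add: action_mult)
    have "cinner (\<sigma> (inv h \<otimes> (g \<otimes> h)) a) a = cinner (\<sigma> (inv h \<otimes> (g \<otimes> h)) b) b"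
      using that g by (intro c) auto
    then show "cinner (\<sigma> g (\<sigma> h a)) (\<sigma> h a) = cinner (\<sigma> g (\<sigma> h b)) (\<sigma> h b)"
      using that g by (simp add: action_mult cinner_action_right)
  qed (use that sub invariantD(2)[OF A] invariantD(2)[OF B] in blast)+
  then show "\<And>g a b. g \<in> carrier G \<Longrightarrow> (a, b) \<in> F \<Longrightarrow> (\<sigma> g a, \<sigma> g b) \<in> F" .
  have add: "(a + a', b + b') \<in> F" if "(a, b) \<in> F" "(a', b') \<in> F" for a b a' b'
    using that sub Ac(2) Bc(2)
    by (intro memI) (auto simp: clinear_add[OF clinear_action] cinner_add_left cinner_add_right c)
  have scale: "(r *\<^sub>C a, r *\<^sub>C b) \<in> F" if "(a, b) \<in> F" for r a b
    using that sub Ac(3) Bc(3)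
    by (intro memI) (auto simp: clinear_scaleC[OF clinear_action] cinner_scaleC_left cinner_scaleC_right c)
  have zero: "(0, 0) \<in> F"
    using Ac(1) Bc(1) by (intro memI) (auto simp: clinear_zero[OF clinear_action])
  have "closed (Domain F)"
    unfolding closed_sequential_limits
  proof (intro allI impI, elim conjE)
    fix X l assume "\<forall>n::nat. X n \<in> Domain F" and l: "X \<longlonglongrightarrow> l"
    then have "\<forall>n. \<exists>y. (X n, y) \<in> F" by (simp add: Domain_iff)
    then obtain Y where XY: "\<And>n. (X n, Y n) \<in> F" by metis
    have "Cauchy X" using l by (rule LIMSEQ_imp_Cauchy)
    then have "Cauchy Y"
      unfolding Cauchy_def dist_norm using compatible_diff_norm[OF comp XY XY] by simp
    then obtain m where m: "Y \<longlonglongrightarrow> m"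
      using Cauchy_convergent_iff convergent_def by blast
    have lA: "l \<in> A" and mB: "m \<in> B"
      using closed_sequentially[OF Ac(6) _ l] closed_sequentially[OF Bc(6) _ m] sub XY by blast+
    have half: "cinner (\<sigma> g l) a = cinner (\<sigma> g m) b" if "(a, b) \<in> F" "g \<in> carrier G" for g a b
    proof -
      have "(\<lambda>n. cinner (X n) (\<sigma> (inv g) a)) \<longlonglongrightarrow> cinner l (\<sigma> (inv g) a)"
        "(\<lambda>n. cinner (Y n) (\<sigma> (inv g) b)) \<longlonglongrightarrow> cinner m (\<sigma> (inv g) b)"
        by (intro cinner.tendsto tendsto_const l m)+
      moreover have "cinner (X n) (\<sigma> (inv g) a) = cinner (Y n) (\<sigma> (inv g) b)" for n
        using c[OF XY that(1) that(2)] that(2) by (simp add: cinner_action_left)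
      ultimately show ?thesis
        using that(2) by (simp add: cinner_action_left LIMSEQ_unique)
    qed
    have "(l, m) \<in> F"
    proof (rule memI[OF lA mB half])
      fix g assume g: "g \<in> carrier G"
      have "(\<lambda>n. cinner (\<sigma> g l) (X n)) \<longlonglongrightarrow> cinner (\<sigma> g l) l"
        "(\<lambda>n. cinner (\<sigma> g m) (Y n)) \<longlonglongrightarrow> cinner (\<sigma> g m) m"
        by (intro cinner.tendsto tendsto_const l m)+
      then show "cinner (\<sigma> g l) l = cinner (\<sigma> g m) m"
        using half[OF XY g] by (simp add: LIMSEQ_unique)
    qed
    then show "l \<in> Domain F" by blast
  qed
  then have "closed_csubspace (Domain F)"
    using zero add scale by (intro closed_csubspaceI) blast+
  then show "invariant G \<sigma> (Domain F)"
    unfolding invariant_def using act by blast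
qed

end

context group
begin

lemma cinner_lam_proj_delta:
  assumes A: "invariant G (lam G) A" and x: "x \<in> A" and g: "g \<in> carrier G"
  shows "cinner x (lam G g (proj A (delta \<one>))) = coord x g"
proof -
  have "cinner x (lam G g (proj A (delta \<one>))) = cinner x (proj A (delta g))"
    using g by (simp add: lam.proj_action[OF A, symmetric] lam_delta)
  then show ?thesis
    by (simp add: cinner_proj'[OF lam.invariantD(1)[OF A] x])
qed

text \<open>The coefficient at \<open>g\<close> is the value \<open>x g\<close>, because the projection onto \<open>A\<close> commutes with
  translations and fixes \<open>x\<close>.\<close>
lemma parseval_proj_delta:
  assumes A: "invariant G (lam G) A" "A \<subseteq> supported (carrier G)" and x: "x \<in> A"
  shows "((\<lambda>g. (cmod (cinner x (lam G g (proj A (delta \<one>)))))\<^sup>2) has_sum (norm x)\<^sup>2) (carrier G)"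
proof -
  have "((\<lambda>g. (cmod (coord x g))\<^sup>2) has_sum (norm x)\<^sup>2) (carrier G)"
    using A(2) x by (intro has_sum_norm_supported) auto
  then show ?thesis
    by (rule has_sum_cong[THEN iffD1, rotated]) (simp add: cinner_lam_proj_delta[OF A(1) x])
qed

text \<open>The norm of the projection of \<open>\<delta>\<^sub>1\<close>, the square root of the trace of the projection onto
  \<open>A\<close>, grows strictly with \<open>A\<close>.\<close>
lemma invariant_eqI_trace:
  assumes A: "invariant G (lam G) A" and B: "invariant G (lam G) B" "B \<subseteq> supported (carrier G)"
    and "A \<subseteq> B" and tr: "norm (proj A (delta \<one>)) = norm (proj B (delta \<one>))"
  shows "A = B"
proof -
  have cA: "closed_csubspace A" and cB: "closed_csubspace B"
    using lam.invariantD(1)[OF A] lam.invariantD(1)[OF B(1)] by -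
  define b where "b = proj B (delta \<one>)"
  have "proj A b = proj A (delta \<one>)"
    using \<open>A \<subseteq> B\<close> proj_in[OF cA]
    by (intro proj_eqI[OF cA])
       (auto simp: b_def cinner_diff_left cinner_proj[OF cB] cinner_proj[OF cA])
  then have "proj A b = b"
    using norm_proj_pythagoras[OF cA, of b] tr by (simp add: b_def)
  then have eq: "proj A (delta \<one>) = b" using \<open>proj A b = proj A (delta \<one>)\<close> by simp
  have "y \<in> A" if y: "y \<in> B" for y
  proof -
    have "coord y g = coord (proj A y) g" for g
    proof (cases "g \<in> carrier G")
      case True
      have "coord y g = cinner y (lam G g (proj A (delta \<one>)))"
        using cinner_lam_proj_delta[OF B(1) y True] eq by (simp add: b_def)
      also have "\<dots> = cinner (proj A y) (lam G g (proj A (delta \<one>)))"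
        using proj_in[OF cA] lam.invariantD(2)[OF A True] by (simp add: cinner_proj[OF cA])
      also have "\<dots> = coord (proj A y) g"
        by (rule cinner_lam_proj_delta[OF A proj_in[OF cA] True])
      finally show ?thesis .
    next
      case False
      moreover have "proj A y \<in> supported (carrier G)" "y \<in> supported (carrier G)"
        using proj_in[OF cA] \<open>A \<subseteq> B\<close> B(2) y by blast+
      ultimately show ?thesis by (simp add: supported_def)
    qed
    then have "y = proj A y" by (rule ell2_eqI)
    then show ?thesis using proj_in[OF cA] by metis
  qed
  then show ?thesis using \<open>A \<subseteq> B\<close> by blast
qed

text \<open>Isometric invariant subspaces have the same trace: writing \<open>d\<close> and \<open>e\<close> for the projections
  of \<open>\<delta>\<^sub>1\<close> and \<open>d'\<close> for the partner of \<open>d\<close>, the Parseval identities for the orbits of \<open>d\<close> and of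
  \<open>e\<close> both express the sum \<open>\<Sum>\<^sub>g \<bar>\<langle>e, g d'\<rangle>\<bar>\<^sup>2\<close>.\<close>
lemma compatible_trace_eq:
  assumes F: "compatible G (lam G) F"
    and D: "invariant G (lam G) (Domain F)" "Domain F \<subseteq> supported (carrier G)"
    and E: "invariant G (lam G) (Range F)" "Range F \<subseteq> supported (carrier G)"
  shows "norm (proj (Domain F) (delta \<one>)) = norm (proj (Range F) (delta \<one>))"
proof -
  define d where "d = proj (Domain F) (delta \<one>)"
  define e where "e = proj (Range F) (delta \<one>)"
  obtain d' e' where de: "(d, d') \<in> F" "(e', e) \<in> F"
    using proj_in[OF lam.invariantD(1)[OF D(1)]] proj_in[OF lam.invariantD(1)[OF E(1)]]
    unfolding d_def e_def by blast
  have n: "norm a = norm b" if "(a, b) \<in> F" for a b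
  proof -
    have "cinner a a = cinner b b"
      using compatibleD[OF F that that one_closed] by (simp add: lam.action_one)
    then have "(norm a)\<^sup>2 = (norm b)\<^sup>2"
      unfolding cinner_self using of_real_eq_iff by blast
    then show ?thesis by (simp add: power2_eq_iff_nonneg)
  qed
  have 1: "((\<lambda>g. (cmod (cinner e' (lam G g d)))\<^sup>2) has_sum (norm e)\<^sup>2) (carrier G)"
    using parseval_proj_delta[OF D, of e'] de n[OF de(2)] unfolding d_def by auto
  have 2: "((\<lambda>g. (cmod (cinner d' (lam G g e)))\<^sup>2) has_sum (norm d)\<^sup>2) (carrier G)"
    using parseval_proj_delta[OF E, of d'] de n[OF de(1)] unfolding e_def by auto
  have eq: "cmod (cinner e' (lam G g d)) = cmod (cinner d' (lam G (inv g) e))" if "g \<in> carrier G" for g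
  proof -
    have "cinner (lam G g d) e' = cinner (lam G g d') e"
      using compatibleD[OF F de that] .
    then show ?thesis
      using that by (simp add: cmod_cinner_commute[of e'] lam.cinner_action_left[of _ d'])
  qed
  have "bij_betw (\<lambda>g. inv g) (carrier G) (carrier G)"
    by (rule bij_betw_byWitness[where f' = "\<lambda>g. inv g"]) auto
  then have "((\<lambda>g. (cmod (cinner d' (lam G (inv g) e)))\<^sup>2) has_sum (norm d)\<^sup>2) (carrier G)"
    using has_sum_reindex_bij_betw[where f = "\<lambda>g. (cmod (cinner d' (lam G g e)))\<^sup>2"] 2 by blast
  then have "((\<lambda>g. (cmod (cinner e' (lam G g d)))\<^sup>2) has_sum (norm d)\<^sup>2) (carrier G)"
    by (rule has_sum_cong[THEN iffD1, rotated]) (simp add: eq)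
  then have "(norm d)\<^sup>2 = (norm e)\<^sup>2"
    using 1 has_sum_unique by blast
  then show ?thesis
    unfolding d_def[symmetric] e_def[symmetric] by (simp add: power2_eq_iff_nonneg)
qed

end

text \<open>A nonzero intertwiner \<open>T\<close> between the two subspaces exists by the ICC property, and \<open>T\<close> times
  the inverse of \<open>R = (T\<^sup>*T)\<^sup>1\<^sup>/\<^sup>2\<close> would be isometric. The pair \<open>(R x, T x)\<close> records the effect of
  this polar decomposition on a single vector without inverting \<open>R\<close>.\<close>
lemma icc_common_vector_state:
  fixes G :: "('g, 'm) monoid_scheme" (structure)
  assumes icc: "icc_group G"
    and A: "invariant G (lam G) A" "A \<subseteq> supported (carrier G)" "x\<^sub>0 \<in> A" "x\<^sub>0 \<noteq> 0"
    and B: "invariant G (lam G) B" "B \<subseteq> supported (carrier G)" "y\<^sub>0 \<in> B" "y\<^sub>0 \<noteq> 0"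
  shows "\<exists>a\<in>A. \<exists>b\<in>B. a \<noteq> 0 \<and> (\<forall>g\<in>carrier G. cinner (lam G g a) a = cinner (lam G g b) b)"
proof -
  interpret group G using icc by (simp add: icc_group_def)
  obtain h x y where h: "h \<in> carrier G" and x: "x \<in> A" and y: "y \<in> B"
    and nz: "cinner (rho G h x) y \<noteq> 0"
    using icc_invariant_subspaces_not_disjoint[OF icc A B] by blast
  have cA: "closed_csubspace A" and cB: "closed_csubspace B"
    using lam.invariantD(1)[OF A(1)] lam.invariantD(1)[OF B(1)] by -
  define T where "T v = proj B (rho G h (proj A v))" for v
  define T' where "T' v = proj A (rho G (inv h) (proj B v))" for v
  have T_lin: "clinear T"
    unfolding T_def
    by (rule clinear_compose[OF clinear_proj[OF cB] clinear_compose[OF rho.clinear_action[OF h] clinear_proj[OF cA]]])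
  have T_contr: "norm (T v) \<le> norm v" "norm (T' v) \<le> norm v" for v
    unfolding T_def T'_def
    using h norm_proj_le[OF cB, of "rho G h (proj A v)"] norm_proj_le[OF cA, of v]
      norm_proj_le[OF cA, of "rho G (inv h) (proj B v)"] norm_proj_le[OF cB, of v]
    by (simp_all add: rho.norm_action)
  have T_adj: "cinner (T u) v = cinner u (T' v)" for u v
    unfolding T_def T'_def using h
    by (simp add: proj_selfadjoint[OF cA] proj_selfadjoint[OF cB] rho.cinner_action_left)
  obtain R where R: "clinear R" "\<And>x y. cinner (R x) y = cinner x (R y)" "\<And>x. R (R x) = T' (T x)"
    and "\<forall>C. clinear C \<longrightarrow> (\<forall>x. norm (C x) \<le> norm x) \<longrightarrow> (\<forall>x. C (T' (T x)) = T' (T (C x))) \<longrightarrow>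
       (\<forall>x. C (R x) = R (C x))"
    by (rule positive_sqrt_exists[OF T_lin T_contr(1) T_adj T_contr(2)]) (rule that)
  then have R_comm: "C (R x) = R (C x)"
    if "clinear C" "\<And>x. norm (C x) \<le> norm x" "\<And>x. C (T' (T x)) = T' (T (C x))" for C x
    using that by blast
  have lamT: "lam G g (T v) = T (lam G g v)" "lam G g (T' v) = T' (lam G g v)" if "g \<in> carrier G" for g v
    using that h by (simp_all add: T_def T'_def lam.proj_action[OF A(1)] lam.proj_action[OF B(1)] flip: lam_rho_commute)
  have lamR: "lam G g (R v) = R (lam G g v)" if "g \<in> carrier G" for g v
    using that lamT by (intro R_comm) (simp_all add: lam.clinear_action lam.norm_action)
  \<comment> \<open>The square root inherits from \<open>T\<^sup>*T\<close> that it commutes with the projection onto \<open>A\<close>, so it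
    maps \<open>A\<close> into itself.\<close>
  have "proj A (R x) = R (proj A x)"
    by (intro R_comm clinear_proj cA norm_proj_le)
       (simp add: T_def T'_def proj_same[OF cA] proj_in[OF cA])
  then have "R x \<in> A"
    using proj_in[OF cA] proj_same[OF cA x] by metis
  moreover have "T x \<in> B"
    unfolding T_def by (rule proj_in[OF cB])
  moreover have state: "cinner (lam G g (R x)) (R x) = cinner (lam G g (T x)) (T x)" if "g \<in> carrier G" for g
    using that by (simp add: lamR lamT R(2,3) T_adj)
  moreover have "R x \<noteq> 0"
  proof
    assume "R x = 0"
    then have "cinner (T x) (T x) = 0"
      using state[OF one_closed] by (simp add: lam.action_one)
    moreover have "cinner (T x) y \<noteq> 0"
      using nz x y by (simp add: T_def proj_same[OF cA] cinner_proj[OF cB])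
    ultimately show False by auto
  qed
  ultimately show ?thesis by blast
qed

text \<open>A maximal compatible relation is the graph of an isometric intertwiner from a subspace of
  \<open>A\<close> onto a subspace of \<open>B\<close>. It exhausts \<open>A\<close> or \<open>B\<close>, since otherwise a pair of vectors from the
  two orthogonal complements could be added; by equality of the traces it then exhausts both.\<close>
theorem icc_comparison:
  fixes G :: "('g, 'm) monoid_scheme" (structure)
  assumes icc: "icc_group G"
    and A: "invariant G (lam G) A" "A \<subseteq> supported (carrier G)"
    and B: "invariant G (lam G) B" "B \<subseteq> supported (carrier G)"
    and tr: "norm (proj A (delta \<one>)) = norm (proj B (delta \<one>))"
  obtains J where "\<And>y. y \<in> B \<Longrightarrow> J y \<in> A"
    "\<And>x y. x \<in> B \<Longrightarrow> y \<in> B \<Longrightarrow> cinner (J x) (J y) = cinner x y"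
    "\<And>g y. g \<in> carrier G \<Longrightarrow> y \<in> B \<Longrightarrow> J (lam G g y) = lam G g (J y)"
proof -
  interpret group G using icc by (simp add: icc_group_def)
  obtain F where F: "maximal_compatible G (lam G) A B F"
    using maximal_compatible_exists by blast
  have comp: "compatible G (lam G) F" and FAB: "F \<subseteq> A \<times> B"
    using F unfolding maximal_compatible_def by blast+
  have D: "invariant G (lam G) (Domain F)"
    by (rule lam.maximal_compatible_invariant_Domain(1)[OF A(1) B(1) F])
  have E: "invariant G (lam G) (Range F)"
    using lam.maximal_compatible_invariant_Domain(1)[OF B(1) A(1) maximal_compatible_converse[OF F]]
    by simp
  have sub: "Domain F \<subseteq> A" "Range F \<subseteq> B" using FAB by auto
  have trF: "norm (proj (Domain F) (delta \<one>)) = norm (proj (Range F) (delta \<one>))"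
    using sub A(2) B(2) by (intro compatible_trace_eq comp D E) auto
  define A' where "A' = {x. \<forall>s\<in>Domain F. cinner x s = 0} \<inter> A"
  define B' where "B' = {x. \<forall>s\<in>Range F. cinner x s = 0} \<inter> B"
  have A': "invariant G (lam G) A'" and B': "invariant G (lam G) B'"
    unfolding A'_def B'_def
    using lam.invariantD(2)[OF D] lam.invariantD(2)[OF E]
    by (intro lam.invariant_Int lam.invariant_orthogonal A(1) B(1); blast)+
  have "A' = {0} \<or> B' = {0}"
  proof (rule ccontr)
    assume "\<not> (A' = {0} \<or> B' = {0})"
    moreover have "0 \<in> A'" "0 \<in> B'"
      using closed_csubspaceD(1) lam.invariantD(1) A' B' by blast+
    ultimately obtain x\<^sub>0 y\<^sub>0 where "x\<^sub>0 \<in> A'" "x\<^sub>0 \<noteq> 0" "y\<^sub>0 \<in> B'" "y\<^sub>0 \<noteq> 0"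
      by blast
    moreover have "A' \<subseteq> supported (carrier G)" "B' \<subseteq> supported (carrier G)"
      using A(2) B(2) by (auto simp: A'_def B'_def)
    ultimately obtain a b where ab: "a \<in> A'" "b \<in> B'" "a \<noteq> 0"
      "\<And>g. g \<in> carrier G \<Longrightarrow> cinner (lam G g a) a = cinner (lam G g b) b"
      using icc_common_vector_state[OF icc A' _ _ _ B'] by metis
    have "(a, b) \<in> F"
    proof (rule lam.maximal_compatible_memI[OF F])
      fix a' b' g assume *: "(a', b') \<in> F" "g \<in> carrier G"
      then have "lam G g a \<in> A'" "lam G g b \<in> B'"
        using ab lam.invariantD(2)[OF A'] lam.invariantD(2)[OF B'] by blast+
      moreover have "a' \<in> Domain F" "b' \<in> Range F" using *(1) by blast+
      ultimately show "cinner (lam G g a) a' = cinner (lam G g b) b'"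
        by (simp add: A'_def B'_def)
    qed (use ab in \<open>auto simp: A'_def B'_def\<close>)
    then have "cinner a a = 0"
      using ab(1) DomainI[of a b F] by (simp add: A'_def)
    then show False using ab(3) by simp
  qed
  then have full: "Domain F = A \<or> Range F = B"
  proof
    have *: "M = N" if "closed_csubspace M" "closed_csubspace N" "M \<subseteq> N" "{x. \<forall>s\<in>M. cinner x s = 0} \<inter> N = {0}"
      for M N :: "'g ell2 set"
    proof -
      have "x \<in> M" if "x \<in> N" for x
      proof -
        have "proj M x \<in> N"
          using proj_in[OF \<open>closed_csubspace M\<close>] \<open>M \<subseteq> N\<close> by blast
        then have "x - proj M x \<in> {x. \<forall>s\<in>M. cinner x s = 0} \<inter> N"
          using proj_orthogonal[OF \<open>closed_csubspace M\<close>]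
            closed_csubspaceD(4)[OF \<open>closed_csubspace N\<close> that] by simp
        then have "x = proj M x"
          using \<open>{x. \<forall>s\<in>M. cinner x s = 0} \<inter> N = {0}\<close> by auto
        then show ?thesis using proj_in[OF \<open>closed_csubspace M\<close>] by metis
      qed
      then show ?thesis using \<open>M \<subseteq> N\<close> by blast
    qed
    show ?thesis if "A' = {0}"
      using *[of "Domain F" A] that sub D A(1) lam.invariantD(1) by (simp add: A'_def)
    show ?thesis if "B' = {0}"
      using *[of "Range F" B] that sub E B(1) lam.invariantD(1) by (simp add: B'_def)
  qed
  have range: "Range F = B"
  proof (cases "Domain F = A")
    case True
    then show ?thesis
      using trF tr by (intro invariant_eqI_trace E B sub) simp
  qed (use full in blast)
  \<comment> \<open>The relation is single-valued, so the choice of a partner is the intertwiner it is a graph of.\<close>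
  define J where "J y = (SOME x. (x, y) \<in> F)" for y
  have J: "(J y, y) \<in> F" if "y \<in> B" for y
    using that range someI_ex[of "\<lambda>x. (x, y) \<in> F"] unfolding J_def by blast
  show ?thesis
  proof (rule that[of J])
    show "J y \<in> A" if "y \<in> B" for y using J[OF that] FAB by blast
    show "cinner (J x) (J y) = cinner x y" if "x \<in> B" "y \<in> B" for x y
      using compatibleD[OF comp J[OF that(1)] J[OF that(2)] one_closed] by (simp add: lam.action_one)
    show "J (lam G g y) = lam G g (J y)" if g: "g \<in> carrier G" and y: "y \<in> B" for g y
    proof -
      have "(lam G g (J y), lam G g y) \<in> F"
        by (rule lam.maximal_compatible_invariant_Domain(2)[OF A(1) B(1) F g J[OF y]])
      then have "norm (J (lam G g y) - lam G g (J y)) = norm (lam G g y - lam G g y)"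
        using lam.invariantD(2)[OF B(1) g y] by (intro lam.compatible_diff_norm[OF comp] J)
      then show ?thesis by simp
    qed
  qed
qed

section \<open>Comparison of representations with Parseval vectors\<close>

lemma isometry_on_cinner:
  assumes A: "closed_csubspace A" and "x \<in> A" "y \<in> A"
    and add: "\<And>x y. x \<in> A \<Longrightarrow> y \<in> A \<Longrightarrow> f (x + y) = f x + f y"
    and scale: "\<And>a x. x \<in> A \<Longrightarrow> f (a *\<^sub>C x) = a *\<^sub>C f x"
    and norm: "\<And>x. x \<in> A \<Longrightarrow> norm (f x) = norm x"
  shows "cinner (f x) (f y) = cinner x y"
proof -
  note Ac = closed_csubspaceD[OF A]
  have Re: "Re (cinner (f u) (f v)) = Re (cinner u v)" if "u \<in> A" "v \<in> A" for u v
  proof -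
    have "f (u - v) + f v = f u"
      using add[of "u - v" v] that Ac(4) by simp
    then have "f u - f v = f (u - v)"
      by (simp add: eq_diff_eq[symmetric])
    then show ?thesis
      using that norm[of "u + v"] norm[of "u - v"] Ac(2,4)
      by (simp add: Re_cinner_polarization flip: add)
  qed
  have "Im (cinner (f x) (f y)) = Im (cinner x y)"
    using Re[of x "\<i> *\<^sub>C y"] assms(2,3) Ac(3) by (simp add: Im_cinner_eq_Re scale)
  then show ?thesis
    using Re assms(2,3) by (simp add: complex_eq_iff)
qed

definition parseval_vector_on ::
    "('g, 'm) monoid_scheme \<Rightarrow> ('g \<Rightarrow> 'a \<Rightarrow> 'a) \<Rightarrow> 'a::complex_inner set \<Rightarrow> 'a \<Rightarrow> bool" where
  "parseval_vector_on G \<sigma> A a \<longleftrightarrow> invariant G \<sigma> A \<and> a \<in> A \<and>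
     (\<forall>x\<in>A. ((\<lambda>g. (cmod (cinner x (\<sigma> g a)))\<^sup>2) has_sum (norm x)\<^sup>2) (carrier G))"

text \<open>The analysis operator of \<open>a\<close>, which turns the representation on \<open>A\<close> into an invariant
  subspace of the regular representation.\<close>
definition frame_coefficients ::
    "('g, 'm) monoid_scheme \<Rightarrow> ('g \<Rightarrow> 'a \<Rightarrow> 'a) \<Rightarrow> 'a \<Rightarrow> 'a::complex_inner \<Rightarrow> 'g ell2" where
  "frame_coefficients G \<sigma> a x = Abs_ell2 (\<lambda>g. if g \<in> carrier G then cinner x (\<sigma> g a) else 0)"

context unitary_action
begin

context
  fixes A :: "'a set" and a :: 'a
  assumes pv: "parseval_vector_on G \<sigma> A a"
begin

private lemma A: "invariant G \<sigma> A" "closed_csubspace A" "a \<in> A"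
  using pv invariantD(1) unfolding parseval_vector_on_def by auto

private lemma parseval:
  assumes "x \<in> A"
  shows "((\<lambda>g. (cmod (if g \<in> carrier G then cinner x (\<sigma> g a) else 0))\<^sup>2) has_sum (norm x)\<^sup>2) UNIV"
proof -
  have "((\<lambda>g. (cmod (cinner x (\<sigma> g a)))\<^sup>2) has_sum (norm x)\<^sup>2) (carrier G)"
    using pv assms unfolding parseval_vector_on_def by blast
  then show ?thesis
    by (rule has_sum_cong_neutral[THEN iffD1, rotated -1]) auto
qed

abbreviation (input) "\<Theta> \<equiv> frame_coefficients G \<sigma> a"

lemma coord_frame_coefficients:
  assumes "x \<in> A"
  shows "coord (\<Theta> x) g = (if g \<in> carrier G then cinner x (\<sigma> g a) else 0)"
  unfolding frame_coefficients_def
  using has_sum_imp_summable[OF parseval[OF assms]] by (subst Abs_ell2_inverse) auto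

lemma norm_frame_coefficients:
  assumes "x \<in> A"
  shows "norm (\<Theta> x) = norm x"
proof -
  have "(norm (\<Theta> x))\<^sup>2 = (norm x)\<^sup>2"
    using has_sum_norm_ell2[of "\<Theta> x"] parseval[OF assms] has_sum_unique
    unfolding coord_frame_coefficients[OF assms] by blast
  then show ?thesis by (simp add: power2_eq_iff_nonneg)
qed

lemma frame_coefficients_add:
  "x \<in> A \<Longrightarrow> y \<in> A \<Longrightarrow> \<Theta> (x + y) = \<Theta> x + \<Theta> y"
  by (rule ell2_eqI) (simp add: coord_frame_coefficients closed_csubspaceD[OF A(2)] cinner_add_left)

lemma frame_coefficients_scaleC:
  "x \<in> A \<Longrightarrow> \<Theta> (r *\<^sub>C x) = r *\<^sub>C \<Theta> x"
  by (rule ell2_eqI) (simp add: coord_frame_coefficients closed_csubspaceD[OF A(2)] cinner_scaleC_left)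

lemma frame_coefficients_diff:
  "x \<in> A \<Longrightarrow> y \<in> A \<Longrightarrow> \<Theta> (x - y) = \<Theta> x - \<Theta> y"
  by (rule ell2_eqI) (simp add: coord_frame_coefficients closed_csubspaceD[OF A(2)] cinner_diff_left)

lemma cinner_frame_coefficients:
  "x \<in> A \<Longrightarrow> y \<in> A \<Longrightarrow> cinner (\<Theta> x) (\<Theta> y) = cinner x y"
  by (rule isometry_on_cinner[OF A(2)])
     (simp_all add: frame_coefficients_add frame_coefficients_scaleC norm_frame_coefficients)

lemma frame_coefficients_action:
  assumes "x \<in> A" "g \<in> carrier G"
  shows "\<Theta> (\<sigma> g x) = lam G g (\<Theta> x)"
  using assms
  by (intro ell2_eqI)
     (simp add: coord_frame_coefficients invariantD(2)[OF A(1)] coord_lam cinner_action_left action_mult)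

lemma inj_on_frame_coefficients: "inj_on \<Theta> A"
proof (rule inj_onI)
  fix x y assume "x \<in> A" "y \<in> A" "\<Theta> x = \<Theta> y"
  then have "norm (x - y) = 0"
    using norm_frame_coefficients[of "x - y"] closed_csubspaceD(4)[OF A(2)]
    by (simp add: frame_coefficients_diff)
  then show "x = y" by simp
qed

lemma frame_coefficients_supported: "\<Theta> ` A \<subseteq> supported (carrier G)"
  by (auto simp: supported_def coord_frame_coefficients)

lemma invariant_range_frame_coefficients: "invariant G (lam G) (\<Theta> ` A)"
  unfolding invariant_def
proof (intro conjI ballI)
  note Ac = closed_csubspaceD[OF A(2)]
  show "closed_csubspace (\<Theta> ` A)"
  proof (rule closed_csubspaceI)
    have "\<Theta> 0 = 0" using frame_coefficients_diff[of a a] A(3) by simp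
    then show "0 \<in> \<Theta> ` A" using Ac(1) by force
    show "x + y \<in> \<Theta> ` A" if "x \<in> \<Theta> ` A" "y \<in> \<Theta> ` A" for x y
      using that Ac(2) by (auto simp flip: frame_coefficients_add)
    show "r *\<^sub>C x \<in> \<Theta> ` A" if "x \<in> \<Theta> ` A" for r x
      using that Ac(3) by (auto simp flip: frame_coefficients_scaleC)
    show "closed (\<Theta> ` A)"
      unfolding closed_sequential_limits
    proof (intro allI impI, elim conjE)
      fix X l assume "\<forall>n::nat. X n \<in> \<Theta> ` A" and l: "X \<longlonglongrightarrow> l"
      then have "\<forall>n. \<exists>y. y \<in> A \<and> X n = \<Theta> y" by blast
      then obtain Y where Y: "\<And>n. Y n \<in> A" "\<And>n. X n = \<Theta> (Y n)" by metis
      have d: "norm (\<Theta> u - \<Theta> v) = norm (u - v)" if "u \<in> A" "v \<in> A" for u v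
        using norm_frame_coefficients[of "u - v"] that Ac(4) by (simp add: frame_coefficients_diff)
      have "Cauchy X" using l by (rule LIMSEQ_imp_Cauchy)
      then have "Cauchy Y"
        unfolding Cauchy_def dist_norm Y(2) by (simp add: d Y(1))
      then obtain m where m: "Y \<longlonglongrightarrow> m"
        using Cauchy_convergent_iff convergent_def by blast
      have mA: "m \<in> A" using closed_sequentially[OF Ac(6) _ m] Y(1) by blast
      have "(\<lambda>n. norm (Y n - m)) \<longlonglongrightarrow> 0"
        using m by (simp add: LIM_zero_iff tendsto_norm_zero_iff)
      then have "(\<lambda>n. norm (X n - \<Theta> m)) \<longlonglongrightarrow> 0"
        by (simp add: Y d mA)
      then have "X \<longlonglongrightarrow> \<Theta> m"
        by (simp add: LIM_zero_iff tendsto_norm_zero_iff)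
      then show "l \<in> \<Theta> ` A" using l mA LIMSEQ_unique by blast
    qed
  qed
  show "lam G g y \<in> \<Theta> ` A" if "g \<in> carrier G" "y \<in> \<Theta> ` A" for g y
    using that invariantD(2)[OF A(1)] by (auto simp flip: frame_coefficients_action)
qed

text \<open>The trace of the projection onto the image of \<open>A\<close> is therefore \<open>\<parallel>a\<parallel>\<^sup>2\<close>: the squared norm of a
  Parseval vector is the dimension of the representation.\<close>
lemma proj_range_frame_coefficients:
  "proj (\<Theta> ` A) (delta \<one>) = \<Theta> a"
proof (rule proj_eqI[OF lam.invariantD(1)[OF invariant_range_frame_coefficients]])
  show "\<Theta> a \<in> \<Theta> ` A" using A(3) by blast
  fix y assume "y \<in> \<Theta> ` A"
  then obtain x where x: "x \<in> A" "y = \<Theta> x" by blast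
  have "cinner y (\<Theta> a) = cinner y (delta \<one>)"
    using x A(3) by (simp add: cinner_frame_coefficients coord_frame_coefficients action_one)
  then show "cinner (delta \<one> - \<Theta> a) y = 0"
    by (subst cinner_commute) (simp add: cinner_diff_right)
qed

end

end

text \<open>The frame coefficients carry both representations to invariant subspaces of \<open>\<ell>\<^sup>2(G)\<close>, whose
  traces are the squared norms of the Parseval vectors.\<close>
theorem icc_parseval_comparison:
  assumes icc: "icc_group G"
    and "unitary_action G \<sigma>" and a: "parseval_vector_on G \<sigma> A a"
    and "unitary_action G \<tau>" and b: "parseval_vector_on G \<tau> B b"
    and ab: "norm a = norm b"
  obtains J where "\<And>y. y \<in> B \<Longrightarrow> J y \<in> A"
    "\<And>x y. x \<in> B \<Longrightarrow> y \<in> B \<Longrightarrow> cinner (J x) (J y) = cinner x y"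
    "\<And>g y. g \<in> carrier G \<Longrightarrow> y \<in> B \<Longrightarrow> J (\<tau> g y) = \<sigma> g (J y)"
proof -
  interpret \<sigma>: unitary_action G \<sigma> by fact
  interpret \<tau>: unitary_action G \<tau> by fact
  define S where "S = frame_coefficients G \<sigma> a"
  define T where "T = frame_coefficients G \<tau> b"
  have aA: "a \<in> A" and bB: "b \<in> B" and A: "invariant G \<sigma> A" and B: "invariant G \<tau> B"
    using a b unfolding parseval_vector_on_def by auto
  have "norm (proj (S ` A) (delta \<one>\<^bsub>G\<^esub>)) = norm (proj (T ` B) (delta \<one>\<^bsub>G\<^esub>))"
    unfolding S_def T_def \<sigma>.proj_range_frame_coefficients[OF a] \<tau>.proj_range_frame_coefficients[OF b]
      \<sigma>.norm_frame_coefficients[OF a aA] \<tau>.norm_frame_coefficients[OF b bB] by (rule ab)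
  then obtain J where J: "\<And>y. y \<in> T ` B \<Longrightarrow> J y \<in> S ` A"
    "\<And>x y. x \<in> T ` B \<Longrightarrow> y \<in> T ` B \<Longrightarrow> cinner (J x) (J y) = cinner x y"
    "\<And>g y. g \<in> carrier G \<Longrightarrow> y \<in> T ` B \<Longrightarrow> J (lam G g y) = lam G g (J y)"
    using icc_comparison[OF icc \<sigma>.invariant_range_frame_coefficients[OF a] \<sigma>.frame_coefficients_supported[OF a]
        \<tau>.invariant_range_frame_coefficients[OF b] \<tau>.frame_coefficients_supported[OF b]]
    unfolding S_def T_def by blast
  define K where "K y = inv_into A S (J (T y))" for y
  have K: "K y \<in> A" "S (K y) = J (T y)" if "y \<in> B" for y
    using that J(1)[of "T y"] unfolding K_def by (auto intro: inv_into_into f_inv_into_f)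
  show ?thesis
  proof (rule that[of K])
    show "K y \<in> A" if "y \<in> B" for y using K(1) that .
    show "cinner (K x) (K y) = cinner x y" if "x \<in> B" "y \<in> B" for x y
    proof -
      have "cinner (K x) (K y) = cinner (S (K x)) (S (K y))"
        unfolding S_def using that K(1) by (simp add: \<sigma>.cinner_frame_coefficients[OF a])
      also have "\<dots> = cinner (T x) (T y)"
        using that by (simp add: K(2) J(2))
      finally show ?thesis
        unfolding T_def using that by (simp add: \<tau>.cinner_frame_coefficients[OF b])
    qed
    show "K (\<tau> g y) = \<sigma> g (K y)" if g: "g \<in> carrier G" and y: "y \<in> B" for g y
    proof -
      have "S (K (\<tau> g y)) = J (T (\<tau> g y))"
        using \<tau>.invariantD(2)[OF B g y] by (rule K(2))
      also have "T (\<tau> g y) = lam G g (T y)"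
        unfolding T_def by (rule \<tau>.frame_coefficients_action[OF b y g])
      also have "J (lam G g (T y)) = lam G g (S (K y))"
        using g y by (simp add: J(3) K(2))
      also have "\<dots> = S (\<sigma> g (K y))"
        unfolding S_def using \<sigma>.frame_coefficients_action[OF a K(1)[OF y] g] by simp
      finally show ?thesis
        using \<sigma>.inj_on_frame_coefficients[OF a] K(1) \<tau>.invariantD(2)[OF B g y]
          \<sigma>.invariantD(2)[OF A g K(1)[OF y]] y unfolding S_def by (meson inj_onD)
    qed
  qed
qed

section \<open>Orthonormal families\<close>

definition orthonormal_on :: "'i set \<Rightarrow> ('i \<Rightarrow> 'a::complex_inner) \<Rightarrow> bool" where
  "orthonormal_on I e \<longleftrightarrow> (\<forall>i\<in>I. \<forall>j\<in>I. cinner (e i) (e j) = (if i = j then 1 else 0))"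

definition fourier_partial :: "('i \<Rightarrow> 'a::complex_inner) \<Rightarrow> 'i set \<Rightarrow> 'a \<Rightarrow> 'a" where
  "fourier_partial e F x = (\<Sum>i\<in>F. cinner x (e i) *\<^sub>C e i)"

lemma orthonormal_on_subset: "orthonormal_on I e \<Longrightarrow> F \<subseteq> I \<Longrightarrow> orthonormal_on F e"
  unfolding orthonormal_on_def by blast

lemma clinear_fourier_partial: "clinear (fourier_partial e F)"
  by (intro clinearI)
     (simp_all add: fourier_partial_def cinner_add_left cinner_scaleC_left scaleC_add_left
        sum.distrib complex_vector.scale_sum_right scaleC_scaleC)

lemma cinner_fourier_partial:
  assumes "orthonormal_on F e" "finite F" "j \<in> F"
  shows "cinner (fourier_partial e F x) (e j) = cinner x (e j)"
proof -
  have "cinner (fourier_partial e F x) (e j) = (\<Sum>i\<in>F. cinner x (e i) * cinner (e i) (e j))"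
    by (simp add: fourier_partial_def cinner.sum_left cinner_scaleC_left)
  also have "\<dots> = (\<Sum>i\<in>F. if i = j then cinner x (e i) else 0)"
    using assms unfolding orthonormal_on_def by (intro sum.cong) auto
  finally show ?thesis using assms by simp
qed

lemma fourier_partial_basis:
  assumes "orthonormal_on F e" "finite F" "j \<in> F"
  shows "fourier_partial e F (e j) = e j"
proof -
  have "fourier_partial e F (e j) = (\<Sum>i\<in>F. if i = j then e i else 0)"
    unfolding fourier_partial_def using assms unfolding orthonormal_on_def
    by (intro sum.cong) auto
  then show ?thesis using assms by simp
qed

lemma norm_diff_fourier_partial:
  assumes "orthonormal_on F e" "finite F"
  shows "(norm (x - fourier_partial e F x))\<^sup>2 = (norm x)\<^sup>2 - (\<Sum>i\<in>F. (cmod (cinner x (e i)))\<^sup>2)"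
proof -
  let ?P = "fourier_partial e F x"
  have *: "cinner v ?P = (\<Sum>i\<in>F. cinner v (e i) * cnj (cinner x (e i)))" for v
    by (simp add: fourier_partial_def cinner.sum_right cinner_scaleC_right mult.commute)
  have 1: "cinner x ?P = of_real (\<Sum>i\<in>F. (cmod (cinner x (e i)))\<^sup>2)"
    unfolding * of_real_sum complex_norm_square by simp
  have "cinner ?P ?P = cinner x ?P"
    unfolding * using assms by (intro sum.cong) (simp_all add: cinner_fourier_partial)
  then have "(norm ?P)\<^sup>2 = (\<Sum>i\<in>F. (cmod (cinner x (e i)))\<^sup>2)"
    unfolding 1 cinner_self of_real_eq_iff .
  moreover have "Re (cinner x ?P) = (\<Sum>i\<in>F. (cmod (cinner x (e i)))\<^sup>2)"
    unfolding 1 by simp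
  ultimately show ?thesis by (simp add: norm_diff_sq)
qed

lemma bessel_inequality:
  assumes "orthonormal_on F e" "finite F"
  shows "(\<Sum>i\<in>F. (cmod (cinner x (e i)))\<^sup>2) \<le> (norm x)\<^sup>2"
  using norm_diff_fourier_partial[OF assms, of x] zero_le_power2[of "norm (x - fourier_partial e F x)"]
  by linarith

text \<open>A partial Fourier sum over enough indices fixes any given element of the span of the basis, and
  the complementary operation is a contraction; hence the partial sums of \<open>x\<close> approximate \<open>x\<close> as
  well as the span does.\<close>
lemma orthonormal_basis_parseval_frame:
  assumes ob: "orthonormal_basis I e"
  shows "parseval_frame I e"
  unfolding parseval_frame_def
proof
  fix x
  have on: "orthonormal_on I e" and dense: "closure (cspan (e ` I)) = UNIV"
    using ob unfolding orthonormal_basis_def orthonormal_on_def by auto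
  let ?s = "\<lambda>F. \<Sum>i\<in>F. (cmod (cinner x (e i)))\<^sup>2"
  note bessel = bessel_inequality[OF orthonormal_on_subset[OF on]]
  have fixed: "\<exists>F. finite F \<and> F \<subseteq> I \<and> (\<forall>F'. finite F' \<longrightarrow> F \<subseteq> F' \<longrightarrow> F' \<subseteq> I \<longrightarrow> fourier_partial e F' y = y)"
    if "y \<in> cspan (e ` I)" for y
    using that
  proof (induction rule: complex_vector.span_induct_alt)
    case base
    show ?case
      by (rule exI[of _ "{}"]) (simp add: clinear_zero[OF clinear_fourier_partial])
  next
    case (step c u v)
    then obtain i F where *: "i \<in> I" "u = e i" "finite F" "F \<subseteq> I"
      "\<And>F'. finite F' \<Longrightarrow> F \<subseteq> F' \<Longrightarrow> F' \<subseteq> I \<Longrightarrow> fourier_partial e F' v = v"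
      by blast
    have "fourier_partial e F' (c *\<^sub>C u + v) = c *\<^sub>C u + v"
      if "finite F'" "insert i F \<subseteq> F'" "F' \<subseteq> I" for F'
      using that * fourier_partial_basis[OF orthonormal_on_subset[OF on that(3)] that(1), of i]
      by (simp add: clinear_add[OF clinear_fourier_partial] clinear_scaleC[OF clinear_fourier_partial])
    then show ?case
      using * by (intro exI[of _ "insert i F"]) auto
  qed
  show "((\<lambda>i. (cmod (cinner x (e i)))\<^sup>2) has_sum (norm x)\<^sup>2) I"
    unfolding has_sum_def
  proof (rule order_tendstoI)
    fix a assume a: "(norm x)\<^sup>2 < a"
    show "\<forall>\<^sub>F F in finite_subsets_at_top I. ?s F < a"
    proof (rule eventually_finite_subsets_at_top_weakI)
      fix F assume "finite F" "F \<subseteq> I"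
      then show "?s F < a" using bessel[of F x] a by simp
    qed
  next
    fix a assume a: "a < (norm x)\<^sup>2"
    define \<epsilon> where "\<epsilon> = sqrt ((norm x)\<^sup>2 - a) / 2"
    have \<epsilon>: "\<epsilon> > 0" using a by (simp add: \<epsilon>_def)
    have "x \<in> closure (cspan (e ` I))" using dense by simp
    then obtain y where y: "y \<in> cspan (e ` I)" "dist y x < \<epsilon>"
      using \<epsilon> unfolding closure_approachable by blast
    obtain F where F: "finite F" "F \<subseteq> I"
      "\<And>F'. finite F' \<Longrightarrow> F \<subseteq> F' \<Longrightarrow> F' \<subseteq> I \<Longrightarrow> fourier_partial e F' y = y"
      using fixed[OF y(1)] by blast
    have "a < ?s F'" if F': "finite F'" "F \<subseteq> F'" "F' \<subseteq> I" for F'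
    proof -
      have on': "orthonormal_on F' e" using on F'(3) by (rule orthonormal_on_subset)
      let ?z = "x - y"
      have z: "norm ?z < \<epsilon>" using y(2) by (simp add: dist_norm norm_minus_commute)
      have eq: "x - fourier_partial e F' x = ?z - fourier_partial e F' ?z"
        using F(3)[OF F'] by (simp add: clinear_diff[OF clinear_fourier_partial])
      have "(norm (x - fourier_partial e F' x))\<^sup>2 \<le> (norm ?z)\<^sup>2"
        unfolding eq norm_diff_fourier_partial[OF on' F'(1), of ?z] by (simp add: sum_nonneg)
      also have "\<dots> < \<epsilon>\<^sup>2"
        using z \<epsilon> by (simp add: power_strict_mono)
      also have "\<epsilon>\<^sup>2 \<le> (norm x)\<^sup>2 - a"
        using a by (simp add: \<epsilon>_def power_divide)
      finally show ?thesis
        using norm_diff_fourier_partial[OF on' F'(1), of x] by simp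
    qed
    then show "\<forall>\<^sub>F F in finite_subsets_at_top I. a < ?s F"
      unfolding eventually_finite_subsets_at_top using F(1,2) by blast
  qed
qed

section \<open>Orthonormal orbits are complete by a dimension count\<close>

context unitary_action
begin

text \<open>The vectors \<open>\<xi>\<^sub>j\<close> witness that the representation has dimension one. The component
  \<open>m\<^sub>j\<close> of \<open>\<xi>\<^sub>j\<close> orthogonal to the orbit of \<open>\<eta>\<close> vanishes because, by Bessel's inequality,
  \<open>1 = \<parallel>\<eta>\<parallel>\<^sup>2 = \<Sum>\<^sub>j \<Sum>\<^sub>g \<bar>\<langle>\<xi>\<^sub>j, g\<^sup>-\<^sup>1 \<eta>\<rangle>\<bar>\<^sup>2 \<le> \<Sum>\<^sub>j (\<parallel>\<xi>\<^sub>j\<parallel>\<^sup>2 - \<parallel>m\<^sub>j\<parallel>\<^sup>2) = 1 - \<Sum>\<^sub>j \<parallel>m\<^sub>j\<parallel>\<^sup>2\<close>.\<close>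
theorem orthonormal_orbit_basis:
  assumes J: "finite J"
    and summable: "\<And>x j. j \<in> J \<Longrightarrow> (\<lambda>g. (cmod (cinner x (\<sigma> g (\<xi> j))))\<^sup>2) summable_on carrier G"
    and parseval: "\<And>x. (\<Sum>j\<in>J. \<Sum>\<^sub>\<infinity>g\<in>carrier G. (cmod (cinner x (\<sigma> g (\<xi> j))))\<^sup>2) = (norm x)\<^sup>2"
    and dim: "(\<Sum>j\<in>J. (norm (\<xi> j))\<^sup>2) = 1"
    and \<eta>: "\<And>g. g \<in> carrier G \<Longrightarrow> cinner (\<sigma> g \<eta>) \<eta> = (if g = \<one> then 1 else 0)"
  shows "orthonormal_basis (carrier G) (\<lambda>g. \<sigma> g \<eta>)"
proof -
  have on: "orthonormal_on (carrier G) (\<lambda>g. \<sigma> g \<eta>)"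
    unfolding orthonormal_on_def
  proof (intro ballI)
    fix g h assume gh: "g \<in> carrier G" "h \<in> carrier G"
    have "cinner (\<sigma> g \<eta>) (\<sigma> h \<eta>) = cinner (\<sigma> (inv h \<otimes> g) \<eta>) \<eta>"
      using gh by (simp add: cinner_action_right action_mult)
    then show "cinner (\<sigma> g \<eta>) (\<sigma> h \<eta>) = (if g = h then 1 else 0)"
      using gh \<eta>[of "inv h \<otimes> g"] inv_solve_left'[of \<one> h g] by auto
  qed
  define S where "S = (\<lambda>g. \<sigma> g \<eta>) ` carrier G"
  define M where "M = {x. \<forall>s\<in>S. cinner x s = 0}"
  have "\<sigma> g s \<in> S" if "g \<in> carrier G" "s \<in> S" for g s
    using that unfolding S_def by (auto simp flip: action_mult)
  then have invM: "invariant G \<sigma> M"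
    unfolding M_def by (rule invariant_orthogonal)
  note cM = invariantD(1)[OF invM]
  have bound: "(\<Sum>\<^sub>\<infinity>g\<in>carrier G. (cmod (cinner \<eta> (\<sigma> g (\<xi> j))))\<^sup>2)
      \<le> (norm (\<xi> j))\<^sup>2 - (norm (proj M (\<xi> j)))\<^sup>2" if j: "j \<in> J" for j
  proof -
    let ?l = "\<xi> j - proj M (\<xi> j)"
    have c: "cmod (cinner \<eta> (\<sigma> g (\<xi> j))) = cmod (cinner ?l (\<sigma> (inv g) \<eta>))" if g: "g \<in> carrier G" for g
    proof -
      have "cinner (proj M (\<xi> j)) (\<sigma> (inv g) \<eta>) = 0"
        using proj_in[OF cM, of "\<xi> j"] g unfolding M_def S_def by auto
      then show ?thesis
        using g by (simp add: cinner_diff_left cinner_action_right[of g] cmod_cinner_commute[of "\<xi> j"])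
    qed
    have "(\<Sum>\<^sub>\<infinity>g\<in>carrier G. (cmod (cinner \<eta> (\<sigma> g (\<xi> j))))\<^sup>2) \<le> (norm ?l)\<^sup>2"
    proof (rule infsum_le_finite_sums[OF summable[OF j]])
      fix F assume F: "finite F" "F \<subseteq> carrier G"
      have inj: "inj_on (\<lambda>g. inv g) F"
        using F(2) by (meson inj_on_subset inv_inj)
      have "(\<Sum>g\<in>F. (cmod (cinner \<eta> (\<sigma> g (\<xi> j))))\<^sup>2) = (\<Sum>g\<in>F. (cmod (cinner ?l (\<sigma> (inv g) \<eta>)))\<^sup>2)"
        using F(2) c by (intro sum.cong) auto
      also have "\<dots> = (\<Sum>g\<in>(\<lambda>g. inv g) ` F. (cmod (cinner ?l (\<sigma> g \<eta>)))\<^sup>2)"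
        by (simp add: sum.reindex[OF inj])
      also have "\<dots> \<le> (norm ?l)\<^sup>2"
        using F by (intro bessel_inequality orthonormal_on_subset[OF on]) auto
      finally show "(\<Sum>g\<in>F. (cmod (cinner \<eta> (\<sigma> g (\<xi> j))))\<^sup>2) \<le> (norm ?l)\<^sup>2" .
    qed
    then show ?thesis
      using norm_proj_pythagoras[OF cM, of "\<xi> j"] by simp
  qed
  have "complex_of_real ((norm \<eta>)\<^sup>2) = 1"
    using \<eta>[OF one_closed] by (simp add: action_one cinner_self)
  then have \<eta>1: "(norm \<eta>)\<^sup>2 = 1"
    by (simp only: of_real_eq_1_iff)
  have "(\<Sum>j\<in>J. \<Sum>\<^sub>\<infinity>g\<in>carrier G. (cmod (cinner \<eta> (\<sigma> g (\<xi> j))))\<^sup>2)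
      \<le> (\<Sum>j\<in>J. (norm (\<xi> j))\<^sup>2 - (norm (proj M (\<xi> j)))\<^sup>2)"
    by (rule sum_mono) (rule bound)
  then have "1 \<le> (\<Sum>j\<in>J. (norm (\<xi> j))\<^sup>2 - (norm (proj M (\<xi> j)))\<^sup>2)"
    unfolding parseval \<eta>1 .
  then have "(\<Sum>j\<in>J. (norm (proj M (\<xi> j)))\<^sup>2) \<le> 0"
    using dim by (simp add: sum_subtractf)
  then have "(\<Sum>j\<in>J. (norm (proj M (\<xi> j)))\<^sup>2) = 0"
    using sum_nonneg[of J "\<lambda>j. (norm (proj M (\<xi> j)))\<^sup>2"] by simp
  then have p0: "proj M (\<xi> j) = 0" if "j \<in> J" for j
    using that J by (simp add: sum_nonneg_eq_0_iff)
  have "x = 0" if x: "x \<in> M" for x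
  proof -
    have "cinner x (\<sigma> g (\<xi> j)) = 0" if "g \<in> carrier G" "j \<in> J" for g j
    proof -
      have "cinner x (\<sigma> g (\<xi> j)) = cinner (\<sigma> (inv g) x) (proj M (\<xi> j))"
        using that invariantD(2)[OF invM _ x, of "inv g"]
        by (simp add: cinner_proj'[OF cM] cinner_action_right)
      then show ?thesis using p0 that by simp
    qed
    then have "(norm x)\<^sup>2 = 0"
      unfolding parseval[symmetric] by (simp add: infsum_0 cong: infsum_cong)
    then show ?thesis by simp
  qed
  then have "closure (cspan S) = UNIV"
    by (intro closed_csubspace_eq_UNIV closed_csubspace_closure_cspan)
       (auto simp: M_def intro: closure_subset[THEN subsetD] complex_vector.span_base)
  then show ?thesis
    using on unfolding orthonormal_basis_def orthonormal_on_def S_def by blast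
qed

end

section \<open>Reproducing kernel subspaces\<close>

text \<open>These are the conditions for right convolution by \<open>C\<close> to be a self-adjoint idempotent; it
  commutes with left translations. Its range is described without reference to this operator, as
  the space in which \<open>kernel_vector x\<close> reproduces the value at \<open>x\<close>.\<close>
locale projection_kernel = group G for G :: "('g, 'm) monoid_scheme" (structure) +
  fixes C :: "'g \<Rightarrow> complex"
  assumes kernel_summable: "(\<lambda>w. (cmod (C w))\<^sup>2) summable_on carrier G"
    and kernel_inv: "w \<in> carrier G \<Longrightarrow> C (inv w) = cnj (C w)"
    and kernel_idem: "w \<in> carrier G \<Longrightarrow> ((\<lambda>z. C z * C (inv z \<otimes> w)) has_sum C w) (carrier G)"
begin

definition kernel_vector :: "'g \<Rightarrow> 'g ell2" where
  "kernel_vector x = Abs_ell2 (\<lambda>y. if y \<in> carrier G then C (inv x \<otimes> y) else 0)"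

definition kernel_space :: "'g ell2 set" where
  "kernel_space = {f \<in> supported (carrier G). \<forall>x\<in>carrier G. cinner f (kernel_vector x) = coord f x}"

lemma bij_mult_left: "x \<in> carrier G \<Longrightarrow> bij_betw (\<lambda>y. x \<otimes> y) (carrier G) (carrier G)"
  by (rule bij_betw_byWitness[where f' = "\<lambda>y. inv x \<otimes> y"]) (auto simp flip: m_assoc)

lemma coord_kernel_vector:
  assumes "x \<in> carrier G"
  shows "coord (kernel_vector x) y = (if y \<in> carrier G then C (inv x \<otimes> y) else 0)"
proof -
  have "(\<lambda>y. (cmod (C (inv x \<otimes> y)))\<^sup>2) summable_on carrier G"
    using summable_on_reindex_bij_betw[OF bij_mult_left[of "inv x"], of "\<lambda>w. (cmod (C w))\<^sup>2"]
      kernel_summable assms by simp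
  then have "(\<lambda>y. (cmod (if y \<in> carrier G then C (inv x \<otimes> y) else 0))\<^sup>2) summable_on UNIV"
    by (rule summable_on_cong_neutral[THEN iffD1, rotated -1]) auto
  then show ?thesis
    unfolding kernel_vector_def by (subst Abs_ell2_inverse) auto
qed

lemma kernel_vector_supported: "x \<in> carrier G \<Longrightarrow> kernel_vector x \<in> supported (carrier G)"
  by (simp add: supported_def coord_kernel_vector)

lemma cinner_kernel_vector:
  assumes x: "x \<in> carrier G" and y: "y \<in> carrier G"
  shows "cinner (kernel_vector x) (kernel_vector y) = C (inv x \<otimes> y)"
proof -
  have "((\<lambda>v. C v * C (inv v \<otimes> (inv x \<otimes> y))) has_sum C (inv x \<otimes> y)) (carrier G)"
    using x y by (intro kernel_idem) auto
  then have "((\<lambda>z. C (inv x \<otimes> z) * C (inv (inv x \<otimes> z) \<otimes> (inv x \<otimes> y))) has_sum C (inv x \<otimes> y)) (carrier G)"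
    using has_sum_reindex_bij_betw[OF bij_mult_left[of "inv x"],
        of "\<lambda>v. C v * C (inv v \<otimes> (inv x \<otimes> y))"] x by simp
  then have "((\<lambda>z. coord (kernel_vector x) z * cnj (coord (kernel_vector y) z)) has_sum C (inv x \<otimes> y)) UNIV"
  proof (rule has_sum_cong_neutral[THEN iffD1, rotated -1])
    fix z assume "z \<in> carrier G \<inter> UNIV"
    then have z: "z \<in> carrier G" by simp
    have "x \<otimes> (inv x \<otimes> y) = y"
      using x y by (simp flip: m_assoc)
    then have "inv (inv x \<otimes> z) \<otimes> (inv x \<otimes> y) = inv z \<otimes> y"
      using x y z by (simp add: inv_mult_group m_assoc)
    also have "\<dots> = inv (inv y \<otimes> z)"
      using x y z by (simp add: inv_mult_group)
    finally show "C (inv x \<otimes> z) * C (inv (inv x \<otimes> z) \<otimes> (inv x \<otimes> y)) =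
        coord (kernel_vector x) z * cnj (coord (kernel_vector y) z)"
      using x y z by (simp add: coord_kernel_vector kernel_inv)
  qed (use x in \<open>auto simp: coord_kernel_vector\<close>)
  then show ?thesis
    using has_sum_cinner_ell2 has_sum_unique by blast
qed

lemma lam_kernel_vector:
  assumes "g \<in> carrier G" "x \<in> carrier G"
  shows "lam G g (kernel_vector x) = kernel_vector (g \<otimes> x)"
  using assms by (intro ell2_eqI) (simp add: coord_lam coord_kernel_vector inv_mult_group m_assoc)

lemma kernel_vector_in_space: "x \<in> carrier G \<Longrightarrow> kernel_vector x \<in> kernel_space"
  by (simp add: kernel_space_def kernel_vector_supported cinner_kernel_vector coord_kernel_vector)

lemma invariant_kernel_space: "invariant G (lam G) kernel_space"
proof -
  let ?S = "(\<lambda>x. kernel_vector x - delta x) ` carrier G"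
  have eq: "kernel_space = {f. \<forall>s\<in>?S. cinner f s = 0} \<inter> supported (carrier G)"
    by (auto simp: kernel_space_def cinner_diff_right)
  have "lam G g s \<in> ?S" if "g \<in> carrier G" "s \<in> ?S" for g s
    using that by (auto simp: clinear_diff[OF lam.clinear_action] lam_kernel_vector lam_delta)
  then show ?thesis
    unfolding eq by (intro lam.invariant_Int lam.invariant_orthogonal)
      (auto simp: invariant_def closed_csubspace_supported lam_supported)
qed

lemma norm_kernel_vector: "x \<in> carrier G \<Longrightarrow> complex_of_real ((norm (kernel_vector x))\<^sup>2) = C \<one>"
  unfolding cinner_self[symmetric] by (simp add: cinner_kernel_vector)

text \<open>The coefficient of \<open>f\<close> at \<open>g\<close> is the value \<open>f g\<close> by the reproducing property.\<close>
lemma parseval_vector_on_kernel_space: "parseval_vector_on G (lam G) kernel_space (kernel_vector \<one>)"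
  unfolding parseval_vector_on_def
proof (intro conjI ballI invariant_kernel_space kernel_vector_in_space one_closed)
  fix f assume f: "f \<in> kernel_space"
  then have "((\<lambda>g. (cmod (coord f g))\<^sup>2) has_sum (norm f)\<^sup>2) (carrier G)"
    by (intro has_sum_norm_supported) (simp add: kernel_space_def)
  then show "((\<lambda>g. (cmod (cinner f (lam G g (kernel_vector \<one>))))\<^sup>2) has_sum (norm f)\<^sup>2) (carrier G)"
    by (rule has_sum_cong[THEN iffD1, rotated]) (use f in \<open>simp add: lam_kernel_vector kernel_space_def\<close>)
qed

end

text \<open>The function \<open>c\<close> on the integers, transported to the powers of \<open>u\<close> and extended by \<open>0\<close>. The
  definite description is meant for \<open>u\<close> of infinite order.\<close>
definition cyclic_kernel :: "('g, 'm) monoid_scheme \<Rightarrow> 'g \<Rightarrow> (int \<Rightarrow> complex) \<Rightarrow> 'g \<Rightarrow> complex" where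
  "cyclic_kernel G u c w =
     (if \<exists>n::int. w = u [^]\<^bsub>G\<^esub> n then c (THE n. w = u [^]\<^bsub>G\<^esub> n) else 0)"

context group
begin

context
  fixes u assumes u: "u \<in> carrier G" and inf: "ord u = 0"
begin

lemma int_pow_inj: "u [^] (m::int) = u [^] (n::int) \<longleftrightarrow> m = n"
proof
  assume *: "u [^] m = u [^] n"
  then have "u [^] (m - n) = \<one>"
    using u by (simp add: int_pow_diff)
  moreover have "u [^] k \<noteq> \<one>" if "k > 0" for k :: nat
    using inf that u ord_eq_0 by simp
  ultimately show "m = n"
    using u by (cases "m - n" rule: int_cases3)
      (auto simp: int_pow_int int_pow_neg)
qed simp

lemma cyclic_kernel_pow: "cyclic_kernel G u c (u [^] n) = c n"
  unfolding cyclic_kernel_def by (auto simp: int_pow_inj)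

lemma cyclic_kernel_outside: "w \<notin> range (\<lambda>n::int. u [^] n) \<Longrightarrow> cyclic_kernel G u c w = 0"
  unfolding cyclic_kernel_def by auto

text \<open>The hypotheses on \<open>c\<close> are those of a projection kernel on the integers. They survive the
  extension by \<open>0\<close>, because \<open>z\<close> and \<open>inv z \<otimes> w\<close> are both powers of \<open>u\<close> only if \<open>w\<close> is one.\<close>
lemma projection_kernel_cyclic:
  assumes summable: "(\<lambda>n. (cmod (c n))\<^sup>2) summable_on UNIV"
    and cnj: "\<And>n. c (- n) = cnj (c n)"
    and idem: "\<And>n. ((\<lambda>m. c m * c (n - m)) has_sum c n) UNIV"
  shows "projection_kernel G (cyclic_kernel G u c)"
proof (intro projection_kernel.intro projection_kernel_axioms.intro group_axioms)
  let ?C = "cyclic_kernel G u c"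
  let ?p = "\<lambda>n::int. u [^] n"
  have bij: "bij_betw ?p UNIV (range ?p)"
    unfolding bij_betw_def by (auto simp: inj_on_def int_pow_inj)
  have sub: "range ?p \<subseteq> carrier G" using u by auto
  have "(\<lambda>w. (cmod (?C w))\<^sup>2) summable_on range ?p"
    using summable_on_reindex_bij_betw[OF bij, of "\<lambda>w. (cmod (?C w))\<^sup>2"] summable
    by (simp add: cyclic_kernel_pow)
  then show "(\<lambda>w. (cmod (?C w))\<^sup>2) summable_on carrier G"
    by (rule summable_on_cong_neutral[THEN iffD1, rotated -1])
       (use sub in \<open>auto simp: cyclic_kernel_outside\<close>)
  show "?C (inv w) = cnj (?C w)" if w: "w \<in> carrier G" for w
  proof (cases "w \<in> range ?p")
    case True
    then obtain n where n: "w = ?p n" by blast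
    have "?C (inv w) = ?C (?p (- n))"
      unfolding n int_pow_neg[OF u] by (rule refl)
    then show ?thesis
      unfolding cyclic_kernel_pow n cnj .
  next
    case False
    have "inv w \<noteq> ?p n" for n
    proof
      assume "inv w = ?p n"
      then have "w = ?p (- n)" using w u by (metis inv_inv int_pow_neg)
      then show False using False by blast
    qed
    then have "inv w \<notin> range ?p" by blast
    then show ?thesis using False by (simp add: cyclic_kernel_outside)
  qed
  show "((\<lambda>z. ?C z * ?C (inv z \<otimes> w)) has_sum ?C w) (carrier G)" if w: "w \<in> carrier G" for w
  proof -
    have "((\<lambda>m. ?C (?p m) * ?C (inv (?p m) \<otimes> w)) has_sum ?C w) UNIV"
    proof (cases "w \<in> range ?p")
      case True
      then obtain n where n: "w = ?p n" by blast
      have "inv (?p m) \<otimes> w = ?p (n - m)" for m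
      proof -
        have "?p (n - m) = ?p (- m) \<otimes> ?p n"
          using u by (simp add: int_pow_mult[symmetric])
        then show ?thesis using u n by (simp add: int_pow_neg)
      qed
      then show ?thesis
        using idem[of n] unfolding cyclic_kernel_pow by (simp add: n cyclic_kernel_pow)
    next
      case False
      have "inv (?p m) \<otimes> w \<noteq> ?p n" for m n
      proof
        assume "inv (?p m) \<otimes> w = ?p n"
        then have "w = ?p m \<otimes> ?p n"
          using u w by (simp add: inv_solve_left')
        then have "w = ?p (m + n)" using u by (simp add: int_pow_mult)
        then show False using False by blast
      qed
      then have "?C (inv (?p m) \<otimes> w) = 0" for m
        by (intro cyclic_kernel_outside) blast
      then show ?thesis using False by (simp add: cyclic_kernel_outside)
    qed
    then have "((\<lambda>z. ?C z * ?C (inv z \<otimes> w)) has_sum ?C w) (range ?p)"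
      using has_sum_reindex_bij_betw[OF bij, of "\<lambda>z. ?C z * ?C (inv z \<otimes> w)"] by simp
    then show ?thesis
      by (rule has_sum_cong_neutral[THEN iffD1, rotated -1])
         (use sub in \<open>auto simp: cyclic_kernel_outside\<close>)
  qed
qed

end

end

section \<open>Fourier coefficients of an arc\<close>

text \<open>The \<open>n\<close>-th coefficient is \<open>\<integral> exp (2 \<pi> i n t) dt\<close> over the arc \<open>0 \<le> t \<le> 1/N\<close>.\<close>
definition arc_coeff :: "nat \<Rightarrow> int \<Rightarrow> complex" where
  "arc_coeff N n = (if n = 0 then 1 / of_nat N
     else (cis (2 * pi * of_int n / of_nat N) - 1) / (2 * pi * of_int n * \<i>))"

text \<open>The discrete analogue on the \<open>2 K\<close>-th roots of unity: the Fourier coefficients of the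
  indicator function of \<open>M\<close> consecutive roots.\<close>
definition discrete_arc_coeff :: "nat \<Rightarrow> nat \<Rightarrow> int \<Rightarrow> complex" where
  "discrete_arc_coeff M K k = (\<Sum>j<M. cis (pi * of_nat j * of_int k / of_nat K)) / of_nat (2 * K)"

lemma norm_cis_minus_one: "cmod (cis \<theta> - 1) = 2 * \<bar>sin (\<theta> / 2)\<bar>"
proof -
  have "(cmod (cis \<theta> - 1))\<^sup>2 = (cos \<theta> - 1)\<^sup>2 + (sin \<theta>)\<^sup>2"
    by (simp add: cmod_power2)
  also have "\<dots> = 2 - 2 * cos \<theta>"
    using sin_cos_squared_add[of \<theta>] by (simp add: power2_diff)
  also have "\<dots> = (2 * \<bar>sin (\<theta> / 2)\<bar>)\<^sup>2"
    using cos_double_sin[of "\<theta> / 2"] by (simp add: power_mult_distrib)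
  finally show ?thesis by (rule power2_eq_imp_eq) simp_all
qed

lemma cis_ne_one:
  assumes "\<theta> \<noteq> 0" "\<bar>\<theta>\<bar> < 2 * pi"
  shows "cis \<theta> \<noteq> 1"
proof -
  have "0 < sin (\<bar>\<theta>\<bar> / 2)"
    using assms by (intro sin_gt_zero) auto
  then have "sin (\<theta> / 2) \<noteq> 0"
    by (cases "\<theta> \<ge> 0") auto
  then show ?thesis using norm_cis_minus_one[of \<theta>] by auto
qed

lemma sum_cis_window:
  assumes K: "K > 0" and a: "\<bar>a\<bar> < 2 * int K"
  shows "(\<Sum>m\<in>{- int K..<int K}. cis (pi * of_int a * of_int m / of_nat K))
    = (if a = 0 then of_nat (2 * K) else 0)"
proof (cases "a = 0")
  case False
  define w where "w = cis (pi * of_int a / of_nat K)"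
  have "cis (pi * of_int a / of_nat K) \<noteq> 1"
  proof (rule cis_ne_one)
    have "real_of_int \<bar>a\<bar> < real_of_int (2 * int K)" using a of_int_less_iff by blast
    then have "\<bar>real_of_int a\<bar> / real K < 2" using K by (simp add: field_simps)
    then have "pi * (\<bar>real_of_int a\<bar> / real K) < pi * 2" by (intro mult_strict_left_mono) auto
    then show "\<bar>pi * of_int a / of_nat K\<bar> < 2 * pi" by (simp add: abs_mult)
  qed (use False K in auto)
  then have w: "w \<noteq> 1" unfolding w_def .
  have "w ^ (2 * K) = cis (2 * pi * of_int a)"
    unfolding w_def Complex.DeMoivre by (rule arg_cong[of _ _ cis]) (use K in simp)
  also have "\<dots> = 1"
    by (rule cis_multiple_2pi) simp
  finally have "(\<Sum>i<2 * K. w ^ i) = 0"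
    using geometric_sum[OF w, of "2 * K"] by simp
  have "(\<Sum>m\<in>{- int K..<int K}. cis (pi * of_int a * of_int m / of_nat K))
      = (\<Sum>i<2 * K. cis (pi * of_int a * of_int (int i - int K) / of_nat K))"
    by (rule sum.reindex_bij_witness[of _ "\<lambda>i. int i - int K" "\<lambda>m. nat (m + int K)"]) auto
  also have "\<dots> = (\<Sum>i<2 * K. cis (- (pi * of_int a)) * w ^ i)"
    unfolding w_def Complex.DeMoivre cis_mult using K by (intro sum.cong refl arg_cong[of _ _ cis]) (simp add: field_simps)
  also have "\<dots> = 0"
    using \<open>(\<Sum>i<2 * K. w ^ i) = 0\<close> by (simp flip: sum_distrib_left)
  finally show ?thesis using False by simp
qed simp

lemma discrete_arc_coeff_idem:
  assumes K: "K > 0" and M: "M \<le> 2 * K"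
  shows "(\<Sum>m\<in>{- int K..<int K}. discrete_arc_coeff M K m * discrete_arc_coeff M K (n - m))
    = discrete_arc_coeff M K n"
proof -
  let ?e = "\<lambda>x::real. cis (pi * x / of_nat K)"
  let ?t = "\<lambda>m j l. ?e (of_nat l * of_int n) * cis (pi * of_int (int j - int l) * of_int m / of_nat K)"
  let ?W = "{- int K..<int K}"
  have "discrete_arc_coeff M K m * discrete_arc_coeff M K (n - m)
      = (\<Sum>j<M. \<Sum>l<M. ?t m j l) / (of_nat (2 * K))\<^sup>2" for m
  proof -
    have "?e (of_nat j * of_int m) * ?e (of_nat l * of_int (n - m))
        = ?t m j l" for j l :: nat
      unfolding cis_mult by (rule arg_cong[of _ _ cis]) (simp add: add_divide_distrib[symmetric] algebra_simps)
    then show ?thesis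
      unfolding discrete_arc_coeff_def
      by (simp add: sum_product power2_eq_square mult.assoc)
  qed
  then have "(\<Sum>m\<in>?W. discrete_arc_coeff M K m * discrete_arc_coeff M K (n - m))
      = (\<Sum>m\<in>?W. \<Sum>j<M. \<Sum>l<M. ?t m j l) / (of_nat (2 * K))\<^sup>2"
    by (simp add: sum_divide_distrib)
  also have "(\<Sum>m\<in>?W. \<Sum>j<M. \<Sum>l<M. ?t m j l)
      = (\<Sum>j<M. \<Sum>l<M. \<Sum>m\<in>?W. ?t m j l)"
    by (subst sum.swap, intro sum.cong refl, rule sum.swap)
  also have "\<dots> = (\<Sum>j<M. \<Sum>l<M. ?e (of_nat l * of_int n) * (if l = j then of_nat (2 * K) else 0))"
  proof (intro sum.cong refl)
    fix j l assume "j \<in> {..<M}" "l \<in> {..<M}"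
    then have "\<bar>int j - int l\<bar> < 2 * int K" using M by auto
    then show "(\<Sum>m\<in>?W. ?t m j l)
        = ?e (of_nat l * of_int n) * (if l = j then of_nat (2 * K) else 0)"
      using sum_cis_window[OF K, of "int j - int l"] by (auto simp flip: sum_distrib_left)
  qed
  also have "\<dots> = (\<Sum>j<M. ?e (of_nat j * of_int n)) * of_nat (2 * K)"
    by (simp add: sum_distrib_right if_distrib[of "\<lambda>x. _ * x"] cong: if_cong)
  finally show ?thesis
    unfolding discrete_arc_coeff_def using K by (simp add: power2_eq_square mult.assoc)
qed

lemma discrete_arc_coeff_eq:
  assumes K: "K > 0" and k: "k \<noteq> 0" "\<bar>k\<bar> < 2 * int K"
  shows "discrete_arc_coeff M K k = (cis (pi * of_nat M * of_int k / of_nat K) - 1)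
    / (of_nat (2 * K) * (cis (pi * of_int k / of_nat K) - 1))"
proof -
  define w where "w = cis (pi * of_int k / of_nat K)"
  have "w \<noteq> 1"
    unfolding w_def
  proof (rule cis_ne_one)
    have "real_of_int \<bar>k\<bar> < real_of_int (2 * int K)" using k(2) of_int_less_iff by blast
    then have "\<bar>real_of_int k\<bar> / real K < 2" using K by (simp add: field_simps)
    then have "pi * (\<bar>real_of_int k\<bar> / real K) < pi * 2" by (intro mult_strict_left_mono) auto
    then show "\<bar>pi * of_int k / of_nat K\<bar> < 2 * pi" by (simp add: abs_mult)
  qed (use k K in auto)
  moreover have pow: "w ^ j = cis (pi * of_nat j * of_int k / of_nat K)" for j
    unfolding w_def Complex.DeMoivre by (rule arg_cong[of _ _ cis]) simp
  moreover have "discrete_arc_coeff M K k = (\<Sum>j<M. w ^ j) / of_nat (2 * K)"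
    unfolding discrete_arc_coeff_def pow ..
  ultimately have "discrete_arc_coeff M K k = (w ^ M - 1) / (w - 1) / of_nat (2 * K)"
    using geometric_sum[of w M] by simp
  then show ?thesis
    unfolding pow[symmetric] w_def[symmetric] by (simp only: divide_divide_eq_left mult.commute)
qed

lemma sin_ge_sixth:
  assumes "0 \<le> y" "y \<le> 3 * pi / 4"
  shows "y / 6 \<le> sin y"
proof (cases "y \<le> pi / 3")
  case True
  have "sin 0 - 0 / 2 \<le> sin y - y / (2::real)"
  proof (rule DERIV_nonneg_imp_nondecreasing[OF assms(1)])
    fix x assume x: "0 \<le> x" "x \<le> y"
    have "cos (pi / 3) \<le> cos x"
      using x True by (intro cos_monotone_0_pi_le) auto
    then have "0 \<le> cos x - 1 / 2" by (simp add: cos_60)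
    moreover have "((\<lambda>y. sin y - y / 2) has_real_derivative cos x - 1 / 2) (at x)"
      by (auto intro!: derivative_eq_intros)
    ultimately show "\<exists>z. ((\<lambda>y. sin y - y / 2) has_real_derivative z) (at x) \<and> 0 \<le> z" by blast
  qed
  then show ?thesis using assms(1) by simp
next
  case False
  have "1 / 2 \<le> sin y"
  proof (cases "y \<le> pi / 2")
    case True
    have "sin (pi / 6) \<le> sin y"
      using True False pi_gt_zero by (intro sin_monotone_2pi_le) linarith+
    then show ?thesis by (simp add: sin_30)
  next
    case False
    have "sin (pi / 6) \<le> sin (pi - y)"
      using False assms(2) pi_gt_zero by (intro sin_monotone_2pi_le) linarith+
    then show ?thesis by (simp add: sin_30)
  qed
  then show ?thesis using assms(2) pi_less_4 by linarith
qed

text \<open>A square-summable bound on the discrete coefficients that does not depend on \<open>K\<close>.\<close>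
definition arc_bound :: "int \<Rightarrow> real" where
  "arc_bound k = 4 / (1 + \<bar>of_int k\<bar>)"

text \<open>The denominator of the geometric sum has modulus \<open>2 \<bar>sin (\<theta> / 2)\<bar>\<close> with \<open>\<theta> = \<pi> k / K\<close>. The range of \<open>k\<close>
  keeps \<open>\<theta> / 2\<close> at distance \<open>\<pi> / 4\<close> from the zero \<open>\<pi>\<close> of the sine, and it is wide enough to contain
  \<open>n - m\<close> for all \<open>m\<close> in the window \<open>\<bar>m\<bar> \<le> K\<close> as soon as \<open>K \<ge> 2 \<bar>n\<bar>\<close>.\<close>
lemma norm_discrete_arc_coeff_le:
  assumes K: "K > 0" and M: "M \<le> 2 * K" and k: "2 * \<bar>k\<bar> \<le> 3 * int K"
  shows "cmod (discrete_arc_coeff M K k) \<le> arc_bound k"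
proof (cases "k = 0")
  case True
  then show ?thesis
    using K M by (simp add: discrete_arc_coeff_def arc_bound_def norm_divide field_simps)
next
  case False
  define \<theta> where "\<theta> = pi * of_int k / of_nat K"
  define r where "r = \<bar>real_of_int k\<bar>"
  have r1: "r \<ge> 1" using False unfolding r_def by linarith
  have "real_of_int (2 * \<bar>k\<bar>) \<le> real_of_int (3 * int K)"
    using k of_int_le_iff by blast
  then have rK: "2 * r \<le> 3 * real K" by (simp add: r_def)
  have \<theta>r: "\<bar>\<theta>\<bar> = pi * (r / real K)"
    by (simp add: \<theta>_def r_def abs_mult)
  have "r / real K \<le> 3 / 2" using rK K by (simp add: field_simps)
  then have "\<bar>\<theta>\<bar> \<le> pi * (3 / 2)"
    unfolding \<theta>r by (intro mult_left_mono) auto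
  then have "\<bar>\<theta>\<bar> / 2 / 6 \<le> sin (\<bar>\<theta>\<bar> / 2)"
    by (intro sin_ge_sixth) auto
  also have "\<dots> \<le> \<bar>sin (\<theta> / 2)\<bar>"
    by (cases "\<theta> \<ge> 0") auto
  finally have "\<bar>\<theta>\<bar> / 6 \<le> cmod (cis \<theta> - 1)"
    unfolding norm_cis_minus_one by simp
  moreover have "3 * (r / real K) \<le> \<bar>\<theta>\<bar>"
    unfolding \<theta>r using pi_gt3 r1 by (intro mult_right_mono) auto
  then have "3 * (r / real K) / 6 \<le> \<bar>\<theta>\<bar> / 6" by (rule divide_right_mono) simp
  ultimately have "3 * (r / real K) / 6 \<le> cmod (cis \<theta> - 1)" by (rule order_trans[rotated])
  then have low: "r \<le> cmod (of_nat (2 * K) * (cis \<theta> - 1))"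
    using K unfolding norm_mult norm_of_nat by (simp add: field_simps)
  have "cmod (cis (pi * of_nat M * of_int k / of_nat K) - 1) \<le> 1 + 1"
    by (rule order_trans[OF norm_triangle_ineq4]) simp
  moreover have "\<bar>k\<bar> < 2 * int K" using k K by linarith
  ultimately have "cmod (discrete_arc_coeff M K k) \<le> 2 / r"
    using discrete_arc_coeff_eq[OF K False, of M] low r1 unfolding \<theta>_def[symmetric]
    by (auto simp: norm_divide intro!: frac_le)
  also have "\<dots> \<le> 4 / (1 + r)"
    using r1 by (simp add: field_simps)
  finally show ?thesis by (simp add: arc_bound_def r_def)
qed

lemma summable_arc_bound_sq: "(\<lambda>k. (arc_bound k)\<^sup>2) summable_on UNIV"
proof -
  have "summable (\<lambda>n::nat. 16 * inverse ((real (Suc n))\<^sup>2))"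
    using inverse_power_summable[of 2, where 'a = real] by (intro summable_mult) (subst summable_Suc_iff, simp)
  then have "(\<lambda>n::nat. (arc_bound (int n))\<^sup>2) summable_on UNIV"
    by (intro norm_summable_imp_summable_on) (simp add: arc_bound_def power_divide field_simps)
  then have 1: "(\<lambda>k. (arc_bound k)\<^sup>2) summable_on range int"
    by (subst summable_on_reindex) (simp_all add: o_def)
  have "(\<lambda>k. (arc_bound k)\<^sup>2) summable_on uminus ` range int"
    using 1 by (subst summable_on_reindex) (simp_all add: o_def arc_bound_def)
  then have "(\<lambda>k. (arc_bound k)\<^sup>2) summable_on (range int \<union> uminus ` range int)"
    using 1 by (intro summable_on_union)
  moreover have "range int \<union> uminus ` range int = UNIV"
  proof -
    have "k \<in> range int \<union> uminus ` range int" for k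
      by (cases k rule: int_cases2) auto
    then show ?thesis by blast
  qed
  ultimately show ?thesis by simp
qed

lemma summable_arc_bound_conv: "(\<lambda>m. arc_bound m * arc_bound (n - m)) summable_on UNIV"
proof -
  have bij: "bij_betw (\<lambda>m::int. n - m) UNIV UNIV"
    by (rule bij_betw_byWitness[where f' = "\<lambda>m. n - m"]) auto
  have "(\<lambda>m. (arc_bound (n - m))\<^sup>2) summable_on UNIV"
    using summable_on_reindex_bij_betw[OF bij, of "\<lambda>k. (arc_bound k)\<^sup>2"] summable_arc_bound_sq by simp
  then have "(\<lambda>m. cmod (of_real (arc_bound m) * cnj (of_real (arc_bound (n - m))))) summable_on UNIV"
    using summable_arc_bound_sq by (intro square_summable_mult) simp_all
  moreover have "cmod (of_real (arc_bound m) * cnj (of_real (arc_bound (n - m)))) = arc_bound m * arc_bound (n - m)" for m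
    unfolding norm_mult complex_mod_cnj norm_of_real by (simp add: arc_bound_def)
  ultimately show ?thesis by simp
qed

context
  fixes N :: nat assumes N: "N > 0"
begin

abbreviation (input) approx_coeff :: "nat \<Rightarrow> int \<Rightarrow> complex" where
  "approx_coeff i \<equiv> discrete_arc_coeff (2 * Suc i) (N * Suc i)"

lemma window_ge: "Suc i \<le> N * Suc i" "2 * Suc i \<le> 2 * (N * Suc i)" "int (Suc i) \<le> int (N * Suc i)" "0 < N * Suc i"
  using N by (cases N, simp, simp)+

text \<open>With \<open>M = 2 (i + 1)\<close> of \<open>2 K = 2 N (i + 1)\<close> roots of unity the discrete arc covers exactly
  \<open>1/N\<close> of the circle for every \<open>i\<close>.\<close>
lemma tendsto_discrete_arc_coeff:
  "(\<lambda>i. approx_coeff i k) \<longlonglongrightarrow> arc_coeff N k"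
proof (cases "k = 0")
  case True
  have "approx_coeff i k = arc_coeff N k" for i
  proof -
    have "approx_coeff i k = of_nat (2 * Suc i) / (of_nat N * of_nat (2 * Suc i))"
    proof -
      have "complex_of_nat (2 * (N * Suc i)) = of_nat N * of_nat (2 * Suc i)"
        unfolding of_nat_mult[symmetric] by (rule arg_cong[of _ _ of_nat]) simp
      then show ?thesis unfolding discrete_arc_coeff_def True by simp
    qed
    also have "\<dots> = 1 / of_nat N"
      by (rule nonzero_divide_mult_cancel_right) (simp only: of_nat_eq_0_iff, simp)
    finally show ?thesis unfolding arc_coeff_def using True by (simp only: if_True simp_thms)
  qed
  then show ?thesis by simp
next
  case False
  define x where "x i = pi * of_int k / real (N * Suc i)" for i
  have x0: "x i \<noteq> 0" for i
  proof -
    have "real (N * Suc i) \<noteq> 0"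
      using window_ge(4)[of i] unfolding of_nat_eq_0_iff by simp
    then show ?thesis
      using False pi_neq_zero unfolding x_def divide_eq_0_iff mult_eq_0_iff of_int_eq_0_iff by blast
  qed
  have "(\<lambda>i. (pi * of_int k / real N) * inverse (real (Suc i))) \<longlonglongrightarrow> (pi * of_int k / real N) * 0"
    by (intro tendsto_mult_left LIMSEQ_inverse_real_of_nat)
  then have xlim: "x \<longlonglongrightarrow> 0"
    unfolding x_def by (simp add: field_simps)
  have "(\<lambda>i. (exp (\<i> * of_real (x i)) - 1) / (\<i> * of_real (x i))) \<longlonglongrightarrow> 1"
  proof (rule filterlim_compose[OF lim_exp_minus_1])
    have "(\<lambda>i. \<i> * complex_of_real (x i)) \<longlonglongrightarrow> \<i> * of_real 0"
      by (intro tendsto_mult_left tendsto_of_real xlim)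
    then show "filterlim (\<lambda>i. \<i> * complex_of_real (x i)) (at 0) sequentially"
      using x0 by (simp add: filterlim_at)
  qed
  then have "(\<lambda>i. \<i> * ((exp (\<i> * of_real (x i)) - 1) / (\<i> * of_real (x i)))) \<longlonglongrightarrow> \<i> * 1"
    by (rule tendsto_mult_left)
  then have "(\<lambda>i. (cis (x i) - 1) / of_real (x i)) \<longlonglongrightarrow> \<i>"
    by (simp add: cis_conv_exp)
  then have "(\<lambda>i. (cis (2 * pi * of_int k / of_nat N) - 1) / (2 * pi * of_int k * ((cis (x i) - 1) / of_real (x i))))
      \<longlonglongrightarrow> (cis (2 * pi * of_int k / of_nat N) - 1) / (2 * pi * of_int k * \<i>)"
    using False by (intro tendsto_divide tendsto_mult tendsto_const) auto
  moreover have "\<forall>\<^sub>F i in sequentially. (cis (2 * pi * of_int k / of_nat N) - 1) / (2 * pi * of_int k * ((cis (x i) - 1) / of_real (x i)))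
      = approx_coeff i k"
    unfolding eventually_sequentially
  proof (intro exI allI impI)
    fix i assume i: "nat \<bar>k\<bar> \<le> i"
    have "\<bar>k\<bar> < int (Suc i)" using i by linarith
    also have "\<dots> \<le> int (N * Suc i)" by (rule window_ge)
    finally have "\<bar>k\<bar> < 2 * int (N * Suc i)" by linarith
    then have "approx_coeff i k
        = (cis (pi * of_nat (2 * Suc i) * of_int k / of_nat (N * Suc i)) - 1) / (of_nat (2 * (N * Suc i)) * (cis (x i) - 1))"
      using discrete_arc_coeff_eq[of "N * Suc i" k "2 * Suc i"] N False by (simp add: x_def del: of_nat_mult of_nat_Suc)
    also have "pi * of_nat (2 * Suc i) * of_int k / of_nat (N * Suc i) = 2 * pi * of_int k / of_nat N"
      unfolding of_nat_mult using N by (simp add: field_simps del: of_nat_Suc)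
    also have "complex_of_nat (2 * (N * Suc i)) = 2 * pi * of_int k / of_real (x i)"
      using False N by (simp add: x_def field_simps del: of_nat_Suc)
    finally show "(cis (2 * pi * of_int k / of_nat N) - 1) / (2 * pi * of_int k * ((cis (x i) - 1) / of_real (x i)))
      = approx_coeff i k" by simp
  qed
  ultimately show ?thesis
    using False by (simp add: arc_coeff_def tendsto_cong)
qed

lemma norm_arc_coeff_le: "cmod (arc_coeff N k) \<le> arc_bound k"
proof (rule tendsto_upperbound[OF tendsto_norm[OF tendsto_discrete_arc_coeff]])
  show "\<forall>\<^sub>F i in sequentially. cmod (approx_coeff i k) \<le> arc_bound k"
    unfolding eventually_sequentially
  proof (intro exI allI impI)
    fix i assume i: "nat \<bar>k\<bar> \<le> i"
    have "\<bar>k\<bar> \<le> int (Suc i)" using i by linarith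
    also have "\<dots> \<le> int (N * Suc i)" by (rule window_ge)
    finally have "2 * \<bar>k\<bar> \<le> 3 * int (N * Suc i)" by linarith
    then show "cmod (approx_coeff i k) \<le> arc_bound k"
      by (intro norm_discrete_arc_coeff_le window_ge)
  qed
qed simp

lemma summable_arc_coeff_sq: "(\<lambda>k. (cmod (arc_coeff N k))\<^sup>2) summable_on UNIV"
  by (rule summable_on_comparison_test[OF summable_arc_bound_sq])
     (auto intro: power_mono norm_arc_coeff_le)

lemma arc_coeff_uminus: "arc_coeff N (- k) = cnj (arc_coeff N k)"
  by (auto simp: arc_coeff_def cis_cnj)

text \<open>The convolution identity says that the indicator function of the arc is equal to its square.
  For the discrete arcs it is the orthogonality of characters, and it passes to the limit by
  dominated convergence.\<close>
lemma arc_coeff_idem: "((\<lambda>m. arc_coeff N m * arc_coeff N (n - m)) has_sum arc_coeff N n) UNIV"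
proof -
  let ?W = "\<lambda>i. {- int (N * Suc i)..<int (N * Suc i)}"
  define D where "D i = approx_coeff i" for i
  define g where "g i m = (if m \<in> ?W i then D i m * D i (n - m) else 0)" for i m
  let ?f = "\<lambda>m. arc_coeff N m * arc_coeff N (n - m)"
  let ?B = "\<lambda>m. arc_bound m * arc_bound (n - m)"
  have lim: "(\<lambda>i. g i m) \<longlonglongrightarrow> ?f m" for m
  proof -
    have "(\<lambda>i. D i m * D i (n - m)) \<longlonglongrightarrow> ?f m"
      unfolding D_def by (intro tendsto_mult tendsto_discrete_arc_coeff)
    moreover have "\<forall>\<^sub>F i in sequentially. D i m * D i (n - m) = g i m"
      unfolding eventually_sequentially
    proof (intro exI allI impI)
      fix i assume "nat \<bar>m\<bar> \<le> i"
      then have "\<bar>m\<bar> < int (Suc i)" by linarith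
      also have "\<dots> \<le> int (N * Suc i)" by (rule window_ge)
      finally have "m \<in> ?W i"
        unfolding atLeastLessThan_iff by linarith
      then show "D i m * D i (n - m) = g i m" by (simp add: g_def)
    qed
    ultimately show ?thesis using tendsto_cong by force
  qed
  have bound: "cmod (g i m) \<le> ?B m" if i: "nat (2 * \<bar>n\<bar>) \<le> i" for i m
  proof (cases "m \<in> ?W i")
    case True
    have 1: "\<bar>m\<bar> \<le> int (N * Suc i)" using True by auto
    have 2: "2 * \<bar>n\<bar> \<le> int (N * Suc i)" using i window_ge(3)[of i] by linarith
    have m: "2 * \<bar>m\<bar> \<le> 3 * int (N * Suc i)" using 1 by linarith
    have nm: "2 * \<bar>n - m\<bar> \<le> 3 * int (N * Suc i)"
    proof -
      have "2 * c \<le> 3 * X" if "c \<le> a + b" "b \<le> X" "2 * a \<le> X" for a b c X :: int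
        using that by linarith
      from this[OF abs_triangle_ineq4 1 2] show ?thesis .
    qed
    have "cmod (D i m) \<le> arc_bound m" "cmod (D i (n - m)) \<le> arc_bound (n - m)"
      unfolding D_def
      by (rule norm_discrete_arc_coeff_le[OF window_ge(4,2) m] norm_discrete_arc_coeff_le[OF window_ge(4,2) nm])+
    then have "cmod (D i m * D i (n - m)) \<le> ?B m"
      unfolding norm_mult by (intro mult_mono) (simp_all add: arc_bound_def)
    then show ?thesis using True by (simp add: g_def)
  next
    case False
    then have "g i m = 0" unfolding g_def by (rule if_not_P)
    then show ?thesis by (simp add: arc_bound_def)
  qed
  have sums: "(g i has_sum D i n) UNIV" for i
  proof (rule has_sum_finite_neutralI)
    have "(\<Sum>m\<in>?W i. g i m)
        = (\<Sum>m\<in>?W i. D i m * D i (n - m))"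
      unfolding g_def by (rule sum.cong[OF refl]) (rule if_P)
    also have "\<dots> = D i n"
      unfolding D_def by (rule discrete_arc_coeff_idem[OF window_ge(4,2)])
    finally show "D i n = (\<Sum>m\<in>?W i. g i m)" ..
    show "g i m = 0" if "m \<in> UNIV - ?W i" for m
      using that unfolding g_def by (intro if_not_P) blast
  qed simp_all
  have bij: "bij_betw int_decode UNIV UNIV" by (rule bij_int_decode)
  have "eventually (\<lambda>i. summable (\<lambda>k. norm (g i (int_decode k)))) sequentially \<and>
      summable (\<lambda>k. norm (?f (int_decode k))) \<and>
      (\<lambda>i. suminf (\<lambda>k. g i (int_decode k))) \<longlonglongrightarrow> suminf (\<lambda>k. ?f (int_decode k))"
  proof (rule tannerys_theorem)
    show "\<forall>\<^sub>F (k, i) in at_top \<times>\<^sub>F sequentially. norm (g i (int_decode k)) \<le> ?B (int_decode k)"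
      unfolding eventually_prod_sequentially using bound by auto
    have "(\<lambda>k. ?B (int_decode k)) summable_on UNIV"
      using summable_on_reindex_bij_betw[OF bij, of ?B] summable_arc_bound_conv by simp
    then show "summable (\<lambda>k. ?B (int_decode k))" by (rule summable_on_imp_summable)
  qed (rule lim, simp)
  then have sf: "summable (\<lambda>k. norm (?f (int_decode k)))"
    and sl: "(\<lambda>i. suminf (\<lambda>k. g i (int_decode k))) \<longlonglongrightarrow> suminf (\<lambda>k. ?f (int_decode k))"
    by auto
  have "suminf (\<lambda>k. g i (int_decode k)) = D i n" for i
  proof -
    have "((\<lambda>k. g i (int_decode k)) has_sum D i n) UNIV"
      using has_sum_reindex_bij_betw[OF bij, of "g i"] sums by simp
    then show ?thesis using has_sum_imp_sums sums_unique by metis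
  qed
  then have "suminf (\<lambda>k. ?f (int_decode k)) = arc_coeff N n"
    using sl tendsto_discrete_arc_coeff[of n] LIMSEQ_unique unfolding D_def by simp
  then have "((\<lambda>k. ?f (int_decode k)) has_sum arc_coeff N n) UNIV"
    using norm_summable_imp_has_sum[OF sf] summable_sums[OF summable_norm_cancel[OF sf]] by simp
  then show ?thesis
    using has_sum_reindex_bij_betw[OF bij, of ?f] by simp
qed

text \<open>The Fourier coefficients of the arc rotated by \<open>k / N\<close> of a full turn.\<close>
definition rotated_arc_coeff :: "nat \<Rightarrow> int \<Rightarrow> complex" where
  "rotated_arc_coeff k n = cis (2 * pi * of_nat k * of_int n / of_nat N) * arc_coeff N n"

lemma summable_rotated_arc_coeff_sq: "(\<lambda>n. (cmod (rotated_arc_coeff k n))\<^sup>2) summable_on UNIV"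
  using summable_arc_coeff_sq by (simp add: rotated_arc_coeff_def norm_mult)

lemma rotated_arc_coeff_uminus: "rotated_arc_coeff k (- n) = cnj (rotated_arc_coeff k n)"
  by (simp add: rotated_arc_coeff_def arc_coeff_uminus cis_cnj)

lemma rotated_arc_coeff_idem:
  "((\<lambda>m. rotated_arc_coeff k m * rotated_arc_coeff k (n - m)) has_sum rotated_arc_coeff k n) UNIV"
proof -
  let ?e = "\<lambda>n::int. cis (2 * pi * of_nat k * of_int n / of_nat N)"
  have e: "?e m * ?e (n - m) = ?e n" for m
    unfolding cis_mult by (rule arg_cong[of _ _ cis]) (simp add: add_divide_distrib[symmetric] algebra_simps)
  have "rotated_arc_coeff k m * rotated_arc_coeff k (n - m)
      = (?e m * ?e (n - m)) * (arc_coeff N m * arc_coeff N (n - m))" for m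
    unfolding rotated_arc_coeff_def by (simp only: mult_ac)
  then have eq: "rotated_arc_coeff k m * rotated_arc_coeff k (n - m) = ?e n * (arc_coeff N m * arc_coeff N (n - m))" for m
    unfolding e .
  show ?thesis
    using has_sum_cmult_right[OF arc_coeff_idem, of "?e n" n]
    unfolding eq rotated_arc_coeff_def[of k n] .
qed

lemma sum_cis_eq_0:
  assumes "cis (2 * pi * of_int n / of_nat N) \<noteq> 1"
  shows "(\<Sum>k<N. cis (2 * pi * of_nat k * of_int n / of_nat N)) = 0"
proof -
  let ?w = "cis (2 * pi * of_int n / of_nat N)"
  have "?w ^ k = cis (2 * pi * of_nat k * of_int n / of_nat N)" for k
    unfolding Complex.DeMoivre by (rule arg_cong[of _ _ cis]) simp
  then have "(\<Sum>k<N. cis (2 * pi * of_nat k * of_int n / of_nat N)) = (\<Sum>k<N. ?w ^ k)"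
    by simp
  also have "\<dots> = (?w ^ N - 1) / (?w - 1)" using assms by (rule geometric_sum)
  also have "?w ^ N = cis (2 * pi * of_int n)" unfolding Complex.DeMoivre by (rule arg_cong[of _ _ cis]) (use N in simp)
  also have "cis (2 * pi * of_int n) = 1" by (rule cis_multiple_2pi) simp
  finally show ?thesis by simp
qed

text \<open>The \<open>N\<close> rotated arcs cover the circle once.\<close>
lemma sum_rotated_arc_coeff: "(\<Sum>k<N. rotated_arc_coeff k n) = (if n = 0 then 1 else 0)"
proof (cases "n = 0")
  case True
  then show ?thesis using N by (simp add: rotated_arc_coeff_def arc_coeff_def)
next
  case False
  have "(\<Sum>k<N. rotated_arc_coeff k n) = (\<Sum>k<N. cis (2 * pi * of_nat k * of_int n / of_nat N)) * arc_coeff N n"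
    by (simp add: rotated_arc_coeff_def sum_distrib_right)
  also have "\<dots> = 0"
    using False sum_cis_eq_0[of n] by (cases "cis (2 * pi * of_int n / of_nat N) = 1") (simp_all add: arc_coeff_def)
  finally show ?thesis using False by simp
qed

end

section \<open>Cosets and induced vectors\<close>

lemma unitary_representation_imp_action:
  assumes "group G" and rep: "unitary_representation G \<pi>"
  shows "unitary_action G \<pi>"
proof -
  interpret group G by fact
  have hom: "\<pi> \<in> hom G unitary_group" using rep unfolding unitary_representation_def .
  have op: "unitary_op (\<pi> g)" if "g \<in> carrier G" for g
    using hom that unfolding hom_def unitary_group_def by auto
  have mult: "\<pi> (g \<otimes>\<^bsub>G\<^esub> h) x = \<pi> g (\<pi> h x)" if "g \<in> carrier G" "h \<in> carrier G" for g h x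
    using hom that unfolding hom_def unitary_group_def by simp
  show ?thesis
  proof (intro unitary_action.intro unitary_action_axioms.intro group_axioms mult)
    show "\<pi> \<one>\<^bsub>G\<^esub> x = x" for x
    proof -
      have "surj (\<pi> \<one>\<^bsub>G\<^esub>)" using op[OF one_closed] unfolding unitary_op_def by blast
      \<comment> \<open>The operator of the unit is idempotent, and every vector lies in its range.\<close>
      then obtain y where "x = \<pi> \<one>\<^bsub>G\<^esub> y" by blast
      then show ?thesis using mult[OF one_closed one_closed, of y] by simp
    qed
  qed (use op in \<open>auto simp: unitary_op_def\<close>)
qed

lemma (in unitary_action) unitary_action_subgroup:
  assumes "subgroup H G"
  shows "unitary_action (G\<lparr>carrier := H\<rparr>) \<sigma>"
  using assms subgroup.mem_carrier[OF assms]
  by (intro unitary_action.intro unitary_action_axioms.intro subgroup_imp_group)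
     (simp_all add: clinear_action cinner_action action_mult action_one)

lemma (in group) transversal_exists:
  assumes H: "subgroup H G" and card: "card (rcosets H) = CARD('n::finite)"
  obtains r :: "'n::finite \<Rightarrow> 'a" where "\<And>j. r j \<in> carrier G"
    "bij_betw (\<lambda>(j, h). h \<otimes> r j) (UNIV \<times> H) (carrier G)"
proof -
  have "finite (rcosets H)"
    using card zero_less_card_finite[where 'a = 'n] by (metis card.infinite less_irrefl)
  then obtain b :: "'n \<Rightarrow> 'a set" where b: "bij_betw b UNIV (rcosets H)"
    using finite_same_card_bij[of "UNIV :: 'n set" "rcosets H"] card by auto
  have "\<exists>x. x \<in> carrier G \<and> b j = H #> x" for j
    using bij_betwE[OF b] unfolding RCOSETS_def by blast
  then obtain r where r: "\<And>j. r j \<in> carrier G" "\<And>j. b j = H #> r j" by metis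
  note Hc = subgroup.mem_carrier[OF H]
  have inj: "i = j \<and> h = k" if "h \<in> H" "k \<in> H" and eq: "h \<otimes> r i = k \<otimes> r j" for i j h k
  proof -
    have "h \<otimes> r i \<in> H #> r i" "k \<otimes> r j \<in> H #> r j"
      by (intro rcosI subgroup.subset[OF H] r(1) that)+
    then have "H #> r i = H #> (h \<otimes> r i)" "H #> r j = H #> (h \<otimes> r i)"
      using repr_independence[OF _ r(1) H] unfolding eq by blast+
    then have "b i = b j" using r(2) by simp
    then have "i = j" using b unfolding bij_betw_def inj_on_def by blast
    then show ?thesis using eq that r(1)[of j] Hc by simp
  qed
  have surj: "\<exists>j. \<exists>h\<in>H. y = h \<otimes> r j" if y: "y \<in> carrier G" for y
  proof -
    have "H #> y \<in> rcosets H" using y subgroup.subset[OF H] by (rule rcosetsI[rotated])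
    then obtain j where "H #> y = H #> r j"
      using b r(2) unfolding bij_betw_def by (metis imageE)
    then have "y \<in> H #> r j" using rcos_self[OF y H] by simp
    then show ?thesis unfolding r_coset_def by blast
  qed
  have "bij_betw (\<lambda>(j, h). h \<otimes> r j) (UNIV \<times> H) (carrier G)"
    unfolding bij_betw_def
  proof
    show "inj_on (\<lambda>(j, h). h \<otimes> r j) (UNIV \<times> H)"
      using inj by (auto simp: inj_on_def)
    show "(\<lambda>(j, h). h \<otimes> r j) ` (UNIV \<times> H) = carrier G"
      using surj Hc r(1) by (auto simp: image_iff Bex_def)
  qed
  then show ?thesis using that r(1) by blast
qed

text \<open>The functions of the kernel space supported on the coset \<open>H r\<close> form a representation of
  \<open>H\<close> of the same dimension \<open>C \<one> = D \<one>\<close> as the kernel space of \<open>D\<close> on \<open>H\<close>, so it contains a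
  vector with the same matrix coefficient as the Parseval vector of the latter.\<close>
lemma (in projection_kernel) coset_vector_exists:
  assumes H: "H \<lhd> G" and icc: "icc_group (G\<lparr>carrier := H\<rparr>)"
    and C0: "\<And>w. w \<notin> H \<Longrightarrow> C w = 0"
    and D: "projection_kernel (G\<lparr>carrier := H\<rparr>) D" and CD: "D \<one> = C \<one>"
    and r: "r \<in> carrier G"
  shows "\<exists>z\<in>kernel_space \<inter> supported (H #> r). \<forall>h\<in>H. cinner (lam G h z) z = D (inv h)"
proof -
  let ?H = "G\<lparr>carrier := H\<rparr>"
  let ?A = "kernel_space \<inter> supported (H #> r)"
  have sub: "subgroup H G" using H by (rule normal_imp_subgroup)
  note Hc = subgroup.mem_carrier[OF sub]
  interpret D: projection_kernel ?H D by (rule D)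
  have act: "unitary_action ?H (lam G)" using sub by (rule lam.unitary_action_subgroup)
  have coset: "inv h \<otimes> y \<in> H #> r \<longleftrightarrow> y \<in> H #> r" if "h \<in> H" "y \<in> carrier G" for h y
  proof
    assume "inv h \<otimes> y \<in> H #> r"
    then obtain k where k: "k \<in> H" "inv h \<otimes> y = k \<otimes> r" unfolding r_coset_def by blast
    then have "y = (h \<otimes> k) \<otimes> r" using that r Hc by (simp add: inv_solve_left' m_assoc)
    then show "y \<in> H #> r"
      using k(1) that(1) subgroup.m_closed[OF sub] unfolding r_coset_def by blast
  next
    assume "y \<in> H #> r"
    then obtain k where k: "k \<in> H" "y = k \<otimes> r" unfolding r_coset_def by blast
    then have "inv h \<otimes> y = (inv h \<otimes> k) \<otimes> r" using that r Hc by (simp add: m_assoc)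
    then show "inv h \<otimes> y \<in> H #> r"
      using k(1) that(1) subgroup.m_closed[OF sub] subgroup.m_inv_closed[OF sub]
      unfolding r_coset_def by blast
  qed
  have rH: "H #> r \<subseteq> carrier G" using r subgroup.subset[OF sub] by (rule r_coset_subset_G[rotated])
  have inv: "invariant ?H (lam G) ?A"
    unfolding invariant_def
  proof (intro conjI ballI)
    show "closed_csubspace ?A"
      by (intro closed_csubspace_Int closed_csubspace_supported lam.invariantD(1)[OF invariant_kernel_space])
    fix h f assume h: "h \<in> carrier ?H" and f: "f \<in> ?A"
    then have hH: "h \<in> H" "h \<in> carrier G" using Hc by auto
    have "lam G h f \<in> kernel_space"
      using lam.invariantD(2)[OF invariant_kernel_space hH(2)] f by blast
    moreover have "coord (lam G h f) y = 0" if "y \<notin> H #> r" for y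
      using that f coset[OF hH(1), of y] hH(2) by (auto simp: coord_lam supported_def)
    ultimately show "lam G h f \<in> ?A" by (simp add: supported_def)
  qed
  have "kernel_vector r \<in> ?A"
  proof -
    have "coord (kernel_vector r) y = 0" if y: "y \<notin> H #> r" for y
    proof (cases "y \<in> carrier G \<and> inv r \<otimes> y \<in> H")
      case True
      then have "r \<otimes> (inv r \<otimes> y) \<otimes> inv r \<in> H"
        using r by (intro normal.inv_op_closed2[OF H]) auto
      then have "(r \<otimes> (inv r \<otimes> y) \<otimes> inv r) \<otimes> r \<in> H #> r"
        unfolding r_coset_def by blast
      then show ?thesis using y True r by (simp add: m_assoc[symmetric]) (simp add: m_assoc)
    qed (use r C0 in \<open>auto simp: coord_kernel_vector\<close>)
    then show ?thesis using kernel_vector_in_space[OF r] by (simp add: supported_def)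
  qed
  moreover have "((\<lambda>h. (cmod (cinner f (lam G h (kernel_vector r))))\<^sup>2) has_sum (norm f)\<^sup>2) (carrier ?H)"
    if f: "f \<in> ?A" for f
  proof -
    have "bij_betw (\<lambda>h. h \<otimes> r) H (H #> r)"
      using r Hc unfolding bij_betw_def inj_on_def r_coset_def by auto
    moreover have "((\<lambda>y. (cmod (coord f y))\<^sup>2) has_sum (norm f)\<^sup>2) (H #> r)"
      using f by (intro has_sum_norm_supported) blast
    ultimately have "((\<lambda>h. (cmod (coord f (h \<otimes> r)))\<^sup>2) has_sum (norm f)\<^sup>2) (carrier ?H)"
      using has_sum_reindex_bij_betw[of "\<lambda>h. h \<otimes> r" H "H #> r" "\<lambda>y. (cmod (coord f y))\<^sup>2"] by simp
    then show ?thesis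
      by (rule has_sum_cong[THEN iffD1, rotated])
         (use f r Hc in \<open>simp add: lam_kernel_vector kernel_space_def\<close>)
  qed
  ultimately have pv: "parseval_vector_on ?H (lam G) ?A (kernel_vector r)"
    using inv unfolding parseval_vector_on_def by blast
  have "complex_of_real ((norm (kernel_vector r))\<^sup>2) = complex_of_real ((norm (D.kernel_vector \<one>))\<^sup>2)"
    using norm_kernel_vector[OF r] D.norm_kernel_vector[of \<one>] subgroup.one_closed[OF sub] CD by simp
  then have "norm (kernel_vector r) = norm (D.kernel_vector \<one>\<^bsub>?H\<^esub>)"
    unfolding of_real_eq_iff by (simp add: power2_eq_iff_nonneg)
  then obtain J where J: "\<And>y. y \<in> D.kernel_space \<Longrightarrow> J y \<in> ?A"
    "\<And>x y. x \<in> D.kernel_space \<Longrightarrow> y \<in> D.kernel_space \<Longrightarrow> cinner (J x) (J y) = cinner x y"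
    "\<And>g y. g \<in> carrier ?H \<Longrightarrow> y \<in> D.kernel_space \<Longrightarrow> J (lam ?H g y) = lam G g (J y)"
    by (rule icc_parseval_comparison[OF icc act pv D.unitary_action_lam D.parseval_vector_on_kernel_space])
       (rule that)
  let ?b = "D.kernel_vector \<one>"
  have b: "?b \<in> D.kernel_space"
    using D.kernel_vector_in_space[of \<one>] subgroup.one_closed[OF sub] by simp
  have "cinner (lam G h (J ?b)) (J ?b) = D (inv h)" if h: "h \<in> H" for h
  proof -
    have "lam ?H h ?b = D.kernel_vector h"
      using D.lam_kernel_vector[of h \<one>] h subgroup.one_closed[OF sub] Hc by simp
    then have "cinner (lam G h (J ?b)) (J ?b) = cinner (D.kernel_vector h) ?b"
      using J(2)[OF D.kernel_vector_in_space[of h] b] J(3)[OF _ b, of h] h by simp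
    also have "\<dots> = D (inv\<^bsub>?H\<^esub> h \<otimes> \<one>)"
      using D.cinner_kernel_vector[of h \<one>] h subgroup.one_closed[OF sub] by simp
    finally show ?thesis using h Hc by (simp add: m_inv_consistent[OF sub])
  qed
  then show ?thesis using J(1)[OF b] by blast
qed

section \<open>Strongly disjoint tuples of generators\<close>

context unitary_action
begin

text \<open>The orbits of the \<open>\<zeta> k\<close> under \<open>H\<close> span orthogonal summands of the representation, and an element
  outside \<open>H\<close> moves every summand to an orthogonal one.\<close>
lemma imprimitive_vectors_exist:
  fixes \<xi> :: 'a and N :: nat
  assumes "icc_group G" and "parseval_frame_vector G \<sigma> \<xi>" and "(norm \<xi>)\<^sup>2 = 1 / real N"
    and "H \<lhd> G" and "icc_group (G\<lparr>carrier := H\<rparr>)" and "card (rcosets H) = N"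
    and "u \<in> H" "ord u = 0" and "CARD('n::finite) = N"
  shows "\<exists>\<zeta> :: 'n \<Rightarrow> 'a.
    (\<forall>g\<in>carrier G. \<forall>k l. (g \<in> H \<longleftrightarrow> k \<noteq> l) \<longrightarrow> cinner (\<sigma> g (\<zeta> k)) (\<zeta> l) = 0) \<and>
    (\<forall>h\<in>H. (\<Sum>k\<in>UNIV. cinner (\<sigma> h (\<zeta> k)) (\<zeta> k)) = (if h = \<one> then 1 else 0))"
proof -
  let ?H = "G\<lparr>carrier := H\<rparr>"
  have N: "N > 0" using assms(9) zero_less_card_finite[where 'a = 'n] by simp
  have sub: "subgroup H G" using assms(4) by (rule normal_imp_subgroup)
  note Hc = subgroup.mem_carrier[OF sub]
  interpret H: group ?H using sub by (rule subgroup_imp_group)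
  obtain r :: "'n \<Rightarrow> 'g" where r: "\<And>j. r j \<in> carrier G"
    and bij_r: "bij_betw (\<lambda>(j, h). h \<otimes> r j) (UNIV \<times> H) (carrier G)"
    using transversal_exists[OF sub, where 'n = 'n] assms(6,9) by metis
  note u = assms(7,8)
  have uG: "u \<in> carrier G" using u Hc by blast
  have uH: "H.ord u = 0"
    using u(2) unfolding ord_def H.ord_def nat_pow_consistent[of u _ H] by simp
  obtain f :: "'n \<Rightarrow> nat" where f: "bij_betw f UNIV {..<N}"
    using finite_same_card_bij[of "UNIV :: 'n set" "{..<N}"] assms(9) by auto

  \<comment> \<open>\<open>C\<close> is a projection kernel of trace \<open>1/N\<close> on \<open>G\<close> supported in \<open>H\<close>; the kernels \<open>D k\<close> on \<open>H\<close> have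
    the same value at the unit and add up to the kernel \<open>\<delta>\<^sub>1\<close> of the identity.\<close>
  define C where "C = cyclic_kernel G u (arc_coeff N)"
  interpret C: projection_kernel G C
    unfolding C_def
    by (rule projection_kernel_cyclic[OF uG u(2) summable_arc_coeff_sq[OF N] arc_coeff_uminus[OF N] arc_coeff_idem[OF N]])
  define D where "D k = cyclic_kernel ?H u (rotated_arc_coeff N (f k))" for k
  have D: "projection_kernel ?H (D k)" for k
    unfolding D_def
    by (rule H.projection_kernel_cyclic[OF _ uH summable_rotated_arc_coeff_sq[OF N] rotated_arc_coeff_uminus[OF N] rotated_arc_coeff_idem[OF N]])
       (simp add: u(1))
  have C1: "C \<one> = 1 / of_nat N"
    using cyclic_kernel_pow[OF uG u(2), of "arc_coeff N" 0] by (simp add: C_def arc_coeff_def)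
  have D1: "D k \<one> = 1 / of_nat N" for k
    using H.cyclic_kernel_pow[OF _ uH, of "rotated_arc_coeff N (f k)" 0] u(1)
    by (simp add: D_def rotated_arc_coeff_def[OF N] arc_coeff_def)
  have C0: "C w = 0" if "w \<notin> H" for w
    unfolding C_def
  proof (rule cyclic_kernel_outside[OF uG u(2)])
    have "u [^] (n::int) \<in> H" for n
      using H.int_pow_closed[of u n] u(1) int_pow_consistent[OF sub u(1), of n] by simp
    then show "w \<notin> range (\<lambda>n::int. u [^] n)" using that by blast
  qed
  have sum_D: "(\<Sum>k\<in>UNIV. D k w) = (if w = \<one> then 1 else 0)" for w
  proof (cases "w \<in> range (\<lambda>n::int. u [^]\<^bsub>?H\<^esub> n)")
    case True
    then obtain n :: int where n: "w = u [^]\<^bsub>?H\<^esub> n" by blast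
    have uc: "u \<in> carrier ?H" using u(1) by simp
    have "(\<Sum>k\<in>UNIV. D k w) = (\<Sum>k\<in>UNIV. rotated_arc_coeff N (f k) n)"
      unfolding D_def n H.cyclic_kernel_pow[OF uc uH] ..
    also have "\<dots> = (\<Sum>k<N. rotated_arc_coeff N k n)"
      by (rule sum.reindex_bij_betw[OF f])
    also have "\<dots> = (if n = 0 then 1 else 0)" by (rule sum_rotated_arc_coeff[OF N])
    also have "n = 0 \<longleftrightarrow> w = \<one>"
      using H.int_pow_inj[OF uc uH, of n 0] n by simp
    finally show ?thesis .
  next
    case False
    have uc: "u \<in> carrier ?H" using u(1) by simp
    have "w \<noteq> \<one>"
    proof
      assume "w = \<one>"
      then have "w = u [^]\<^bsub>?H\<^esub> (0::int)" by simp
      then show False using False by blast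
    qed
    then show ?thesis
      using H.cyclic_kernel_outside[OF uc uH False] by (simp add: D_def)
  qed

  obtain J where J: "\<And>x y. x \<in> C.kernel_space \<Longrightarrow> y \<in> C.kernel_space \<Longrightarrow> cinner (J x) (J y) = cinner x y"
    "\<And>g y. g \<in> carrier G \<Longrightarrow> y \<in> C.kernel_space \<Longrightarrow> J (lam G g y) = \<sigma> g (J y)"
  proof -
    have pv: "parseval_vector_on G \<sigma> UNIV \<xi>"
      using assms(2) unfolding parseval_vector_on_def parseval_frame_vector_def parseval_frame_def
      by (simp add: invariant_def closed_csubspace_UNIV)
    have "complex_of_real ((norm (C.kernel_vector \<one>))\<^sup>2) = complex_of_real ((norm \<xi>)\<^sup>2)"
      unfolding C.norm_kernel_vector[OF one_closed] C1 assms(3) by simp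
    then have "norm \<xi> = norm (C.kernel_vector \<one>)"
      unfolding of_real_eq_iff by (simp add: power2_eq_iff_nonneg)
    from icc_parseval_comparison[OF assms(1) unitary_action_axioms pv unitary_action_lam
        C.parseval_vector_on_kernel_space this]
    show ?thesis using that by metis
  qed

  \<comment> \<open>The functions supported on the cosets \<open>H r\<^sub>k\<close> decompose the representation into \<open>N\<close> summands, and
    \<open>z k\<close> is a vector of the \<open>k\<close>-th summand with matrix coefficient \<open>h \<mapsto> D k (inv h)\<close> on \<open>H\<close>.\<close>
  have "\<exists>z\<in>C.kernel_space \<inter> supported (H #> r k). \<forall>h\<in>H. cinner (lam G h z) z = D k (inv h)" for k
    by (rule C.coset_vector_exists[OF assms(4,5) C0 D _ r]) (simp_all add: C1 D1)
  then obtain z where z: "\<And>k. z k \<in> C.kernel_space" "\<And>k. z k \<in> supported (H #> r k)"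
    "\<And>k h. h \<in> H \<Longrightarrow> cinner (lam G h (z k)) (z k) = D k (inv h)"
    by (metis IntE)
  define \<zeta> where "\<zeta> k = J (z k)" for k
  have \<zeta>_lam: "cinner (\<sigma> g (\<zeta> k)) (\<zeta> l) = cinner (lam G g (z k)) (z l)" if "g \<in> carrier G" for g k l
    unfolding \<zeta>_def
    using that J(1)[OF lam.invariantD(2)[OF C.invariant_kernel_space that z(1)] z(1)] J(2)[OF that z(1)] by simp
  \<comment> \<open>An element \<open>g\<close> fixes every summand if \<open>g \<in> H\<close>, and moves each one off itself otherwise.\<close>
  have coset_eq: "g \<in> H \<longleftrightarrow> k = l"
    if g: "g \<in> carrier G" and y: "inv g \<otimes> y \<in> H #> r k" "y \<in> H #> r l" "y \<in> carrier G"
    for g y k l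
  proof -
    obtain a b where ab: "a \<in> H" "b \<in> H" "inv g \<otimes> y = a \<otimes> r k" "y = b \<otimes> r l"
      using y unfolding r_coset_def by blast
    then have eq: "b \<otimes> r l = g \<otimes> (a \<otimes> r k)"
      using g y(3) r Hc by (simp add: inv_solve_left')
    show ?thesis
    proof
      assume "g \<in> H"
      then have "g \<otimes> a \<in> H" using ab(1) by (rule subgroup.m_closed[OF sub])
      moreover have "b \<otimes> r l = (g \<otimes> a) \<otimes> r k"
        using eq g ab r Hc by (simp add: m_assoc)
      ultimately show "k = l"
        using bij_betw_imp_inj_on[OF bij_r] ab(2) unfolding inj_on_def by force
    next
      assume "k = l"
      then have "b = g \<otimes> a"
        using eq g ab r[of l] Hc by (simp flip: m_assoc)
      then have "g = b \<otimes> inv a"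
        using g ab Hc by (simp add: m_assoc)
      then show "g \<in> H"
        using ab subgroup.m_closed[OF sub] subgroup.m_inv_closed[OF sub] by blast
    qed
  qed
  have \<zeta>_orth: "cinner (\<sigma> g (\<zeta> k)) (\<zeta> l) = 0" if g: "g \<in> carrier G" and ne: "g \<in> H \<longleftrightarrow> k \<noteq> l" for g k l
    unfolding \<zeta>_lam[OF g]
  proof (rule cinner_disjoint_supported)
    show "lam G g (z k) \<in> supported {y \<in> carrier G. inv g \<otimes> y \<in> H #> r k}"
      using z(2)[of k] z(1)[of k] g by (auto simp: supported_def coord_lam C.kernel_space_def)
    show "{y \<in> carrier G. inv g \<otimes> y \<in> H #> r k} \<inter> (H #> r l) = {}"
      using coset_eq[OF g] ne by blast
  qed (rule z(2))

  have \<zeta>_sum: "(\<Sum>k\<in>UNIV. cinner (\<sigma> h (\<zeta> k)) (\<zeta> k)) = (if h = \<one> then 1 else 0)" if h: "h \<in> H" for h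
  proof -
    have hG: "h \<in> carrier G" using h Hc by blast
    show ?thesis
      unfolding \<zeta>_lam[OF hG] z(3)[OF h] sum_D using hG by simp
  qed
  show ?thesis
    by (intro exI[of _ \<zeta>] conjI ballI allI impI \<zeta>_orth \<zeta>_sum)
qed

text \<open>Take \<open>\<eta> i\<close> to be the superposition of the \<open>\<zeta> k\<close> with the values of the \<open>i\<close>-th character of the
  cyclic group of order \<open>N\<close> as coefficients, divided by \<open>\<surd>N\<close>. On \<open>H\<close> only the diagonal terms of its
  matrix coefficient survive, and they do not see the character because it has modulus one. Off \<open>H\<close>
  the diagonal terms vanish, and orthogonality of characters removes the others from the sum over \<open>i\<close>.\<close>
lemma superposed_vectors_exist:
  fixes \<zeta> :: "'n::finite \<Rightarrow> 'a"
  assumes H: "subgroup H G" and card: "CARD('n) = N"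
    and \<zeta>: "\<forall>g\<in>carrier G. \<forall>k l. (g \<in> H \<longleftrightarrow> k \<noteq> l) \<longrightarrow> cinner (\<sigma> g (\<zeta> k)) (\<zeta> l) = 0"
      "\<forall>h\<in>H. (\<Sum>k\<in>UNIV. cinner (\<sigma> h (\<zeta> k)) (\<zeta> k)) = (if h = \<one> then 1 else 0)"
  shows "\<exists>\<eta> :: 'n \<Rightarrow> 'a.
    (\<forall>h\<in>H. \<forall>i. cinner (\<sigma> h (\<eta> i)) (\<eta> i) = (if h = \<one> then 1 else 0) / of_nat N) \<and>
    (\<forall>g\<in>carrier G. (\<Sum>i\<in>UNIV. cinner (\<sigma> g (\<eta> i)) (\<eta> i)) = (if g = \<one> then 1 else 0))"
proof -
  note \<zeta>_orth = \<zeta>(1)[rule_format] and \<zeta>_sum = \<zeta>(2)[rule_format]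
  note Hc = subgroup.mem_carrier[OF H]
  have N: "N > 0" using card zero_less_card_finite[where 'a = 'n] by simp
  obtain f :: "'n \<Rightarrow> nat" where f: "bij_betw f UNIV {..<N}"
    using finite_same_card_bij[of "UNIV :: 'n set" "{..<N}"] card by auto
  define \<theta> where "\<theta> i k = cis (2 * pi * of_nat (f i) * of_int (int (f k)) / of_nat N)" for i k
  have \<theta>_unit: "\<theta> i k * cnj (\<theta> i k) = 1" for i k
    unfolding \<theta>_def cis_cnj cis_mult by simp
  have \<theta>_orth: "(\<Sum>i\<in>UNIV. \<theta> i k * cnj (\<theta> i l)) = 0" if "k \<noteq> l" for k l
  proof -
    let ?n = "int (f k) - int (f l)"
    have "f k \<noteq> f l" "f k < N" "f l < N"
      using f that unfolding bij_betw_def inj_on_def by blast+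
    then have n: "?n \<noteq> 0" "\<bar>?n\<bar> < int N" by auto
    have "real_of_int \<bar>?n\<bar> < real N" using n(2) by linarith
    then have "\<bar>real_of_int ?n\<bar> / real N < 1" using N by (simp add: field_simps)
    then have "(2 * pi) * (\<bar>real_of_int ?n\<bar> / real N) < (2 * pi) * 1"
      by (intro mult_strict_left_mono) auto
    then have "cis (2 * pi * of_int ?n / of_nat N) \<noteq> 1"
      using n(1) N by (intro cis_ne_one) (auto simp: abs_mult)
    then have "(\<Sum>i<N. cis (2 * pi * of_nat i * of_int ?n / of_nat N)) = 0"
      by (rule sum_cis_eq_0[OF N])
    then have "(\<Sum>i\<in>UNIV. cis (2 * pi * of_nat (f i) * of_int ?n / of_nat N)) = 0"
      using sum.reindex_bij_betw[OF f, of "\<lambda>i. cis (2 * pi * of_nat i * of_int ?n / of_nat N)"] by simp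
    moreover have "\<theta> i k * cnj (\<theta> i l) = cis (2 * pi * of_nat (f i) * of_int ?n / of_nat N)" for i
      unfolding \<theta>_def cis_cnj cis_mult by (rule arg_cong[of _ _ cis])
        (simp add: right_diff_distrib diff_divide_distrib)
    ultimately show ?thesis by simp
  qed

  define \<eta> where "\<eta> i = (1 / sqrt (real N)) *\<^sub>R (\<Sum>k\<in>UNIV. \<theta> i k *\<^sub>C \<zeta> k)" for i
  have action_sum: "\<sigma> g (\<Sum>k\<in>UNIV. \<theta> i k *\<^sub>C \<zeta> k) = (\<Sum>k\<in>UNIV. \<theta> i k *\<^sub>C \<sigma> g (\<zeta> k))" if "g \<in> carrier G" for g i
    using clinear_action[OF that] by (simp add: clinear_sum clinear_scaleC)
  have \<eta>_coeff: "cinner (\<sigma> g (\<eta> i)) (\<eta> i)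
      = (\<Sum>k\<in>UNIV. \<Sum>l\<in>UNIV. \<theta> i k * cnj (\<theta> i l) * cinner (\<sigma> g (\<zeta> k)) (\<zeta> l)) / of_nat N"
    if g: "g \<in> carrier G" for g i
  proof -
    have s: "complex_of_real (1 / sqrt (real N)) * (complex_of_real (1 / sqrt (real N)) * w) = w / of_nat N" for w
    proof -
      have "complex_of_real (1 / sqrt (real N)) * complex_of_real (1 / sqrt (real N)) = 1 / of_nat N"
        unfolding of_real_mult[symmetric] by (simp add: real_sqrt_mult_self)
      then show ?thesis by (simp flip: mult.assoc)
    qed
    have "cinner (\<sigma> g (\<eta> i)) (\<eta> i)
      = cinner (\<Sum>k\<in>UNIV. \<theta> i k *\<^sub>C \<sigma> g (\<zeta> k)) (\<Sum>l\<in>UNIV. \<theta> i l *\<^sub>C \<zeta> l) / of_nat N"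
      unfolding \<eta>_def clinear_scaleR[OF clinear_action[OF g]] cinner_scaleR_left cinner_scaleR_right s action_sum[OF g] ..
    also have "cinner (\<Sum>k\<in>UNIV. \<theta> i k *\<^sub>C \<sigma> g (\<zeta> k)) (\<Sum>l\<in>UNIV. \<theta> i l *\<^sub>C \<zeta> l)
      = (\<Sum>k\<in>UNIV. \<Sum>l\<in>UNIV. \<theta> i k * cnj (\<theta> i l) * cinner (\<sigma> g (\<zeta> k)) (\<zeta> l))"
      by (simp add: cinner.sum_left cinner.sum_right cinner_scaleC_left cinner_scaleC_right sum_distrib_left mult_ac)
         (rule sum.swap)
    finally show ?thesis .
  qed
  have \<eta>_H: "cinner (\<sigma> h (\<eta> i)) (\<eta> i) = (if h = \<one> then 1 else 0) / of_nat N" if h: "h \<in> H" for h i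
  proof -
    have hG: "h \<in> carrier G" using h Hc by blast
    have "(\<Sum>l\<in>UNIV. \<theta> i k * cnj (\<theta> i l) * cinner (\<sigma> h (\<zeta> k)) (\<zeta> l))
        = (\<Sum>l\<in>UNIV. if l = k then cinner (\<sigma> h (\<zeta> k)) (\<zeta> k) else 0)" for k
      by (rule sum.cong[OF refl]) (use \<zeta>_orth[OF hG] h \<theta>_unit in auto)
    then show ?thesis
      unfolding \<eta>_coeff[OF hG] \<zeta>_sum[OF h, symmetric] by simp
  qed
  have \<eta>_G: "(\<Sum>i\<in>UNIV. cinner (\<sigma> g (\<eta> i)) (\<eta> i)) = (if g = \<one> then 1 else 0)" if g: "g \<in> carrier G" for g
  proof (cases "g \<in> H")
    case True
    then show ?thesis using \<eta>_H[OF True] card N by simp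
  next
    case False
    have "(\<Sum>i\<in>UNIV. \<Sum>k\<in>UNIV. \<Sum>l\<in>UNIV. \<theta> i k * cnj (\<theta> i l) * cinner (\<sigma> g (\<zeta> k)) (\<zeta> l))
      = (\<Sum>k\<in>UNIV. \<Sum>i\<in>UNIV. \<Sum>l\<in>UNIV. \<theta> i k * cnj (\<theta> i l) * cinner (\<sigma> g (\<zeta> k)) (\<zeta> l))"
      by (rule sum.swap)
    also have "\<dots> = (\<Sum>k\<in>UNIV. \<Sum>l\<in>UNIV. \<Sum>i\<in>UNIV. \<theta> i k * cnj (\<theta> i l) * cinner (\<sigma> g (\<zeta> k)) (\<zeta> l))"
      by (intro sum.cong refl sum.swap)
    also have "\<dots> = (\<Sum>k\<in>UNIV. \<Sum>l\<in>UNIV. (\<Sum>i\<in>UNIV. \<theta> i k * cnj (\<theta> i l)) * cinner (\<sigma> g (\<zeta> k)) (\<zeta> l))"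
      by (simp add: sum_distrib_right)
    also have "\<dots> = 0"
    proof (intro sum.neutral ballI)
      fix k l
      show "(\<Sum>i\<in>UNIV. \<theta> i k * cnj (\<theta> i l)) * cinner (\<sigma> g (\<zeta> k)) (\<zeta> l) = 0"
        using \<theta>_orth[of k l] \<zeta>_orth[OF g, of k l] False by (cases "k = l") auto
    qed
    finally have "(\<Sum>i\<in>UNIV. cinner (\<sigma> g (\<eta> i)) (\<eta> i)) = 0"
      unfolding \<eta>_coeff[OF g] sum_divide_distrib[symmetric] by simp
    moreover have "g \<noteq> \<one>" using False subgroup.one_closed[OF H] by auto
    ultimately show ?thesis by simp
  qed

  show ?thesis by (intro exI[of _ \<eta>] conjI ballI allI \<eta>_H \<eta>_G)
qed

text \<open>The hypotheses say that \<open>\<surd>N \<eta> i\<close> has an orthonormal orbit under \<open>H\<close>, and the tuple \<open>\<eta>\<close> one under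
  \<open>G\<close> in the direct sum. Both representations have dimension one, so both orbits are bases.\<close>
lemma strongly_disjoint_bases_by_coefficients:
  fixes \<xi> :: 'a and \<eta> :: "'n::finite \<Rightarrow> 'a"
  assumes sub: "subgroup H G" and index: "card (rcosets H) = N" and card: "CARD('n) = N"
    and \<xi>: "parseval_frame_vector G \<sigma> \<xi>" "(norm \<xi>)\<^sup>2 = 1 / real N"
    and \<eta>: "\<forall>h\<in>H. \<forall>i. cinner (\<sigma> h (\<eta> i)) (\<eta> i) = (if h = \<one> then 1 else 0) / of_nat N"
      "\<forall>g\<in>carrier G. (\<Sum>i\<in>UNIV. cinner (\<sigma> g (\<eta> i)) (\<eta> i)) = (if g = \<one> then 1 else 0)"
  shows "strongly_disjoint G \<sigma> \<eta> \<and> (\<forall>i. orthonormal_basis H (\<lambda>h. sqrt (real N) *\<^sub>R \<sigma> h (\<eta> i)))"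
proof -
  let ?H = "G\<lparr>carrier := H\<rparr>"
  note \<eta>_H = \<eta>(1)[rule_format] and \<eta>_G = \<eta>(2)[rule_format]
  note Hc = subgroup.mem_carrier[OF sub]
  have N: "N > 0" using card zero_less_card_finite[where 'a = 'n] by simp
  obtain r :: "'n \<Rightarrow> 'g" where r: "\<And>j. r j \<in> carrier G"
    and bij_r: "bij_betw (\<lambda>(j, h). h \<otimes> r j) (UNIV \<times> H) (carrier G)"
    using transversal_exists[OF sub, where 'n = 'n] index card by metis
  have \<xi>_parseval: "((\<lambda>g. (cmod (cinner x (\<sigma> g \<xi>)))\<^sup>2) has_sum (norm x)\<^sup>2) (carrier G)" for x
    using \<xi>(1) unfolding parseval_frame_vector_def parseval_frame_def by blast
  have \<xi>_dim: "(\<Sum>j\<in>(UNIV::'n set). (norm \<xi>)\<^sup>2) = 1"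
    using \<xi>(2) card N by simp

  \<comment> \<open>Over \<open>H\<close> the vectors \<open>\<sigma> (r j) \<xi>\<close> form a Parseval family of total squared norm \<open>N \<cdot> 1/N = 1\<close>.\<close>
  have H_basis: "orthonormal_basis H (\<lambda>h. sqrt (real N) *\<^sub>R \<sigma> h (\<eta> i))" for i
  proof -
    interpret H: unitary_action ?H \<sigma> using sub by (rule unitary_action_subgroup)
    have split: "((\<lambda>(j, h). (cmod (cinner x (\<sigma> h (\<sigma> (r j) \<xi>))))\<^sup>2) has_sum (norm x)\<^sup>2) (UNIV \<times> H)" for x
    proof -
      have "((\<lambda>p. (cmod (cinner x (\<sigma> (case p of (j, h) \<Rightarrow> h \<otimes> r j) \<xi>)))\<^sup>2) has_sum (norm x)\<^sup>2) (UNIV \<times> H)"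
        using has_sum_reindex_bij_betw[OF bij_r, of "\<lambda>g. (cmod (cinner x (\<sigma> g \<xi>)))\<^sup>2"] \<xi>_parseval by blast
      then show ?thesis
        by (rule has_sum_cong[THEN iffD1, rotated]) (use r Hc in \<open>auto simp: action_mult\<close>)
    qed
    have sm: "(\<lambda>(j, h). (cmod (cinner x (\<sigma> h (\<sigma> (r j) \<xi>))))\<^sup>2) summable_on (UNIV \<times> H)" for x
      using split has_sum_imp_summable by blast
    have "orthonormal_basis (carrier ?H) (\<lambda>h. \<sigma> h (sqrt (real N) *\<^sub>R \<eta> i))"
    proof (rule H.orthonormal_orbit_basis[where J = "UNIV :: 'n set" and \<xi> = "\<lambda>j. \<sigma> (r j) \<xi>"])
      show "(\<lambda>h. (cmod (cinner x (\<sigma> h (\<sigma> (r j) \<xi>))))\<^sup>2) summable_on carrier ?H" for x j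
        using summable_on_SigmaD1[OF sm[of x], of j] by simp
      show "(\<Sum>j\<in>UNIV. \<Sum>\<^sub>\<infinity>h\<in>carrier ?H. (cmod (cinner x (\<sigma> h (\<sigma> (r j) \<xi>))))\<^sup>2) = (norm x)\<^sup>2" for x
        using infsum_Sigma'_banach[OF sm[of x]] infsumI[OF split[of x]] by simp
      show "(\<Sum>j\<in>UNIV. (norm (\<sigma> (r j) \<xi>))\<^sup>2) = 1"
        using \<xi>_dim by (simp add: norm_action r)
      show "cinner (\<sigma> h (sqrt (real N) *\<^sub>R \<eta> i)) (sqrt (real N) *\<^sub>R \<eta> i) = (if h = \<one>\<^bsub>?H\<^esub> then 1 else 0)"
        if "h \<in> carrier ?H" for h
      proof -
        have h: "h \<in> H" "h \<in> carrier G" using that Hc by auto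
        have "complex_of_real (sqrt (real N)) * complex_of_real (sqrt (real N)) = of_nat N"
          unfolding of_real_mult[symmetric] by simp
        then show ?thesis
          using N by (simp add: clinear_scaleR[OF clinear_action[OF h(2)]] cinner_scaleR_left
              cinner_scaleR_right \<eta>_H[OF h(1)] flip: mult.assoc)
      qed
    qed simp
    moreover have "\<sigma> h (sqrt (real N) *\<^sub>R \<eta> i) = sqrt (real N) *\<^sub>R \<sigma> h (\<eta> i)" if "h \<in> H" for h
      using clinear_scaleR[OF clinear_action[OF Hc[OF that]]] .
    ultimately show ?thesis
      unfolding orthonormal_basis_def by (simp cong: image_cong)
  qed

  \<comment> \<open>Over \<open>G\<close> the copies of \<open>\<xi>\<close> in the \<open>N\<close> coordinates form one for the direct sum.\<close>
  define \<Phi> :: "'g \<Rightarrow> 'a ^ 'n \<Rightarrow> 'a ^ 'n" where "\<Phi> g v = (\<chi> i. \<sigma> g (v $ i))" for g v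
  interpret \<Phi>: unitary_action G \<Phi>
  proof (intro unitary_action.intro unitary_action_axioms.intro group_axioms)
    show "clinear (\<Phi> g)" if "g \<in> carrier G" for g
      using clinear_action[OF that]
      by (intro clinearI) (simp_all add: \<Phi>_def vec_eq_iff scaleC_vec_def clinear_add clinear_scaleC)
  qed (simp_all add: \<Phi>_def vec_eq_iff cinner_vec_def cinner_action action_mult action_one)
  have cinner_axis: "cinner x (axis j y) = cinner (x $ j) y" "cinner (axis j y) x = cinner y (x $ j)" for x :: "'a ^ 'n" and j y
    by (simp_all add: cinner_vec_def axis_def if_distrib[of "\<lambda>z. cinner _ z"] if_distrib[of "\<lambda>z. cinner z _"] cong: if_cong)
  have \<Phi>_axis: "\<Phi> g (axis j y) = axis j (\<sigma> g y)" if "g \<in> carrier G" for g j y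
    using clinear_zero[OF clinear_action[OF that]] by (simp add: \<Phi>_def axis_def vec_eq_iff)
  have norm_axis: "norm (axis j y :: 'a ^ 'n) = norm y" for j y
  proof -
    have "complex_of_real ((norm (axis j y :: 'a ^ 'n))\<^sup>2) = complex_of_real ((norm y)\<^sup>2)"
      unfolding cinner_self[symmetric] cinner_axis by simp
    then show ?thesis
      unfolding of_real_eq_iff by (simp add: power2_eq_iff_nonneg)
  qed
  have norm_vec: "(\<Sum>j\<in>UNIV. (norm (x $ j))\<^sup>2) = (norm x)\<^sup>2" for x :: "'a ^ 'n"
    by (simp add: norm_vec_def L2_set_def sum_nonneg)
  have "orthonormal_basis (carrier G) (\<lambda>g. \<Phi> g (\<chi> i. \<eta> i))"
  proof (rule \<Phi>.orthonormal_orbit_basis[where J = "UNIV :: 'n set" and \<xi> = "\<lambda>j. axis j \<xi>"])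
    have *: "((\<lambda>g. (cmod (cinner x (\<Phi> g (axis j \<xi>))))\<^sup>2) has_sum (norm (x $ j))\<^sup>2) (carrier G)" for x j
      using \<xi>_parseval[of "x $ j"]
      by (rule has_sum_cong[THEN iffD1, rotated]) (simp add: \<Phi>_axis cinner_axis)
    show "(\<lambda>g. (cmod (cinner x (\<Phi> g (axis j \<xi>))))\<^sup>2) summable_on carrier G" for x j
      using * has_sum_imp_summable by blast
    show "(\<Sum>j\<in>UNIV. \<Sum>\<^sub>\<infinity>g\<in>carrier G. (cmod (cinner x (\<Phi> g (axis j \<xi>))))\<^sup>2) = (norm x)\<^sup>2" for x
      unfolding infsumI[OF *] by (rule norm_vec)
    show "(\<Sum>j\<in>(UNIV::'n set). (norm (axis j \<xi> :: 'a ^ 'n))\<^sup>2) = 1"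
      unfolding norm_axis by (rule \<xi>_dim)
    show "cinner (\<Phi> g (\<chi> i. \<eta> i)) (\<chi> i. \<eta> i) = (if g = \<one> then 1 else 0)" if "g \<in> carrier G" for g
      using \<eta>_G[OF that] by (simp add: \<Phi>_def cinner_vec_def)
  qed simp
  then have G_frame: "parseval_frame (carrier G) (\<lambda>g. \<Phi> g (\<chi> i. \<eta> i))"
    by (rule orthonormal_basis_parseval_frame)
  have "parseval_frame_vector G \<sigma> (\<eta> i)" for i
    unfolding parseval_frame_vector_def parseval_frame_def
  proof
    fix x
    have "((\<lambda>g. (cmod (cinner (axis i x) (\<Phi> g (\<chi> i. \<eta> i))))\<^sup>2) has_sum (norm (axis i x :: 'a ^ 'n))\<^sup>2) (carrier G)"
      using G_frame unfolding parseval_frame_def by blast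
    then show "((\<lambda>g. (cmod (cinner x (\<sigma> g (\<eta> i))))\<^sup>2) has_sum (norm x)\<^sup>2) (carrier G)"
      unfolding cinner_axis norm_axis by (simp add: \<Phi>_def)
  qed
  moreover have "parseval_frame (carrier G) (\<lambda>g. (\<chi> i. \<sigma> g (\<eta> i)) :: 'a ^ 'n)"
    using G_frame by (simp add: \<Phi>_def)
  ultimately have "strongly_disjoint G \<sigma> \<eta>"
    unfolding strongly_disjoint_def by blast
  then show ?thesis using H_basis by blast
qed

end

theorem theorem3p3:
  fixes G :: "('g, 'm) monoid_scheme"
    and H :: "'g set"
    and \<pi> :: "'g \<Rightarrow> 'h::chilbert_space \<Rightarrow> 'h"
    and \<xi> :: 'h
    and N :: nat
  assumes "countable (carrier G)"
    and "icc_group G"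
    and "unitary_representation G \<pi>"
    and "parseval_frame_vector G \<pi> \<xi>"
    and "(norm \<xi>)\<^sup>2 = 1 / real N"
    and "H \<lhd> G"
    and "icc_group (G\<lparr>carrier := H\<rparr>)"
    and "card (rcosets\<^bsub>G\<^esub> H) = N"
    and "\<exists>h\<in>H. group.ord G h = 0"
    and "CARD('n::finite) = N"
  shows "\<exists>\<eta> :: 'n \<Rightarrow> 'h. strongly_disjoint G \<pi> \<eta> \<and>
           (\<forall>i. orthonormal_basis H (\<lambda>h. sqrt (real N) *\<^sub>R \<pi> h (\<eta> i)))"
proof -
  interpret group G using assms(2) by (simp add: icc_group_def)
  interpret unitary_action G \<pi>
    by (rule unitary_representation_imp_action[OF group_axioms assms(3)])
  have sub: "subgroup H G" using assms(6) by (rule normal_imp_subgroup)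
  obtain u where u: "u \<in> H" "ord u = 0" using assms(9) by blast
  obtain \<zeta> :: "'n \<Rightarrow> 'h"
    where \<zeta>: "\<forall>g\<in>carrier G. \<forall>k l. (g \<in> H \<longleftrightarrow> k \<noteq> l) \<longrightarrow> cinner (\<pi> g (\<zeta> k)) (\<zeta> l) = 0"
      "\<forall>h\<in>H. (\<Sum>k\<in>UNIV. cinner (\<pi> h (\<zeta> k)) (\<zeta> k)) = (if h = \<one>\<^bsub>G\<^esub> then 1 else 0)"
    using imprimitive_vectors_exist[OF assms(2,4,5,6,7,8) u assms(10)] by (elim exE conjE) (rule that)
  obtain \<eta> :: "'n \<Rightarrow> 'h"
    where \<eta>: "\<forall>h\<in>H. \<forall>i. cinner (\<pi> h (\<eta> i)) (\<eta> i) = (if h = \<one>\<^bsub>G\<^esub> then 1 else 0) / of_nat N"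
      "\<forall>g\<in>carrier G. (\<Sum>i\<in>UNIV. cinner (\<pi> g (\<eta> i)) (\<eta> i)) = (if g = \<one>\<^bsub>G\<^esub> then 1 else 0)"
    using superposed_vectors_exist[OF sub assms(10) \<zeta>] by (elim exE conjE) (rule that)
  show ?thesis
    by (rule exI[of _ \<eta>], rule strongly_disjoint_bases_by_coefficients[OF sub assms(8,10,4,5) \<eta>])
qed

end
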